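(* Let $X$ be a Banach space and let $\Gamma:[0,1]\to cwk(X)$ be a multifunction. Then the following conditions are equivalent: (i) $\Gamma$ is Birkhoff integrable; (ii) $\Gamma$ is $\mathcal{H}$-integrable and $\mathcal{S}_{\mathcal{H}}(\Gamma)\subset\mathcal{S}_{Bi}(\Gamma)$; (iii) $\Gamma$ is $\mathcal{H}$-integrable and $\mathcal{S}_{\mathcal{H}}(\Gamma)\subset\mathcal{S}_{MS}(\Gamma)$; (iv) $\Gamma$ is $\mathcal{H}$-integrable and $\mathcal{S}_{\mathcal{H}}(\Gamma)\subset\mathcal{S}_P(\Gamma)$; (v) $\Gamma$ is $\mathcal{H}$-integrable and $\mathcal{S}_P(\Gamma)\neq\emptyset$; (vi) $\Gamma$ is Pettis and $\mathcal{H}$-integrable.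
   Context: $X$ is an arbitrary (not necessarily separable) real Banach space with dual $X^*$, and $cwk(X)$ is the family of all non-empty convex weakly compact subsets of $X$, with Minkowski addition, multiplication by positive scalars, and the Hausdorff distance $d_H$. The support function is $s(x^*,C)=\sup\{\langle x^*,x\rangle:x\in C\}$. A multifunction is a map $\Gamma:[0,1]\to cwk(X)$; a selection of $\Gamma$ is a function $f:[0,1]\to X$ with $f(t)\in\Gamma(t)$ for every $t\in[0,1]$. $\lambda$ is Lebesgue measure on $[0,1]$ and $\mathcal{L}$ the family of Lebesgue measurable subsets of $[0,1]$. A gauge is any strictly positive function $\delta$ on $[0,1]$. A partition of $[0,1]$ is a finite collection $\{(I_1,t_1),\dots,(I_p,t_p)\}$ of nonoverlapping closed subintervals $I_i$ with union $[0,1]$ and points $t_i\in[0,1]$; it is a Perron partition if $t_i\in I_i$ for all $i$; it is $\delta$-fine if $I_i\subset(t_i-\delta(t_i),t_i+\delta(t_i))$ for all $i$. $\Gamma$ is McShane integrable on $[0,1]$ if there is $\Phi_\Gamma([0,1])\in cwk(X)$ such that for every $\varepsilon>0$ there is a gauge $\delta$ with $d_H\big(\Phi_\Gamma([0,1]),\sum_{i=1}^p\Gamma(t_i)|I_i|\big)<\varepsilon$ for every $\delta$-fine partition of $[0,1]$. $\Gamma$ is $\mathcal{H}$-integrable on $[0,1]$ if there is $\Phi_\Gamma([0,1])\in cwk(X)$ such that for every $\varepsilon>0$ there is a Lebesgue measurable gauge $\delta$ such that the same inequality holds for every $\delta$-fine Perron partition of $[0,1]$. $\Gamma$ is Birkhoff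 integrable on $[0,1]$ if there is $\Phi_\Gamma([0,1])\in cwk(X)$ such that for every $\varepsilon>0$ there is a countable partition $\mathcal{P}_0$ of $[0,1]$ into sets of $\mathcal{L}$ such that for every countable partition $(A_n)_n$ of $[0,1]$ into sets of $\mathcal{L}$ finer than $\mathcal{P}_0$ and any choice of $t_n\in A_n$, the series $\sum_n\lambda(A_n)\Gamma(t_n)$ is unconditionally convergent (in the Hausdorff metric) and $d_H\big(\Phi_\Gamma([0,1]),\sum_n\Gamma(t_n)\lambda(A_n)\big)<\varepsilon$ (empty sets $A_n$ are allowed and contribute nothing). $\Gamma$ is Pettis integrable if for every $x^*\in X^*$ the function $s(x^*,\Gamma(\cdot))$ is Lebesgue integrable and for each $A\in\mathcal{L}$ there is $W_A\in cwk(X)$ with $s(x^*,W_A)=\int_A s(x^*,\Gamma)\,d\lambda$ for every $x^*\in X^*$. For functions $f:[0,1]\to X$ these notions are applied to $t\mapsto\{f(t)\}$ (with integral in $X$ and norm distance). $\mathcal{S}_{\mathcal{H}}(\Gamma)$, $\mathcal{S}_{Bi}(\Gamma)$, $\mathcal{S}_{MS}(\Gamma)$, $\mathcal{S}_P(\Gamma)$ are the sets of selections of $\Gamma$ that are, respectively, $\mathcal{H}$-, Birkhoff, McShane, Pettis integrable. *)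

theory Defs
  imports "HOL-Analysis.Analysis"
begin

subsection \<open>Convex weakly compact sets\<close>

definition weak_topology :: "'a::real_normed_vector topology" where
  "weak_topology =
     topology_generated_by {blinfun_apply f -` U | (f :: 'a \<Rightarrow>\<^sub>L real) U. open U}"

definition cwk :: "'a::real_normed_vector set set" where
  "cwk = {C. C \<noteq> {} \<and> convex C \<and> compactin weak_topology C}"

text \<open>
  Both functions below are meaningful on non-empty norm-bounded sets only, which is the case on
  \<^const>\<open>cwk\<close>; suprema are taken in the reals.
\<close>

definition support_fun :: "('a::real_normed_vector \<Rightarrow>\<^sub>L real) \<Rightarrow> 'a set \<Rightarrow> real" where
  "support_fun f C = (SUP x\<in>C. blinfun_apply f x)"

definition hausdorff_dist :: "'a::metric_space set \<Rightarrow> 'a set \<Rightarrow> real" where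
  "hausdorff_dist C D = max (SUP x\<in>C. infdist x D) (SUP y\<in>D. infdist y C)"

lemma topspace_weak_topology [simp]: "topspace weak_topology = UNIV"
proof -
  have "UNIV \<in> {blinfun_apply f -` U | (f :: 'a \<Rightarrow>\<^sub>L real) U. open U}"
    by (auto intro!: exI[of _ UNIV])
  then show ?thesis
    unfolding weak_topology_def topology_generated_by_topspace by blast
qed

lemma hausdorff_dist_singletons [simp]: "hausdorff_dist {x} {y} = dist x y"
  by (simp add: hausdorff_dist_def dist_commute)

lemma support_fun_singleton [simp]: "support_fun f {x} = blinfun_apply f x"
  by (simp add: support_fun_def)

subsection \<open>Riemann-type integrals\<close>

text \<open>
  Partitions are finite sets of pairs (tag, interval), the order of components used by
  \<^const>\<open>tagged_division_of\<close>. For the McShane integral tags need not lie in their intervals; the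
  Perron partitions of \<open>[0,1]\<close> are the library's tagged divisions of \<open>{0..1}\<close>.
\<close>

definition free_tagged_partition :: "(real \<times> real set) set \<Rightarrow> bool" where
  "free_tagged_partition p \<longleftrightarrow>
     finite p \<and>
     (\<forall>(t, I)\<in>p. t \<in> {0..1} \<and> (\<exists>a b. a \<le> b \<and> I = {a..b})) \<and>
     (\<forall>P\<in>p. \<forall>Q\<in>p. P \<noteq> Q \<longrightarrow> interior (snd P) \<inter> interior (snd Q) = {}) \<and>
     \<Union> (snd ` p) = {0..1}"

lemma tagged_division_iff_free_tagged_partition:
  "p tagged_division_of {0..1::real} \<longleftrightarrow>
     free_tagged_partition p \<and> (\<forall>(t, I)\<in>p. t \<in> I)"
proof -
  have U: "\<Union>{K. \<exists>x. (x, K) \<in> p} = \<Union> (snd ` p)"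
    by force
  show ?thesis
  proof
    assume p: "p tagged_division_of {0..1::real}"
    have *: "t \<in> {0..1} \<and> (\<exists>a b. a \<le> b \<and> I = {a..b}) \<and> t \<in> I" if tI: "(t, I) \<in> p" for t I
    proof -
      obtain a b where "I = cbox a b"
        using tagged_division_ofD(4)[OF p tI] by blast
      moreover have "t \<in> I" "I \<subseteq> {0..1}"
        using tagged_division_ofD(2,3)[OF p tI] by auto
      ultimately have "I = {a..b}" "a \<le> b" "t \<in> I" "t \<in> {0..1}"
        by auto
      then show ?thesis by metis
    qed
    have "\<forall>(t, I)\<in>p. t \<in> {0..1} \<and> (\<exists>a b. a \<le> b \<and> I = {a..b})" "\<forall>(t, I)\<in>p. t \<in> I"
      by (clarify; use * in blast)+
    moreover have "interior (snd P) \<inter> interior (snd Q) = {}"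
      if "P \<in> p" "Q \<in> p" "P \<noteq> Q" for P Q
      using tagged_division_ofD(5)[OF p, of "fst P" "snd P" "fst Q" "snd Q"] that by simp
    ultimately show "free_tagged_partition p \<and> (\<forall>(t, I)\<in>p. t \<in> I)"
      using tagged_division_ofD(1)[OF p] tagged_division_ofD(6)[OF p] U
      unfolding free_tagged_partition_def by (intro conjI ballI impI) simp_all
  next
    assume "free_tagged_partition p \<and> (\<forall>(t, I)\<in>p. t \<in> I)"
    then have fin: "finite p" and cl: "\<And>t I. (t, I) \<in> p \<Longrightarrow> (\<exists>a b. I = {a..b}) \<and> t \<in> I"
      and dj: "\<And>P Q. P \<in> p \<Longrightarrow> Q \<in> p \<Longrightarrow> P \<noteq> Q \<Longrightarrow> interior (snd P) \<inter> interior (snd Q) = {}"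
      and un: "\<Union> (snd ` p) = {0..1}"
      unfolding free_tagged_partition_def by (simp, fast, simp, simp)
    show "p tagged_division_of {0..1::real}"
    proof (rule tagged_division_ofI)
      show "finite p" by (rule fin)
      show "\<Union>{K. \<exists>x. (x, K) \<in> p} = {0..1}" using U un by simp
    next
      fix x K assume xK: "(x, K) \<in> p"
      show "x \<in> K" using cl[OF xK] by simp
      show "\<exists>a b. K = cbox a b" using cl[OF xK] by simp
      show "K \<subseteq> {0..1}" using un imageI[OF xK, of snd] by auto
    next
      fix x1 K1 x2 K2 assume "(x1, K1) \<in> p" "(x2, K2) \<in> p" "(x1, K1) \<noteq> (x2, K2)"
      then show "interior K1 \<inter> interior K2 = {}" using dj[of "(x1, K1)" "(x2, K2)"] by simp
    qed
  qed
qed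

definition riemann_sum :: "(real \<Rightarrow> 'a::real_normed_vector set) \<Rightarrow> (real \<times> real set) set \<Rightarrow> 'a set"
  where "riemann_sum \<Gamma> p = (\<Sum>(t, I)\<in>p. (*\<^sub>R) (measure lborel I) ` \<Gamma> t)"

definition is_mcshane_integral :: "(real \<Rightarrow> 'a::real_normed_vector set) \<Rightarrow> 'a set \<Rightarrow> bool" where
  "is_mcshane_integral \<Gamma> W \<longleftrightarrow>
     (\<forall>\<epsilon>>0. \<exists>\<delta> :: real \<Rightarrow> real. (\<forall>t\<in>{0..1}. \<delta> t > 0) \<and>
        (\<forall>p. free_tagged_partition p \<and> (\<lambda>t. ball t (\<delta> t)) fine p \<longrightarrow>
           hausdorff_dist W (riemann_sum \<Gamma> p) < \<epsilon>))"

definition is_H_integral :: "(real \<Rightarrow> 'a::real_normed_vector set) \<Rightarrow> 'a set \<Rightarrow> bool" where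
  "is_H_integral \<Gamma> W \<longleftrightarrow>
     (\<forall>\<epsilon>>0. \<exists>\<delta> :: real \<Rightarrow> real. (\<forall>t\<in>{0..1}. \<delta> t > 0) \<and>
        \<delta> \<in> borel_measurable (lebesgue_on {0..1}) \<and>
        (\<forall>p. p tagged_division_of {0..1} \<and> (\<lambda>t. ball t (\<delta> t)) fine p \<longrightarrow>
           hausdorff_dist W (riemann_sum \<Gamma> p) < \<epsilon>))"

subsection \<open>The Birkhoff integral\<close>

definition set_sums :: "(nat \<Rightarrow> 'a::real_normed_vector set) \<Rightarrow> 'a set \<Rightarrow> bool" where
  "set_sums C S \<longleftrightarrow> S \<in> cwk \<and> (\<lambda>n. hausdorff_dist (\<Sum>k<n. C k) S) \<longlonglongrightarrow> 0"

definition unconditionally_convergent :: "(nat \<Rightarrow> 'a::real_normed_vector set) \<Rightarrow> bool" where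
  "unconditionally_convergent C \<longleftrightarrow> (\<forall>\<pi>. bij \<pi> \<longrightarrow> (\<exists>S. set_sums (C \<circ> \<pi>) S))"

text \<open>
  Countable partitions are sequences whose members may be empty, so that finite partitions are
  included.
\<close>

definition countable_partition :: "(nat \<Rightarrow> real set) \<Rightarrow> bool" where
  "countable_partition A \<longleftrightarrow>
     (\<forall>n. A n \<in> sets (lebesgue_on {0..1})) \<and> disjoint_family A \<and> (\<Union>n. A n) = {0..1}"

text \<open>
  For empty \<open>A n\<close> the point \<open>t n\<close> is unconstrained, hence the case distinction: \<open>\<Gamma> (t n)\<close> might be
  the empty set, whose multiple by 0 is empty and not \<open>{0}\<close>.
\<close>

definition birkhoff_term ::
  "(real \<Rightarrow> 'a::real_normed_vector set) \<Rightarrow> (nat \<Rightarrow> real set) \<Rightarrow> (nat \<Rightarrow> real) \<Rightarrow> nat \<Rightarrow> 'a set" where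
  "birkhoff_term \<Gamma> A t n =
     (if A n = {} then {0} else (*\<^sub>R) (measure lebesgue (A n)) ` \<Gamma> (t n))"

definition is_birkhoff_integral :: "(real \<Rightarrow> 'a::real_normed_vector set) \<Rightarrow> 'a set \<Rightarrow> bool" where
  "is_birkhoff_integral \<Gamma> W \<longleftrightarrow>
     (\<forall>\<epsilon>>0. \<exists>B. countable_partition B \<and>
        (\<forall>A t. countable_partition A \<and> (\<forall>n. \<exists>m. A n \<subseteq> B m) \<and> (\<forall>n. A n \<noteq> {} \<longrightarrow> t n \<in> A n) \<longrightarrow>
           unconditionally_convergent (birkhoff_term \<Gamma> A t) \<and>
           (\<exists>S. set_sums (birkhoff_term \<Gamma> A t) S \<and> hausdorff_dist W S < \<epsilon>)))"

subsection \<open>The Pettis integral\<close>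

definition scalarly_integrable :: "(real \<Rightarrow> 'a::real_normed_vector set) \<Rightarrow> bool" where
  "scalarly_integrable \<Gamma> \<longleftrightarrow>
     (\<forall>f. integrable (lebesgue_on {0..1}) (\<lambda>t. support_fun f (\<Gamma> t)))"

definition is_pettis_integral ::
  "(real \<Rightarrow> 'a::real_normed_vector set) \<Rightarrow> real set \<Rightarrow> 'a set \<Rightarrow> bool" where
  "is_pettis_integral \<Gamma> A W \<longleftrightarrow>
     (\<forall>f. support_fun f W = (LINT t:A|lebesgue. support_fun f (\<Gamma> t)))"

subsection \<open>Integrability of multifunctions\<close>

definition mcshane_integrable :: "(real \<Rightarrow> 'a::real_normed_vector set) \<Rightarrow> bool" where
  "mcshane_integrable \<Gamma> \<longleftrightarrow> (\<exists>W\<in>cwk. is_mcshane_integral \<Gamma> W)"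

definition H_integrable :: "(real \<Rightarrow> 'a::real_normed_vector set) \<Rightarrow> bool" where
  "H_integrable \<Gamma> \<longleftrightarrow> (\<exists>W\<in>cwk. is_H_integral \<Gamma> W)"

definition birkhoff_integrable :: "(real \<Rightarrow> 'a::real_normed_vector set) \<Rightarrow> bool" where
  "birkhoff_integrable \<Gamma> \<longleftrightarrow> (\<exists>W\<in>cwk. is_birkhoff_integral \<Gamma> W)"

definition pettis_integrable :: "(real \<Rightarrow> 'a::real_normed_vector set) \<Rightarrow> bool" where
  "pettis_integrable \<Gamma> \<longleftrightarrow> scalarly_integrable \<Gamma> \<and>
     (\<forall>A\<in>sets (lebesgue_on {0..1}). \<exists>W\<in>cwk. is_pettis_integral \<Gamma> A W)"

subsection \<open>Integrable selections\<close>

text \<open>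
  For functions the integral is a vector: between singletons the Hausdorff distance is the norm
  distance, as proved in the lemma \<open>hausdorff_dist_singletons\<close>.
\<close>

definition mcshane_integrable_fun :: "(real \<Rightarrow> 'a::real_normed_vector) \<Rightarrow> bool" where
  "mcshane_integrable_fun f \<longleftrightarrow> (\<exists>w. is_mcshane_integral (\<lambda>t. {f t}) {w})"

definition H_integrable_fun :: "(real \<Rightarrow> 'a::real_normed_vector) \<Rightarrow> bool" where
  "H_integrable_fun f \<longleftrightarrow> (\<exists>w. is_H_integral (\<lambda>t. {f t}) {w})"

definition birkhoff_integrable_fun :: "(real \<Rightarrow> 'a::real_normed_vector) \<Rightarrow> bool" where
  "birkhoff_integrable_fun f \<longleftrightarrow> (\<exists>w. is_birkhoff_integral (\<lambda>t. {f t}) {w})"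

definition pettis_integrable_fun :: "(real \<Rightarrow> 'a::real_normed_vector) \<Rightarrow> bool" where
  "pettis_integrable_fun f \<longleftrightarrow> scalarly_integrable (\<lambda>t. {f t}) \<and>
     (\<forall>A\<in>sets (lebesgue_on {0..1}). \<exists>w. is_pettis_integral (\<lambda>t. {f t}) A {w})"

definition selections :: "(real \<Rightarrow> 'a set) \<Rightarrow> (real \<Rightarrow> 'a) set" where
  "selections \<Gamma> = {f. \<forall>t\<in>{0..1}. f t \<in> \<Gamma> t}"

definition S_H :: "(real \<Rightarrow> 'a::real_normed_vector set) \<Rightarrow> (real \<Rightarrow> 'a) set" where
  "S_H \<Gamma> = {f \<in> selections \<Gamma>. H_integrable_fun f}"

definition S_Bi :: "(real \<Rightarrow> 'a::real_normed_vector set) \<Rightarrow> (real \<Rightarrow> 'a) set" where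
  "S_Bi \<Gamma> = {f \<in> selections \<Gamma>. birkhoff_integrable_fun f}"

definition S_MS :: "(real \<Rightarrow> 'a::real_normed_vector set) \<Rightarrow> (real \<Rightarrow> 'a) set" where
  "S_MS \<Gamma> = {f \<in> selections \<Gamma>. mcshane_integrable_fun f}"

definition S_P :: "(real \<Rightarrow> 'a::real_normed_vector set) \<Rightarrow> (real \<Rightarrow> 'a) set" where
  "S_P \<Gamma> = {f \<in> selections \<Gamma>. pettis_integrable_fun f}"

end

theory Submission imports Defs
begin

text \<open>
  A set in \<open>cwk\<close> is determined by its support function, and the Hausdorff distance is the uniform
  distance of the support functions on the unit ball of the dual. So \<open>\<Gamma>\<close> may be replaced by the
  real functions \<open>\<phi>\<^sub>f(t) = support_fun f (\<Gamma> t)\<close>, estimated uniformly in \<open>\<parallel>f\<parallel> \<le> 1\<close>; conversely, a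
  sublinear functional that is approximated on the unit ball by support functions of sets in
  \<open>cwk\<close> is itself such a support function, which yields the values of the Pettis integral.

  A measurable gauge for a Henstock integral exceeds \<open>1/N\<close> off a set of small measure, so
  interchanging tags in cells of length \<open>1/N\<close> bounds the oscillations of \<open>\<Gamma>\<close> there. Iterating gives
  a countable partition on which the Riemann sums are almost independent of the tags, and the uniform
  countable additivity of the Pettis integral makes the series converge: Henstock and Pettis
  integrability give Birkhoff integrability. Conversely, approximating the members of a Birkhoff
  partition from outside by open sets produces a measurable gauge for free tagged partitions,
  and McShane integrability implies Pettis integrability.

  Finally, a Henstock integrable \<open>\<Gamma>\<close> has a Henstock integrable selection: the integral has a
  strongly exposed point, and the selection maximizes the exposing functional.
\<close>

section \<open>The Hahn-Banach theorem\<close>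

text \<open>\<open>X\<close> may be nonseparable, so its dual ball need not contain a countable
  norming set, and null sets that depend on the functional cannot be discarded together. Therefore
  each gauge, partition or index is fixed before the functional is quantified, every bound is
  uniform over the unit ball of the dual, and a set in \<open>cwk\<close> is recovered from its
  support function only when all these bounds are available.

  Existence of an H-integrable selection keeps the inclusions between families of selections from
  being vacuous: without it, they would say nothing about \<open>\<Gamma>\<close>. An exposed point
  of the integral would not be enough there. The Riemann sums of the selection are caught in thin
  slices of the integral, and only strong exposedness makes thin slices small in norm; it comes from
  weak compactness and two uses of Baire-type arguments.

  Birkhoff sums are controlled only through convergence of series, not absolutely. This is why tails
  are estimated over arbitrary finite sets of indices: such bounds survive permutations and
  splitting by sign. Single functions are treated as multifunctions with singleton values, so every
  implication is proved once.\<close>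

definition sublinear :: "('v::real_vector \<Rightarrow> real) \<Rightarrow> bool" where
  "sublinear p \<longleftrightarrow> (\<forall>x y. p (x + y) \<le> p x + p y) \<and> (\<forall>x c. 0 \<le> c \<longrightarrow> p (c *\<^sub>R x) = c * p x)"

lemma sublinear_add: "sublinear p \<Longrightarrow> p (x + y) \<le> p x + p y"
  and sublinear_scale: "sublinear p \<Longrightarrow> 0 \<le> c \<Longrightarrow> p (c *\<^sub>R x) = c * p x"
  by (auto simp: sublinear_def)

text \<open>The inequality for \<open>1 / c\<close> at the point \<open>c *\<^sub>R x\<close>
  reverses the one for \<open>c\<close> at \<open>x\<close>, so one inequality for positive factors
  already gives homogeneity.\<close>

lemma sublinearI:
  fixes q :: "'v::real_vector \<Rightarrow> real"
  assumes add: "\<And>x y. q (x + y) \<le> q x + q y"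
    and half: "\<And>c x. 0 < c \<Longrightarrow> q (c *\<^sub>R x) \<le> c * q x" and q0: "q 0 = 0"
  shows "sublinear q"
proof -
  have "q (c *\<^sub>R x) = c * q x" if "0 \<le> c" for c x
  proof (cases "c = 0")
    case False
    then have c: "0 < c" using that by simp
    have "c * q x = c * q ((1 / c) *\<^sub>R (c *\<^sub>R x))" using c by simp
    also have "\<dots> \<le> c * ((1 / c) * q (c *\<^sub>R x))"
      using half[of "1 / c" "c *\<^sub>R x"] c by (intro mult_left_mono) simp_all
    also have "\<dots> = q (c *\<^sub>R x)" using c by simp
    finally show ?thesis using half[OF c, of x] by simp
  qed (simp add: q0)
  then show ?thesis using add by (simp add: sublinear_def)
qed

lemma sublinear_zero: "sublinear p \<Longrightarrow> p 0 = 0"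
  using sublinear_scale[of p 0 0] by simp

lemma sublinear_minus_ge: "sublinear p \<Longrightarrow> - p (- x) \<le> p x"
  using sublinear_add[of p x "- x"] sublinear_zero[of p] by simp

lemma sublinear_shift_lower:
  assumes "sublinear p" "0 \<le> t"
  shows "- p (- x) \<le> p (x + t *\<^sub>R y) - t * p y"
  using sublinear_add[OF assms(1), of "x + t *\<^sub>R y" "- x"] sublinear_scale[OF assms, of y]
  by (simp add: algebra_simps)

text \<open>This is the one-dimensional step of the Hahn-Banach theorem: the infimum along the ray
  in direction \<open>y\<close> stays sublinear, and \<open>q (- y) \<le> - p y \<le> - q y\<close>
  forces \<open>q\<close> to be odd at \<open>y\<close>. It serves twice: to prescribe a value at
  one vector, and to show that minimal sublinear functions are odd.\<close>

lemma sublinear_shift: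
  fixes p :: "'v::real_vector \<Rightarrow> real"
  assumes p: "sublinear p"
  obtains q where "sublinear q" "\<And>x. q x \<le> p x" "q (- y) \<le> - p y"
proof -
  define q where "q x = (INF t\<in>{0..}. p (x + t *\<^sub>R y) - t * p y)" for x
  have bdd: "bdd_below ((\<lambda>t. p (x + t *\<^sub>R y) - t * p y) ` {0..})" for x
    using sublinear_shift_lower[OF p] by (intro bdd_belowI[of _ "- p (- x)"]) auto
  have le: "q x \<le> p (x + t *\<^sub>R y) - t * p y" if "0 \<le> t" for x t
    unfolding q_def using bdd that by (intro cINF_lower) auto
  have ge: "r \<le> q x" if "\<And>t. 0 \<le> t \<Longrightarrow> r \<le> p (x + t *\<^sub>R y) - t * p y" for r x
    unfolding q_def using that by (intro cINF_greatest) auto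
  have add: "q (x + z) \<le> q x + q z" for x z
  proof -
    have "q (x + z) - (p (x + t *\<^sub>R y) - t * p y) \<le> q z" if t: "0 \<le> t" for t
    proof (rule ge)
      fix s :: real assume s: "0 \<le> s"
      have "q (x + z) \<le> p ((x + t *\<^sub>R y) + (z + s *\<^sub>R y)) - (t + s) * p y"
        using le[of "t + s" "x + z"] s t by (simp add: algebra_simps)
      also have "\<dots> \<le> p (x + t *\<^sub>R y) + p (z + s *\<^sub>R y) - (t + s) * p y"
        using sublinear_add[OF p] by simp
      finally show "q (x + z) - (p (x + t *\<^sub>R y) - t * p y) \<le> p (z + s *\<^sub>R y) - s * p y"
        by (simp add: algebra_simps)
    qed
    then have "q (x + z) - q z \<le> q x"
      by (intro ge) (simp add: algebra_simps)
    then show ?thesis by simp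
  qed
  have half: "q (c *\<^sub>R x) \<le> c * q x" if c: "0 < c" for c x
  proof -
    have "q (c *\<^sub>R x) / c \<le> q x"
    proof (rule ge)
      fix t :: real assume t: "0 \<le> t"
      have "q (c *\<^sub>R x) \<le> p (c *\<^sub>R (x + t *\<^sub>R y)) - (c * t) * p y"
        using le[of "c * t" "c *\<^sub>R x"] c t by (simp add: algebra_simps)
      also have "\<dots> = c * (p (x + t *\<^sub>R y) - t * p y)"
        unfolding sublinear_scale[OF p less_imp_le[OF c]] by (simp add: right_diff_distrib)
      finally show "q (c *\<^sub>R x) / c \<le> p (x + t *\<^sub>R y) - t * p y"
        using c by (simp add: field_simps)
    qed
    then show ?thesis using c by (simp add: field_simps)
  qed
  have q0: "q 0 = 0"
  proof (rule antisym)
    show "q 0 \<le> 0" using le[of 0 0] sublinear_zero[OF p] by simp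
    show "0 \<le> q 0" by (rule ge) (simp add: sublinear_scale[OF p])
  qed
  show thesis
  proof
    show "sublinear q" using add half q0 by (rule sublinearI)
    show "q x \<le> p x" for x using le[of 0 x] by simp
    show "q (- y) \<le> - p y" using le[of 1 "- y"] sublinear_zero[OF p] by simp
  qed
qed

text \<open>Zorn's lemma for the reversed order. Along a chain the pointwise infimum is finite,
  because every sublinear \<open>q \<le> p\<close> is bounded below by \<open>- p (- x)\<close>; it
  is subadditive, because of two members of a chain one lies below the other.\<close>

lemma minimal_sublinear_exists:
  fixes p :: "'v::real_vector \<Rightarrow> real"
  assumes p: "sublinear p"
  obtains m where "sublinear m" "\<And>x. m x \<le> p x"
    "\<And>q. sublinear q \<Longrightarrow> (\<And>x. q x \<le> m x) \<Longrightarrow> q = m"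
proof -
  define S where "S = {q. sublinear q \<and> q \<le> p}"
  define P where "P = (\<lambda>q r :: 'v \<Rightarrow> real. r \<le> q)"
  have "\<exists>m\<in>S. \<forall>a\<in>S. P m a \<longrightarrow> a = m"
  proof (rule predicate_Zorn)
    show "partial_order_on S (relation_of P S)"
      by (rule partial_order_on_relation_ofI) (auto simp: P_def)
  next
    fix C assume "C \<in> Chains (relation_of P S)"
    then have CS: "C \<subseteq> S" and tot: "\<And>a b. a \<in> C \<Longrightarrow> b \<in> C \<Longrightarrow> a \<le> b \<or> b \<le> a"
      by (auto simp: Chains_def relation_of_def P_def)
    show "\<exists>u\<in>S. \<forall>a\<in>C. P a u"
    proof (cases "C = {}")
      case True
      then show ?thesis using p by (auto simp: S_def)
    next
      case ne: False
      define u where "u x = (INF q\<in>C. q x)" for x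
      have lower: "- p (- x) \<le> q x" if "q \<in> C" for q x
      proof -
        have "sublinear q" "q \<le> p" using that CS by (auto simp: S_def)
        then show ?thesis using sublinear_minus_ge[of q x] le_funD[of q p "- x"] by simp
      qed
      have bdd: "bdd_below ((\<lambda>q. q x) ` C)" for x
        using lower by (intro bdd_belowI[of _ "- p (- x)"]) auto
      have le: "u x \<le> q x" if "q \<in> C" for q x
        unfolding u_def using bdd that by (intro cINF_lower) auto
      have ge: "r \<le> u x" if "\<And>q. q \<in> C \<Longrightarrow> r \<le> q x" for r x
        unfolding u_def using that ne by (intro cINF_greatest) auto
      have sub: "sublinear q" if "q \<in> C" for q using that CS by (auto simp: S_def)
      have "u (x + y) \<le> u x + u y" for x y
      proof -
        have "u (x + y) - q x \<le> u y" if q: "q \<in> C" for q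
        proof (rule ge)
          fix r assume r: "r \<in> C"
          obtain s where s: "s \<in> C" "s \<le> q" "s \<le> r" using tot[OF q r] q r by blast
          have "u (x + y) \<le> s x + s y"
            using le[OF s(1), of "x + y"] sublinear_add[OF sub[OF s(1)], of x y] by linarith
          then show "u (x + y) - q x \<le> r y"
            using le_funD[OF s(2), of x] le_funD[OF s(3), of y] by linarith
        qed
        then have "u (x + y) - u y \<le> u x"
          by (intro ge) (simp add: algebra_simps)
        then show ?thesis by simp
      qed
      moreover have "u (c *\<^sub>R x) \<le> c * u x" if c: "0 < c" for c x
      proof -
        have "u (c *\<^sub>R x) / c \<le> u x"
          using le[of _ "c *\<^sub>R x"] sublinear_scale[OF sub less_imp_le[OF c]] c
          by (intro ge) (simp add: field_simps)
        then show ?thesis using c by (simp add: field_simps)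
      qed
      moreover have "u 0 = 0"
      proof (rule antisym)
        show "0 \<le> u 0" by (rule ge) (simp add: sublinear_zero[OF sub])
        obtain q where q: "q \<in> C" using ne by blast
        show "u 0 \<le> 0" using le[OF q, of 0] sublinear_zero[OF sub[OF q]] by simp
      qed
      ultimately have "sublinear u" by (intro sublinearI)
      moreover have "u \<le> p"
      proof -
        obtain q where q: "q \<in> C" using ne by blast
        then have "q \<le> p" using CS by (auto simp: S_def)
        then show ?thesis using le[OF q] by (auto simp: le_fun_def intro: order_trans)
      qed
      ultimately show ?thesis using le by (intro bexI[of _ u]) (auto simp: S_def P_def le_fun_def)
    qed
  qed
  then obtain m where m: "m \<in> S" "\<And>a. a \<in> S \<Longrightarrow> a \<le> m \<Longrightarrow> a = m"
    by (auto simp: P_def)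
  show thesis
  proof
    show "sublinear m" "\<And>x. m x \<le> p x" using m(1) by (auto simp: S_def le_fun_def)
    show "q = m" if "sublinear q" "\<And>x. q x \<le> m x" for q
      using m(1) that by (intro m(2)) (auto simp: S_def le_fun_def intro: order_trans)
  qed
qed

text \<open>Shifting \<open>m\<close> along \<open>y\<close> yields a sublinear function below
  \<open>m\<close>, hence \<open>m\<close> itself. So \<open>m\<close> is odd, and an odd
  subadditive function is additive.\<close>

lemma minimal_sublinear_linear:
  assumes m: "sublinear m" and min: "\<And>q. sublinear q \<Longrightarrow> (\<And>x. q x \<le> m x) \<Longrightarrow> q = m"
  shows "linear m"
proof -
  have odd: "m (- y) = - m y" for y
  proof -
    obtain q where "sublinear q" "\<And>x. q x \<le> m x" "q (- y) \<le> - m y"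
      using sublinear_shift[OF m] by blast
    then have "m (- y) \<le> - m y" using min by metis
    then show ?thesis using sublinear_minus_ge[OF m, of y] by simp
  qed
  show ?thesis
  proof (rule linearI)
    fix x y
    show "m (x + y) = m x + m y"
      using sublinear_add[OF m, of x y] sublinear_add[OF m, of "- x" "- y"]
        odd[of x] odd[of y] odd[of "x + y"] by simp
    show "m (c *\<^sub>R x) = c *\<^sub>R m x" for c
    proof (cases "0 \<le> c")
      case False
      then show ?thesis using sublinear_scale[OF m, of "- c" x] odd[of "c *\<^sub>R x"] by simp
    qed (simp add: sublinear_scale[OF m])
  qed
qed

theorem Hahn_Banach_sublinear:
  fixes p :: "'v::real_vector \<Rightarrow> real"
  assumes p: "sublinear p"
  obtains l where "linear l" "\<And>x. l x \<le> p x" "l y = p y"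
proof -
  \<comment> \<open>Shifting before minimizing fixes the value at \<open>y\<close>: whatever lies
    below \<open>q\<close> is at most \<open>- p y\<close> at \<open>- y\<close>.\<close>
  obtain q where q: "sublinear q" "\<And>x. q x \<le> p x" "q (- y) \<le> - p y"
    using sublinear_shift[OF p] by blast
  obtain m where m: "sublinear m" "\<And>x. m x \<le> q x"
    "\<And>r. sublinear r \<Longrightarrow> (\<And>x. r x \<le> m x) \<Longrightarrow> r = m"
    using minimal_sublinear_exists[OF q(1)] by blast
  have l: "linear m" using minimal_sublinear_linear[OF m(1,3)] by blast
  have le: "m x \<le> p x" for x using m(2) q(2) order_trans by blast
  have "m (- y) \<le> - p y" using m(2)[of "- y"] q(3) by simp
  then have "m y = p y" using le[of y] linear_neg[OF l, of y] by simp
  then show thesis using that l le by blast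
qed

section \<open>Weak topology and support functions\<close>

lemma linear_bounded_by_norm_blinfun:
  fixes l :: "'a::real_normed_vector \<Rightarrow> real"
  assumes l: "linear l" and le: "\<And>x. l x \<le> norm x"
  obtains f :: "'a \<Rightarrow>\<^sub>L real" where "norm f \<le> 1" "\<And>x. blinfun_apply f x = l x"
proof -
  have abs: "\<bar>l x\<bar> \<le> norm x" for x
    using le[of x] le[of "- x"] linear_neg[OF l, of x] by simp
  have bl: "bounded_linear l"
    by (intro bounded_linear_intro[where K = 1]) (use l abs in \<open>auto simp: linear_add linear_scale\<close>)
  have "blinfun_apply (Blinfun l) x = l x" for x
    by (simp add: bl bounded_linear_Blinfun_apply)
  moreover have "norm (Blinfun l) \<le> 1"
    using abs by (intro norm_blinfun_bound) (simp_all add: bl bounded_linear_Blinfun_apply)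
  ultimately show thesis using that by blast
qed

lemma blinfun_le_norm: "norm f \<le> 1 \<Longrightarrow> blinfun_apply f x \<le> norm x" for f :: "'a::real_normed_vector \<Rightarrow>\<^sub>L real"
  using norm_blinfun[of f x] mult_right_mono[of "norm f" 1 "norm x"] by simp

lemma blinfun_abs_le: "\<bar>blinfun_apply f x\<bar> \<le> norm f * norm x" for f :: "'a::real_normed_vector \<Rightarrow>\<^sub>L real"
  using norm_blinfun[of f x] by simp

lemma norming_functional:
  fixes x :: "'a::real_normed_vector"
  obtains f :: "'a \<Rightarrow>\<^sub>L real" where "norm f \<le> 1" "blinfun_apply f x = norm x"
proof -
  have "sublinear (norm :: 'a \<Rightarrow> real)"
    by (rule sublinearI) (auto simp: norm_triangle_ineq)
  then obtain l where "linear l" "\<And>y. l y \<le> norm y" "l x = norm x"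
    using Hahn_Banach_sublinear by blast
  then show thesis using linear_bounded_by_norm_blinfun that by metis
qed

text \<open>With \<open>c = 0\<close> this also serves to identify two vectors on which all
  functionals agree.\<close>

lemma norm_le_if_functionals_le:
  fixes x :: "'a::real_normed_vector"
  assumes "\<And>f :: 'a \<Rightarrow>\<^sub>L real. norm f \<le> 1 \<Longrightarrow> blinfun_apply f x \<le> c"
  shows "norm x \<le> c"
  using norming_functional[of x] assms by metis

text \<open>
  The sublinear function \<open>y \<mapsto> inf {\<parallel>y - t (z - x)\<parallel> - t r | t \<ge> 0, z \<in> D}\<close>, where \<open>r\<close> is the distance
  from \<open>x\<close> to \<open>D\<close>, dominates exactly the functionals of norm at most 1 that separate \<open>x\<close> from \<open>D\<close>
  by \<open>r\<close>.
\<close>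

lemma separating_functional:
  fixes x :: "'a::real_normed_vector"
  assumes D: "convex D" "D \<noteq> {}"
  obtains f :: "'a \<Rightarrow>\<^sub>L real" where "norm f \<le> 1" "\<And>z. z \<in> D \<Longrightarrow> blinfun_apply f z + infdist x D \<le> blinfun_apply f x"
proof -
  define r where "r = infdist x D"
  define A where "A = {0::real..} \<times> D"
  define g where "g y = (\<lambda>(t, z). norm (y - t *\<^sub>R (z - x)) - t * r)" for y
  define q where "q y = (INF w\<in>A. g y w)" for y
  have r: "r \<le> norm (z - x)" if "z \<in> D" for z
    using infdist_le[OF that, of x] by (simp add: r_def dist_norm norm_minus_commute)
  have lower: "- norm y \<le> g y w" if "w \<in> A" for y w
  proof -
    obtain t z where w: "w = (t, z)" "0 \<le> t" "z \<in> D" using \<open>w \<in> A\<close> by (auto simp: A_def)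
    have "t * r \<le> norm (t *\<^sub>R (z - x))" using r[OF w(3)] w(2) by (simp add: mult_left_mono)
    also have "\<dots> \<le> norm (y - t *\<^sub>R (z - x)) + norm y"
      by (metis add.commute norm_minus_commute norm_triangle_sub)
    finally show ?thesis by (simp add: g_def w)
  qed
  have bdd: "bdd_below (g y ` A)" for y
    using lower by (intro bdd_belowI2)
  have le: "q y \<le> g y (t, z)" if "0 \<le> t" "z \<in> D" for y t z
    unfolding q_def using bdd that by (intro cINF_lower) (auto simp: A_def)
  have ge: "c \<le> q y" if "\<And>t z. 0 \<le> t \<Longrightarrow> z \<in> D \<Longrightarrow> c \<le> g y (t, z)" for c y
    unfolding q_def using that D by (intro cINF_greatest) (auto simp: A_def)
  have "sublinear q"
  proof (rule sublinearI)
    fix y1 y2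
    have key: "q (y1 + y2) \<le> g y1 (t1, z1) + g y2 (t2, z2)"
      if t: "0 \<le> t1" "0 \<le> t2" and z: "z1 \<in> D" "z2 \<in> D" for t1 t2 z1 z2
    proof -
      \<comment> \<open>Convexity of \<open>D\<close> merges the parameters \<open>(t1, z1)\<close>
        and \<open>(t2, z2)\<close> into one admissible parameter with first component
        \<open>t1 + t2\<close>.\<close>
      obtain z where z': "z \<in> D" "(t1 + t2) *\<^sub>R z = t1 *\<^sub>R z1 + t2 *\<^sub>R z2"
      proof (cases "t1 + t2 = 0")
        case True
        then have "t1 = 0" "t2 = 0" using t by auto
        then show ?thesis using that[of z1] z by simp
      next
        case False
        then have p: "0 < t1 + t2" using t by simp
        have "(t1 / (t1 + t2)) *\<^sub>R z1 + (t2 / (t1 + t2)) *\<^sub>R z2 \<in> D"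
          using p t z D(1) by (intro convexD) (auto simp: field_simps add_divide_distrib[symmetric])
        then show ?thesis using that[of "(t1 / (t1 + t2)) *\<^sub>R z1 + (t2 / (t1 + t2)) *\<^sub>R z2"] p
          by (simp add: scaleR_add_right)
      qed
      have "norm (y1 + y2 - (t1 + t2) *\<^sub>R (z - x))
          = norm ((y1 - t1 *\<^sub>R (z1 - x)) + (y2 - t2 *\<^sub>R (z2 - x)))"
        using z'(2) by (simp add: algebra_simps)
      also have "\<dots> \<le> norm (y1 - t1 *\<^sub>R (z1 - x)) + norm (y2 - t2 *\<^sub>R (z2 - x))"
        by (rule norm_triangle_ineq)
      finally show ?thesis using le[of "t1 + t2" z "y1 + y2"] t z'(1)
        by (simp add: g_def algebra_simps)
    qed
    have "q (y1 + y2) - q y2 \<le> g y1 (t, z)" if "0 \<le> t" "z \<in> D" for t z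
    proof -
      have "q (y1 + y2) - g y1 (t, z) \<le> q y2"
        using key[OF that(1) _ that(2)] by (intro ge) (simp add: algebra_simps)
      then show ?thesis by simp
    qed
    then have "q (y1 + y2) - q y2 \<le> q y1" by (rule ge)
    then show "q (y1 + y2) \<le> q y1 + q y2" by simp
  next
    fix c :: real and y :: 'a assume c: "0 < c"
    have "q (c *\<^sub>R y) / c \<le> g y (t, z)" if "0 \<le> t" "z \<in> D" for t z
    proof -
      have "q (c *\<^sub>R y) \<le> norm (c *\<^sub>R (y - t *\<^sub>R (z - x))) - c * t * r"
        using le[of "c * t" z "c *\<^sub>R y"] c that by (simp add: g_def scaleR_diff_right)
      then have "q (c *\<^sub>R y) \<le> c * g y (t, z)" using c by (simp add: g_def right_diff_distrib)
      then show ?thesis using c by (simp add: field_simps)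
    qed
    then have "q (c *\<^sub>R y) / c \<le> q y" by (rule ge)
    then show "q (c *\<^sub>R y) \<le> c * q y" using c by (simp add: field_simps)
  next
    obtain z where "z \<in> D" using D(2) by blast
    then have "q 0 \<le> 0" using le[of 0 z 0] by (simp add: g_def)
    moreover have "0 \<le> q 0" using lower[of _ 0] by (intro ge) (auto simp: A_def)
    ultimately show "q 0 = 0" by simp
  qed
  then obtain l where l: "linear l" "\<And>y. l y \<le> q y" using Hahn_Banach_sublinear by blast
  have "l y \<le> norm y" for y
  proof -
    obtain z where "z \<in> D" using D(2) by blast
    then show ?thesis using l(2)[of y] le[of 0 z y] by (simp add: g_def)
  qed
  then obtain f :: "'a \<Rightarrow>\<^sub>L real" where f: "norm f \<le> 1" "\<And>y. blinfun_apply f y = l y"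
    using linear_bounded_by_norm_blinfun[OF l(1)] by metis
  show thesis
  proof
    show "norm f \<le> 1" by (rule f)
    fix z assume "z \<in> D"
    \<comment> \<open>For the parameter \<open>t = 1\<close> at the vector \<open>z - x\<close> the
      norm vanishes and only \<open>- r\<close> is left.\<close>
    then have "blinfun_apply f (z - x) \<le> - r" using l(2)[of "z - x"] le[of 1 z "z - x"] f(2) by (simp add: g_def)
    then show "blinfun_apply f z + infdist x D \<le> blinfun_apply f x" by (simp add: r_def blinfun.diff_right)
  qed
qed

section \<open>Closed, separated and bounded sets in the weak topology\<close>

lemma continuous_map_weak_functional [continuous_intros]:
  "continuous_map weak_topology euclideanreal (blinfun_apply f)" for f :: "'a::real_normed_vector \<Rightarrow>\<^sub>L real"
  unfolding continuous_map_alt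
proof (intro conjI allI impI)
  fix U :: "real set" assume "openin euclideanreal U"
  then have "openin weak_topology (blinfun_apply f -` U)"
    unfolding weak_topology_def by (intro topology_generated_by_Basis) auto
  then show "openin weak_topology (blinfun_apply f -` U \<inter> topspace weak_topology)" by simp
qed auto

lemma continuous_map_into_weak:
  assumes "\<And>f :: 'a::real_normed_vector \<Rightarrow>\<^sub>L real. continuous_map T euclideanreal (\<lambda>x. blinfun_apply f (g x))"
  shows "continuous_map T weak_topology g"
proof -
  have "openin T (g -` (blinfun_apply f -` U) \<inter> topspace T)" if "open U"
    for f :: "'a \<Rightarrow>\<^sub>L real" and U
    using openin_continuous_map_preimage[OF assms[of f], of U] that
    by (simp add: vimage_def Int_def conj_commute)
  then show ?thesis
    unfolding weak_topology_def
    by (intro continuous_on_generated_topo)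
       (auto simp: topology_generated_by_topspace[symmetric] weak_topology_def[symmetric])
qed

lemma closedin_weak_halfspace: "closedin weak_topology {x. blinfun_apply f x \<le> c}"
  for f :: "'a::real_normed_vector \<Rightarrow>\<^sub>L real"
  using closedin_continuous_map_preimage[OF continuous_map_weak_functional[of f], of "{..c}"] by simp

text \<open>Mazur's theorem: separation of points at positive distance exhibits the set as an
  intersection of weakly closed half-spaces.\<close>

lemma closedin_weak_convex:
  fixes C :: "'a::real_normed_vector set"
  assumes "convex C" "closed C"
  shows "closedin weak_topology C"
proof (cases "C = {}")
  case False
  define H where "H = {{y. blinfun_apply f y \<le> c} | f (c :: real). C \<subseteq> {y. blinfun_apply f y \<le> c}}"
  have "x \<in> C" if x: "x \<in> \<Inter>H" for x
  proof (rule ccontr)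
    assume "x \<notin> C"
    then have pos: "0 < infdist x C" using assms(2) False
      by (metis antisym_conv1 in_closed_iff_infdist_zero infdist_nonneg)
    obtain f :: "'a \<Rightarrow>\<^sub>L real" where f: "\<And>z. z \<in> C \<Longrightarrow> blinfun_apply f z + infdist x C \<le> blinfun_apply f x"
      using separating_functional[OF assms(1) False] by metis
    then have "C \<subseteq> {y. blinfun_apply f y \<le> blinfun_apply f x - infdist x C}" by (auto simp: algebra_simps)
    then have "{y. blinfun_apply f y \<le> blinfun_apply f x - infdist x C} \<in> H"
      unfolding H_def by blast
    then have "x \<in> {y. blinfun_apply f y \<le> blinfun_apply f x - infdist x C}" using x by blast
    then show False using pos by simp
  qed
  then have "C = \<Inter>H" by (auto simp: H_def)
  \<comment> \<open>The zero functional gives the whole space as a half-space, so the family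
    \<open>H\<close> is nonempty and its intersection may be formed.\<close>
  moreover have "{y. blinfun_apply 0 y \<le> (0::real)} \<in> H"
    unfolding H_def by (rule CollectI, rule exI[of _ 0], rule exI[of _ 0]) auto
  then have "closedin weak_topology (\<Inter>H)"
    by (intro closedin_Inter) (auto simp: H_def closedin_weak_halfspace)
  ultimately show ?thesis by simp
qed simp

lemma Hausdorff_weak_topology: "Hausdorff_space (weak_topology :: 'a::real_normed_vector topology)"
  unfolding Hausdorff_space_def
proof (intro allI impI)
  fix x y :: 'a assume "x \<in> topspace weak_topology \<and> y \<in> topspace weak_topology \<and> x \<noteq> y"
  then have pos: "0 < norm (x - y)" by simp
  obtain f :: "'a \<Rightarrow>\<^sub>L real" where f: "blinfun_apply f (x - y) = norm (x - y)"
    using norming_functional by blast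
  then have less: "blinfun_apply f y < blinfun_apply f x" using pos f blinfun.diff_right[of f x y] by linarith
  define c where "c = (blinfun_apply f x + blinfun_apply f y) / 2"
  have op: "openin weak_topology (blinfun_apply f -` U)" if "open U" for U
    using openin_continuous_map_preimage[OF continuous_map_weak_functional[of f], of U] that
    by (simp add: vimage_def)
  have "openin weak_topology (f -` {c<..})" "openin weak_topology (f -` {..<c})"
    by (rule op, simp)+
  moreover have "x \<in> f -` {c<..}" "y \<in> f -` {..<c}" "disjnt (f -` {c<..}) (f -` {..<c})"
    using less by (auto simp: c_def disjnt_def)
  ultimately show "\<exists>U V. openin weak_topology U \<and> openin weak_topology V \<and> x \<in> U \<and> y \<in> V \<and> disjnt U V"
    by blast
qed

text \<open>Uniform boundedness: \<open>X\<^sup>*\<close> is the union of the closed sets \<open>{f. \<bar>f\<bar> \<le> n on C}\<close>.\<close>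

lemma bounded_if_weakly_bounded:
  fixes C :: "'a::real_normed_vector set"
  assumes "\<And>f :: 'a \<Rightarrow>\<^sub>L real. bounded (blinfun_apply f ` C)"
  shows "bounded C"
proof -
  define A where "A n = {f :: 'a \<Rightarrow>\<^sub>L real. \<forall>x\<in>C. \<bar>blinfun_apply f x\<bar> \<le> real n}" for n
  have clo: "closed (A n)" for n
  proof -
    have "A n = (\<Inter>x\<in>C. {f. \<bar>blinfun_apply f x\<bar> \<le> real n})" by (auto simp: A_def)
    also have "closed \<dots>"
      by (intro closed_INT ballI closed_Collect_le continuous_intros)
    finally show ?thesis .
  qed
  have "f \<in> (\<Union>n. A n)" for f
  proof -
    obtain M where "\<And>x. x \<in> C \<Longrightarrow> \<bar>blinfun_apply f x\<bar> \<le> M"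
      using assms[of f] by (auto simp: bounded_iff)
    then have "f \<in> A (nat \<lceil>M\<rceil>)" unfolding A_def using real_nat_ceiling_ge order_trans by blast
    then show ?thesis by blast
  qed
  then have un: "\<Union>(range A) = UNIV" by blast
  have "\<exists>n. interior (A n) \<noteq> {}"
  proof (rule ccontr)
    assume "\<not> ?thesis"
    then have "euclidean interior_of \<Union>(range A) = {}"
      by (intro Baire_category_alt)
         (use clo in \<open>auto simp: completely_metrizable_space_euclidean closed_closedin[symmetric]\<close>)
    then show False by (simp add: un)
  qed
  then obtain n f0 where "f0 \<in> interior (A n)" by blast
  then obtain e where e: "0 < e" "cball f0 e \<subseteq> A n"
    by (auto simp: mem_interior_cball)
  have "norm x \<le> 2 * real n / e" if x: "x \<in> C" for x
  proof (rule norm_le_if_functionals_le)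
    fix f :: "'a \<Rightarrow>\<^sub>L real" assume f: "norm f \<le> 1"
    \<comment> \<open>\<open>e *\<^sub>R f\<close> is a difference of two points of the ball, and
      both are bounded by \<open>n\<close> on \<open>C\<close>; hence the constant
      \<open>2 * n / e\<close>.\<close>
    have "f0 + e *\<^sub>R f \<in> cball f0 e" "f0 \<in> cball f0 e"
      using e(1) f mult_left_mono[of "norm f" 1 e] by (auto simp: dist_norm)
    then have "f0 + e *\<^sub>R f \<in> A n" "f0 \<in> A n" using e(2) by auto
    then have "\<bar>blinfun_apply f0 x + e * blinfun_apply f x\<bar> \<le> real n" "\<bar>blinfun_apply f0 x\<bar> \<le> real n"
      using x by (auto simp: A_def blinfun.add_left blinfun.scaleR_left)
    then have "e * blinfun_apply f x \<le> 2 * real n" by linarith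
    then show "blinfun_apply f x \<le> 2 * real n / e" using e(1) by (simp add: field_simps)
  qed
  then show ?thesis by (meson bounded_iff)
qed

lemma bounded_if_weakly_compact:
  fixes C :: "'a::real_normed_vector set"
  assumes "compactin weak_topology C"
  shows "bounded C"
proof (rule bounded_if_weakly_bounded)
  show "bounded (blinfun_apply f ` C)" for f :: "'a \<Rightarrow>\<^sub>L real"
    using image_compactin[OF assms continuous_map_weak_functional[of f]] by (simp add: compact_imp_bounded)
qed

section \<open>Stability properties of \<open>cwk\<close>\<close>

lemma cwk_bounded: "C \<in> cwk \<Longrightarrow> bounded C"
  and cwk_nonempty: "C \<in> cwk \<Longrightarrow> C \<noteq> {}"
  and cwk_convex: "C \<in> cwk \<Longrightarrow> convex C"
  and cwk_compact: "C \<in> cwk \<Longrightarrow> compactin weak_topology C"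
  by (auto simp: cwk_def bounded_if_weakly_compact)

lemma cwk_singleton: "{x} \<in> cwk"
  by (simp add: cwk_def)

lemma cwk_plus:
  assumes "C \<in> cwk" "D \<in> cwk"
  shows "C + D \<in> cwk"
proof -
  have "continuous_map (prod_topology weak_topology weak_topology) weak_topology (\<lambda>p :: 'a \<times> 'a. fst p + snd p)"
  proof (rule continuous_map_into_weak)
    fix f :: "'a \<Rightarrow>\<^sub>L real"
    have "continuous_map (prod_topology weak_topology weak_topology) euclideanreal (blinfun_apply f \<circ> fst)"
      "continuous_map (prod_topology weak_topology weak_topology) euclideanreal (blinfun_apply f \<circ> snd)"
      by (rule continuous_map_compose[OF _ continuous_map_weak_functional], rule continuous_map_fst continuous_map_snd)+
    then show "continuous_map (prod_topology weak_topology weak_topology) euclideanreal (\<lambda>p. blinfun_apply f (fst p + snd p))"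
      unfolding blinfun.add_right o_def by (rule continuous_map_add)
  qed
  moreover have "compactin (prod_topology weak_topology weak_topology) (C \<times> D)"
    using assms by (simp add: compactin_Times cwk_compact)
  ultimately have "compactin weak_topology ((\<lambda>p. fst p + snd p) ` (C \<times> D))"
    using image_compactin by blast
  moreover have "(\<lambda>p. fst p + snd p) ` (C \<times> D) = C + D"
    by (force simp: set_plus_def)
  ultimately show ?thesis
    using assms convex_set_plus[of C D] by (auto simp: cwk_def set_plus_def)
qed

lemma cwk_scale:
  assumes "C \<in> cwk"
  shows "(*\<^sub>R) c ` C \<in> cwk"
proof -
  have "continuous_map weak_topology weak_topology ((*\<^sub>R) c :: 'a \<Rightarrow> 'a)"
  proof (rule continuous_map_into_weak)
    fix f :: "'a \<Rightarrow>\<^sub>L real"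
    show "continuous_map weak_topology euclideanreal (\<lambda>x. blinfun_apply f (c *\<^sub>R x))"
      using continuous_map_real_mult_left[OF continuous_map_weak_functional[of f], of c]
      by (simp add: blinfun.scaleR_right)
  qed
  then show ?thesis using assms image_compactin by (auto simp: cwk_def convex_scaling)
qed

lemma cwk_sum:
  assumes "finite I" "\<And>i. i \<in> I \<Longrightarrow> C i \<in> cwk"
  shows "(\<Sum>i\<in>I. C i) \<in> cwk"
  using assms by (induction rule: finite_induct) (simp_all add: cwk_plus set_zero cwk_singleton)

section \<open>Calculus of support functions\<close>

context
  fixes C :: "'a::real_normed_vector set"
  assumes bounded: "bounded C"
begin

lemma bdd_above_functional: "bdd_above (blinfun_apply f ` C)" for f :: "'a \<Rightarrow>\<^sub>L real"
  using bounded_linear_image[OF bounded blinfun.bounded_linear_right[of f]]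
  by (rule bounded_imp_bdd_above)

lemma support_fun_upper: "x \<in> C \<Longrightarrow> blinfun_apply f x \<le> support_fun f C"
  unfolding support_fun_def by (intro cSUP_upper bdd_above_functional)

end

lemma support_fun_least: "C \<noteq> {} \<Longrightarrow> (\<And>x. x \<in> C \<Longrightarrow> blinfun_apply f x \<le> c) \<Longrightarrow> support_fun f C \<le> c"
  unfolding support_fun_def by (rule cSUP_least)

lemma support_fun_attained:
  fixes f :: "'a::real_normed_vector \<Rightarrow>\<^sub>L real"
  assumes "compactin weak_topology C" "C \<noteq> {}"
  obtains x where "x \<in> C" "blinfun_apply f x = support_fun f C"
proof -
  have "compact (blinfun_apply f ` C)"
    using image_compactin[OF assms(1) continuous_map_weak_functional[of f]] by simp
  then obtain s where "s \<in> blinfun_apply f ` C" "\<forall>t\<in>blinfun_apply f ` C. t \<le> s"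
    using compact_attains_sup[of "blinfun_apply f ` C"] assms(2) by blast
  then obtain x where x: "x \<in> C" "\<And>y. y \<in> C \<Longrightarrow> blinfun_apply f y \<le> blinfun_apply f x" by blast
  then have "blinfun_apply f x = support_fun f C"
    using support_fun_least[OF assms(2), of f "blinfun_apply f x"]
      support_fun_upper[OF bounded_if_weakly_compact[OF assms(1)] x(1), of f] by simp
  then show thesis using that x(1) by blast
qed

lemma support_fun_le_norm:
  assumes "C \<noteq> {}" "\<And>x. x \<in> C \<Longrightarrow> norm x \<le> M"
  shows "\<bar>support_fun f C\<bar> \<le> norm f * M"
proof -
  have b: "bounded C" using assms(2) by (auto simp: bounded_iff)
  have *: "\<bar>blinfun_apply f x\<bar> \<le> norm f * M" if "x \<in> C" for x
    using norm_blinfun[of f x] mult_left_mono[OF assms(2)[OF that], of "norm f"] by simp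
  have "support_fun f C \<le> norm f * M"
    using * by (intro support_fun_least[OF assms(1)]) (auto simp: abs_le_iff)
  moreover obtain x where "x \<in> C" using assms(1) by blast
  then have "- (norm f * M) \<le> support_fun f C"
    using support_fun_upper[OF b, of x f] *[of x] by linarith
  ultimately show ?thesis by linarith
qed

lemma sublinear_support_fun:
  assumes "bounded C" "C \<noteq> {}"
  shows "sublinear (\<lambda>f. support_fun f C)"
proof (rule sublinearI)
  fix f g :: "'a \<Rightarrow>\<^sub>L real"
  show "support_fun (f + g) C \<le> support_fun f C + support_fun g C"
    using support_fun_upper[OF assms(1)]
    by (intro support_fun_least[OF assms(2)]) (simp add: blinfun.add_left add_mono)
next
  fix f :: "'a \<Rightarrow>\<^sub>L real" and c :: real assume "0 < c"
  then show "support_fun (c *\<^sub>R f) C \<le> c * support_fun f C"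
    using support_fun_upper[OF assms(1)]
    by (intro support_fun_least[OF assms(2)]) (simp add: blinfun.scaleR_left)
qed (use assms(2) in \<open>simp add: support_fun_def\<close>)

lemma support_fun_plus:
  assumes "bounded C" "C \<noteq> {}" "bounded D" "D \<noteq> {}"
  shows "support_fun f (C + D) = support_fun f C + support_fun f D"
proof (rule antisym)
  show "support_fun f (C + D) \<le> support_fun f C + support_fun f D"
    using assms by (intro support_fun_least)
      (auto simp: set_plus_def blinfun.add_right intro!: add_mono support_fun_upper)
  have b: "bounded (C + D)" using assms bounded_plus[of C D] by (simp add: set_plus_image)
  have "support_fun f C \<le> support_fun f (C + D) - support_fun f D"
  proof (rule support_fun_least[OF assms(2)])
    fix x assume x: "x \<in> C"
    have "support_fun f D \<le> support_fun f (C + D) - blinfun_apply f x"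
    proof (rule support_fun_least[OF assms(4)])
      fix y assume "y \<in> D"
      then have "x + y \<in> C + D" using x by auto
      then show "blinfun_apply f y \<le> support_fun f (C + D) - blinfun_apply f x"
        using support_fun_upper[OF b, of "x + y" f] by (simp add: blinfun.add_right)
    qed
    then show "blinfun_apply f x \<le> support_fun f (C + D) - support_fun f D" by simp
  qed
  then show "support_fun f C + support_fun f D \<le> support_fun f (C + D)" by simp
qed

lemma support_fun_scale:
  assumes "bounded C" "C \<noteq> {}" "0 \<le> c"
  shows "support_fun f ((*\<^sub>R) c ` C) = c * support_fun f C"
proof -
  have "support_fun f ((*\<^sub>R) c ` C) = support_fun (c *\<^sub>R f) C"
    by (simp add: support_fun_def image_image blinfun.scaleR_left blinfun.scaleR_right)
  then show ?thesis using sublinear_scale[OF sublinear_support_fun[OF assms(1,2)] assms(3)] by simp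
qed

lemma support_fun_sum:
  assumes "finite I" "\<And>i. i \<in> I \<Longrightarrow> C i \<in> cwk"
  shows "support_fun f (\<Sum>i\<in>I. C i) = (\<Sum>i\<in>I. support_fun f (C i))"
  using assms
proof (induction rule: finite_induct)
  case (insert i I)
  then have "C i \<in> cwk" "(\<Sum>i\<in>I. C i) \<in> cwk" by (auto intro: cwk_sum)
  then show ?case using insert by (simp add: support_fun_plus cwk_bounded cwk_nonempty)
qed (simp add: set_zero)

section \<open>The Hausdorff distance through support functions\<close>

lemma bdd_above_infdist:
  fixes C D :: "'a::real_normed_vector set"
  assumes "bounded C" "D \<noteq> {}"
  shows "bdd_above ((\<lambda>x. infdist x D) ` C)"
proof -
  obtain y where y: "y \<in> D" using assms(2) by blast
  obtain M where M: "\<And>x. x \<in> C \<Longrightarrow> norm x \<le> M" using assms(1) by (auto simp: bounded_iff)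
  have "infdist x D \<le> M + norm y" if "x \<in> C" for x
    using infdist_le[OF y, of x] M[OF that] norm_triangle_ineq4[of x y] by (simp add: dist_norm)
  then show ?thesis by (intro bdd_aboveI2)
qed

text \<open>A single functional of the unit ball separates a point from a convex set by its full
  distance, so the bound on support functions passes to the distance without loss.\<close>

lemma hausdorff_dist_le:
  fixes C D :: "'a::real_normed_vector set"
  assumes C: "bounded C" "convex C" "C \<noteq> {}" and D: "bounded D" "convex D" "D \<noteq> {}"
    and le: "\<And>f :: 'a \<Rightarrow>\<^sub>L real. norm f \<le> 1 \<Longrightarrow> \<bar>support_fun f C - support_fun f D\<bar> \<le> e"
  shows "hausdorff_dist C D \<le> e"
proof -
  have half: "infdist x D \<le> e" if as: "bounded C" "convex D" "D \<noteq> {}" "x \<in> C"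
    and le: "\<And>f :: 'a \<Rightarrow>\<^sub>L real. norm f \<le> 1 \<Longrightarrow> support_fun f C - support_fun f D \<le> e"
    for C D :: "'a set" and x
  proof -
    obtain f :: "'a \<Rightarrow>\<^sub>L real" where f: "norm f \<le> 1" "\<And>z. z \<in> D \<Longrightarrow> blinfun_apply f z + infdist x D \<le> blinfun_apply f x"
      using separating_functional[OF as(2,3)] by metis
    have "support_fun f D \<le> blinfun_apply f x - infdist x D"
      using f(2) by (intro support_fun_least[OF as(3)]) (simp add: algebra_simps)
    also have "blinfun_apply f x \<le> support_fun f C" by (rule support_fun_upper[OF as(1,4)])
    finally show ?thesis using le[OF f(1)] by simp
  qed
  show ?thesis
    unfolding hausdorff_dist_def
  proof (intro max.boundedI cSUP_least C(3) D(3))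
    show "infdist x D \<le> e" if "x \<in> C" for x
      using le by (intro half[OF C(1) D(2,3) that]) (simp add: abs_le_iff)
    show "infdist x C \<le> e" if "x \<in> D" for x
      using le by (intro half[OF D(1) C(2,3) that]) (simp add: abs_le_iff)
  qed
qed

text \<open>The converse half of the duality. The infimum in \<open>infdist\<close> need not be
  attained, hence the approximation by an arbitrary error.\<close>

lemma support_fun_hausdorff_dist:
  fixes C D :: "'a::real_normed_vector set"
  assumes C: "bounded C" "C \<noteq> {}" and D: "bounded D" "D \<noteq> {}"
  shows "\<bar>support_fun f C - support_fun f D\<bar> \<le> norm f * hausdorff_dist C D"
proof -
  have half: "support_fun f C \<le> support_fun f D + norm f * d"
    if C: "bounded C" "C \<noteq> {}" and D: "bounded D" "D \<noteq> {}" and d: "\<And>x. x \<in> C \<Longrightarrow> infdist x D \<le> d"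
    for C D :: "'a set" and d
  proof (rule support_fun_least[OF C(2)])
    fix x assume x: "x \<in> C"
    show "blinfun_apply f x \<le> support_fun f D + norm f * d"
    proof (rule field_le_epsilon)
      fix e :: real assume e: "0 < e"
      \<comment> \<open>The summand 1 keeps the denominator positive for
        \<open>f = 0\<close>.\<close>
      define h where "h = e / (norm f + 1)"
      have n: "0 < norm f + 1" by (simp add: add_nonneg_pos)
      have h: "0 < h" "norm f * h \<le> e" using e n by (simp_all add: h_def field_simps)
      have "infdist x D < d + h" using d[OF x] h by simp
      then obtain z where z: "z \<in> D" "dist x z < d + h"
        using D(2) cINF_less_iff[of D "dist x" "d + h"] by (auto simp: infdist_notempty)
      have "blinfun_apply f x = blinfun_apply f z + blinfun_apply f (x - z)" by (simp add: blinfun.diff_right)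
      also have "blinfun_apply f (x - z) \<le> norm f * norm (x - z)" using norm_blinfun[of f "x - z"] by simp
      also have "norm f * norm (x - z) \<le> norm f * (d + h)"
        using z(2) by (intro mult_left_mono) (simp_all add: dist_norm)
      also have "blinfun_apply f z \<le> support_fun f D" by (rule support_fun_upper[OF D(1) z(1)])
      finally show "blinfun_apply f x \<le> support_fun f D + norm f * d + e" using h(2) by (simp add: algebra_simps)
    qed
  qed
  have "infdist x D \<le> hausdorff_dist C D" if "x \<in> C" for x
    unfolding hausdorff_dist_def using that bdd_above_infdist[OF C(1) D(2)]
    by (intro max.coboundedI1 cSUP_upper)
  moreover have "infdist x C \<le> hausdorff_dist C D" if "x \<in> D" for x
    unfolding hausdorff_dist_def using that bdd_above_infdist[OF D(1) C(2)]
    by (intro max.coboundedI2 cSUP_upper)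
  ultimately have "support_fun f C \<le> support_fun f D + norm f * hausdorff_dist C D"
    "support_fun f D \<le> support_fun f C + norm f * hausdorff_dist C D"
    using half[OF C D] half[OF D C] by blast+
  then show ?thesis by linarith
qed

section \<open>Sublinear functions that are support functions\<close>

text \<open>For nonnegative \<open>a\<close> this is the signed distance of \<open>u\<close> from
  the interval between \<open>- a\<close> and \<open>a\<close> (soft thresholding).\<close>

definition excess :: "real \<Rightarrow> real \<Rightarrow> real" where
  "excess a u = u - max (- a) (min a u)"

lemma excess_eq_0_iff: "0 \<le> a \<Longrightarrow> excess a u = 0 \<longleftrightarrow> \<bar>u\<bar> \<le> a"
  by (auto simp: excess_def max_def min_def)

text \<open>Where the excess is nonzero it has the sign of \<open>u\<close>, and the absolute value
  of \<open>u\<close> is \<open>a\<close> plus that of the excess.\<close>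

lemma excess_mult: "0 \<le> a \<Longrightarrow> excess a u * u = (excess a u)\<^sup>2 + \<bar>excess a u\<bar> * a"
  by (auto simp: excess_def max_def min_def power2_eq_square algebra_simps)

text \<open>Subtracting the excess from \<open>u\<close> lands in the interval, so the distance of
  \<open>u + v\<close> from it is at most the absolute value of \<open>excess a u + v\<close>. The
  squared excess is thus majorized by a parabola that touches it at \<open>v = 0\<close>, which
  replaces a derivative.\<close>

lemma excess_add_square_le:
  assumes "0 \<le> a"
  shows "(excess a (u + v))\<^sup>2 \<le> (excess a u + v)\<^sup>2"
proof -
  have "\<bar>excess a (u + v)\<bar> \<le> \<bar>excess a u + v\<bar>"
    using assms by (auto simp: excess_def max_def min_def)
  then show ?thesis by (simp add: abs_le_square_iff)
qed

text \<open>
  For finitely many functionals a point of \<open>C\<close> minimizing the sum of the squared excesses of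
  \<open>\<bar>l f - f x\<bar>\<close> over \<open>e * norm f\<close> has excess 0: otherwise the combination of the functionals with
  the excesses as coefficients contradicts the domination of \<open>l\<close>.
\<close>

lemma finite_approximate_evaluation:
  fixes l :: "('a::real_normed_vector \<Rightarrow>\<^sub>L real) \<Rightarrow> real"
  assumes C: "C \<in> cwk" and l: "linear l" and e: "0 \<le> e"
    and le: "\<And>f. l f \<le> support_fun f C + e * norm f" and F: "finite F"
  obtains x where "x \<in> C" "\<And>f. f \<in> F \<Longrightarrow> \<bar>l f - blinfun_apply f x\<bar> \<le> e * norm f"
proof -
  define c where "c x f = excess (e * norm f) (l f - blinfun_apply f x)" for x f
  define \<Phi> where "\<Phi> x = (\<Sum>f\<in>F. (c x f)\<^sup>2)" for x
  have "continuous_map weak_topology euclideanreal \<Phi>"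
    unfolding \<Phi>_def c_def excess_def
    by (intro continuous_map_sum continuous_map_real_pow continuous_map_diff continuous_map_real_max
        continuous_map_real_min continuous_map_weak_functional F) simp_all
  then have "compact (\<Phi> ` C)"
    using image_compactin[OF cwk_compact[OF C]] by fastforce
  then obtain x where x: "x \<in> C" "\<And>y. y \<in> C \<Longrightarrow> \<Phi> x \<le> \<Phi> y"
    using compact_attains_inf[of "\<Phi> ` C"] cwk_nonempty[OF C] by auto
  \<comment> \<open>The derivative of \<open>\<Phi>\<close> at \<open>x\<close> is
    \<open>- 2\<close> times \<open>g\<close>; minimality of \<open>\<Phi>\<close> at
    \<open>x\<close> over the convex set \<open>C\<close> therefore says that \<open>g\<close> is
    maximal at \<open>x\<close>.\<close>
  define g where "g = (\<Sum>f\<in>F. c x f *\<^sub>R f)"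
  have max: "blinfun_apply g y \<le> blinfun_apply g x" if y: "y \<in> C" for y
  proof (rule ccontr)
    define v where "v f = blinfun_apply f x - blinfun_apply f y" for f :: "'a \<Rightarrow>\<^sub>L real"
    define S where "S = (\<Sum>f\<in>F. c x f * v f)"
    define V where "V = (\<Sum>f\<in>F. (v f)\<^sup>2)"
    have S: "S = blinfun_apply g x - blinfun_apply g y"
      by (simp add: S_def g_def v_def blinfun.sum_left blinfun.scaleR_left right_diff_distrib sum_subtractf)
    assume "\<not> ?thesis"
    then have neg: "S < 0" by (simp add: S)
    have V: "0 \<le> V" by (simp add: V_def sum_nonneg)
    \<comment> \<open>This step length makes the quadratic term \<open>\<tau> * V\<close> at most
      \<open>- S\<close>, so that \<open>2 * S + \<tau> * V\<close> would be negative.\<close>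
    define \<tau> where "\<tau> = min 1 (- S / (V + 1))"
    have \<tau>: "0 < \<tau>" "\<tau> \<le> 1" "\<tau> * (V + 1) \<le> - S"
      using neg V by (auto simp: \<tau>_def min_def divide_simps split: if_splits)
    define z where "z = (1 - \<tau>) *\<^sub>R x + \<tau> *\<^sub>R y"
    have "z \<in> C"
      unfolding z_def using \<tau> x(1) y cwk_convex[OF C] by (intro convexD) auto
    then have "\<Phi> x \<le> \<Phi> z" by (rule x(2))
    also have "\<dots> \<le> (\<Sum>f\<in>F. (c x f + \<tau> * v f)\<^sup>2)"
      unfolding \<Phi>_def
    proof (rule sum_mono)
      fix f
      have eq: "l f - blinfun_apply f z = (l f - blinfun_apply f x) + \<tau> * v f"
        unfolding z_def v_def blinfun.add_right blinfun.scaleR_right by (simp add: algebra_simps)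
      show "(c z f)\<^sup>2 \<le> (c x f + \<tau> * v f)\<^sup>2"
        unfolding c_def eq using e by (intro excess_add_square_le) simp
    qed
    also have "\<dots> = \<Phi> x + \<tau> * (2 * S + \<tau> * V)"
      by (simp add: \<Phi>_def S_def V_def power2_eq_square sum.distrib sum_distrib_left algebra_simps)
    finally have "0 \<le> 2 * S + \<tau> * V" using \<tau>(1) by (simp add: zero_le_mult_iff)
    moreover have "\<tau> * V \<le> - S" using \<tau> by (simp add: algebra_simps)
    ultimately show False using neg by simp
  qed
  \<comment> \<open>The domination is tested on \<open>g\<close> itself: the contribution of the
    thresholds absorbs \<open>e * norm g\<close>, and only the sum of squares remains.\<close>
  have "l g \<le> blinfun_apply g x + e * norm g"
    using le[of g] support_fun_least[OF cwk_nonempty[OF C] max] by linarith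
  moreover have "l g - blinfun_apply g x = (\<Sum>f\<in>F. c x f * (l f - blinfun_apply f x))"
    by (simp add: g_def linear_sum[OF l] linear_scale[OF l] blinfun.sum_left blinfun.scaleR_left
        right_diff_distrib sum_subtractf)
  moreover have "\<dots> = (\<Sum>f\<in>F. (c x f)\<^sup>2 + \<bar>c x f\<bar> * (e * norm f))"
    unfolding c_def using e by (intro sum.cong refl excess_mult) simp
  moreover have "e * norm g \<le> (\<Sum>f\<in>F. \<bar>c x f\<bar> * (e * norm f))"
  proof -
    have "norm g \<le> (\<Sum>f\<in>F. \<bar>c x f\<bar> * norm f)"
      unfolding g_def by (rule order_trans[OF norm_sum]) simp
    then have "e * norm g \<le> e * (\<Sum>f\<in>F. \<bar>c x f\<bar> * norm f)" using e by (rule mult_left_mono)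
    then show ?thesis by (simp add: sum_distrib_left algebra_simps)
  qed
  ultimately have "(\<Sum>f\<in>F. (c x f)\<^sup>2) \<le> 0" by (simp add: sum.distrib)
  then have "\<forall>f\<in>F. (c x f)\<^sup>2 = 0"
    using sum_nonneg_eq_0_iff[OF F, of "\<lambda>f. (c x f)\<^sup>2"] sum_nonneg[of F "\<lambda>f. (c x f)\<^sup>2"] by auto
  then have "\<bar>l f - blinfun_apply f x\<bar> \<le> e * norm f" if "f \<in> F" for f
    using that e excess_eq_0_iff[of "e * norm f" "l f - blinfun_apply f x"] by (simp add: c_def)
  then show thesis using that x(1) by blast
qed

text \<open>Each functional imposes a weakly closed condition on \<open>x\<close>; the finite case
  is the finite intersection property of these conditions on the weakly compact
  \<open>C\<close>.\<close>

lemma approximate_evaluation: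
  fixes l :: "('a::real_normed_vector \<Rightarrow>\<^sub>L real) \<Rightarrow> real"
  assumes C: "C \<in> cwk" and l: "linear l" and e: "0 \<le> e"
    and le: "\<And>f. l f \<le> support_fun f C + e * norm f"
  obtains x where "x \<in> C" "\<And>f. \<bar>l f - blinfun_apply f x\<bar> \<le> e * norm f"
proof -
  define H where "H f = {x. \<bar>l f - blinfun_apply f x\<bar> \<le> e * norm f}" for f
  have "closedin weak_topology (H f)" for f
    using closedin_continuous_map_preimage[OF continuous_map_weak_functional[of f],
        of "{l f - e * norm f .. l f + e * norm f}"]
    by (simp add: H_def abs_le_iff algebra_simps)
  moreover have "C \<inter> \<Inter>\<F> \<noteq> {}" if fin: "finite \<F>" "\<F> \<subseteq> range H" for \<F>
  proof -
    obtain F where F: "finite F" "\<F> = H ` F" using finite_subset_image[OF fin] by blast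
    obtain x where "x \<in> C" "\<And>f. f \<in> F \<Longrightarrow> \<bar>l f - blinfun_apply f x\<bar> \<le> e * norm f"
      using finite_approximate_evaluation[OF C l e le F(1)] by blast
    then have "x \<in> C \<inter> \<Inter>\<F>" by (auto simp: F(2) H_def)
    then show ?thesis by blast
  qed
  ultimately have "C \<inter> \<Inter>(range H) \<noteq> {}"
    using cwk_compact[OF C] unfolding compactin_fip by blast
  then show thesis using that by (auto simp: H_def)
qed

text \<open>The case of error 0. This is the source of vectors in later arguments: sums and
  integrals are defined as functionals on the dual and then recognized as points of a set in
  \<open>cwk\<close>.\<close>

corollary dominated_evaluation:
  fixes l :: "('a::real_normed_vector \<Rightarrow>\<^sub>L real) \<Rightarrow> real"
  assumes "C \<in> cwk" "linear l" "\<And>f. l f \<le> support_fun f C"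
  obtains x where "x \<in> C" "\<And>f. l f = blinfun_apply f x"
  using approximate_evaluation[OF assms(1,2) order_refl] assms(3) by auto

text \<open>The candidate is the set of vectors dominated by \<open>p\<close>. A linear
  \<open>l\<close> below \<open>p\<close> is an evaluation up to \<open>1 / n\<close> for each
  \<open>n\<close>, and completeness of the space provides the limit vector. Weak compactness comes
  from Tychonoff's theorem for the linear functions below \<open>p\<close>, and the Hahn-Banach
  theorem shows that each value of \<open>p\<close> is attained.\<close>

theorem cwk_representation:
  fixes p :: "('a::banach \<Rightarrow>\<^sub>L real) \<Rightarrow> real"
  assumes p: "sublinear p"
    and approx: "\<And>e. 0 < e \<Longrightarrow> \<exists>C\<in>cwk. \<forall>f. p f \<le> support_fun f C + e * norm f"
  obtains W where "W \<in> cwk" "\<And>f. support_fun f W = p f"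
proof -
  define L where "L = {l. linear l \<and> (\<forall>f. l f \<le> p f)}"
  have ev: "\<exists>x. \<forall>f. blinfun_apply f x = l f" if "l \<in> L" for l
  proof -
    have l: "linear l" "\<And>f. l f \<le> p f" using that by (auto simp: L_def)
    have "\<exists>x. \<forall>f. \<bar>l f - blinfun_apply f x\<bar> \<le> inverse (real (Suc n)) * norm f" for n
    proof -
      obtain C where C: "C \<in> cwk" "\<And>f. p f \<le> support_fun f C + inverse (real (Suc n)) * norm f"
        using approx[of "inverse (real (Suc n))"] by auto
      show ?thesis
        using approximate_evaluation[OF C(1) l(1), of "inverse (real (Suc n))"] C(2) l(2)
        by (metis inverse_nonnegative_iff_nonnegative of_nat_0_le_iff order_trans)
    qed
    then obtain x where x: "\<And>n f. \<bar>l f - blinfun_apply f (x n)\<bar> \<le> inverse (real (Suc n)) * norm f"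
      by metis
    have diff: "norm (x m - x n) \<le> inverse (real (Suc m)) + inverse (real (Suc n))" for m n
    proof (rule norm_le_if_functionals_le)
      fix f :: "'a \<Rightarrow>\<^sub>L real" assume f: "norm f \<le> 1"
      have "inverse (real (Suc k)) * norm f \<le> inverse (real (Suc k))" for k
        using f by (simp add: mult_le_cancel_left1 del: of_nat_Suc)
      then have *: "\<bar>l f - blinfun_apply f (x k)\<bar> \<le> inverse (real (Suc k))" for k
        using x[of f k] order_trans by blast
      show "blinfun_apply f (x m - x n) \<le> inverse (real (Suc m)) + inverse (real (Suc n))"
        using *[of m] *[of n] by (simp add: blinfun.diff_right abs_le_iff del: of_nat_Suc)
    qed
    have "Cauchy x"
    proof (rule CauchyI)
      fix e :: real assume "0 < e"
      then obtain N where N: "inverse (real (Suc N)) < e / 2"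
        using reals_Archimedean[of "e / 2"] by auto
      have "inverse (real (Suc m)) < e / 2" if "m \<ge> N" for m
        using that by (intro le_less_trans[OF _ N]) (simp add: le_imp_inverse_le)
      then have "norm (x m - x n) < e" if "m \<ge> N" "n \<ge> N" for m n
        using diff[of m n] that add_strict_mono[of "inverse (real (Suc m))" "e / 2" "inverse (real (Suc n))" "e / 2"]
        by (simp del: of_nat_Suc)
      then show "\<exists>N. \<forall>m\<ge>N. \<forall>n\<ge>N. norm (x m - x n) < e" by blast
    qed
    then obtain y where y: "x \<longlonglongrightarrow> y" by (auto simp: Cauchy_convergent_iff convergent_def)
    have "blinfun_apply f y = l f" for f
    proof (rule LIMSEQ_unique)
      show "(\<lambda>n. blinfun_apply f (x n)) \<longlonglongrightarrow> blinfun_apply f y" using y by (intro tendsto_intros)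
      have "(\<lambda>n. inverse (real (Suc n)) * norm f) \<longlonglongrightarrow> 0"
        using tendsto_mult_left_zero[OF LIMSEQ_inverse_real_of_nat] .
      then have "(\<lambda>n. blinfun_apply f (x n) - l f) \<longlonglongrightarrow> 0"
        by (rule Lim_null_comparison[rotated]) (use x[of f] in \<open>simp add: abs_minus_commute\<close>)
      then show "(\<lambda>n. blinfun_apply f (x n)) \<longlonglongrightarrow> l f" by (simp add: LIM_zero_iff)
    qed
    then show ?thesis by blast
  qed
  define P where "P = product_topology (\<lambda>_ :: 'a \<Rightarrow>\<^sub>L real. euclideanreal) UNIV"
  have proj: "continuous_map P euclideanreal (\<lambda>l. l f)" for f
    unfolding P_def by (rule continuous_map_product_projection) simp
  have top: "topspace P = UNIV" by (simp add: P_def)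
  have cl0: "closedin P {l. g l = 0}" if "continuous_map P euclideanreal g" for g
    using closedin_continuous_map_preimage[OF that, of "{0}"] top by simp
  have cl1: "closedin P {l. l f \<le> p f}" for f
    using closedin_continuous_map_preimage[OF proj[of f], of "{..p f}"] top by simp
  have "L = (\<Inter>f. \<Inter>g. {l. l (f + g) - l f - l g = 0}) \<inter> (\<Inter>c. \<Inter>f. {l. l (c *\<^sub>R f) - c * l f = 0})
      \<inter> (\<Inter>f. {l. l f \<le> p f})"
    by (auto simp: L_def linear_iff algebra_simps)
  moreover have "closedin P \<dots>"
    by (intro closedin_Int closedin_INT cl0 cl1 continuous_map_diff continuous_map_real_mult_left proj) auto
  ultimately have "closedin P L" by simp
  \<comment> \<open>A linear \<open>l\<close> below \<open>p\<close> also satisfies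
    \<open>- p (- f) \<le> l f\<close>, so all of \<open>L\<close> lies in a product of compact
    intervals.\<close>
  moreover have "compactin P (PiE UNIV (\<lambda>f. {- p (- f)..p f}))"
    unfolding P_def by (simp add: compactin_PiE)
  moreover have "L \<subseteq> PiE UNIV (\<lambda>f. {- p (- f)..p f})"
  proof
    fix l assume "l \<in> L"
    then have "linear l" "\<And>f. l f \<le> p f" by (auto simp: L_def)
    then have "- p (- f) \<le> l f" for f using linear_neg[of l f] by (metis minus_le_iff)
    then show "l \<in> PiE UNIV (\<lambda>f. {- p (- f)..p f})" using \<open>\<And>f. l f \<le> p f\<close> by auto
  qed
  ultimately have LP: "compactin P L" using closed_compactin[of P "PiE UNIV (\<lambda>f. {- p (- f)..p f})" L] by blast
  define u where "u l = (SOME x. \<forall>f. blinfun_apply f x = l f)" for l :: "('a \<Rightarrow>\<^sub>L real) \<Rightarrow> real"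
  have u: "blinfun_apply f (u l) = l f" if "l \<in> L" for l f
    unfolding u_def using someI_ex[OF ev[OF that]] by blast
  have "continuous_map (subtopology P L) weak_topology u"
  proof (rule continuous_map_into_weak)
    fix f :: "'a \<Rightarrow>\<^sub>L real"
    have "continuous_map (subtopology P L) euclideanreal (\<lambda>l. l f)"
      by (rule continuous_map_from_subtopology[OF proj])
    then show "continuous_map (subtopology P L) euclideanreal (\<lambda>l. blinfun_apply f (u l))"
      by (rule continuous_map_eq) (simp add: u top)
  qed
  moreover have "compactin (subtopology P L) L" using LP by (simp add: compactin_subtopology)
  ultimately have comp: "compactin weak_topology (u ` L)" using image_compactin by blast
  have uL: "u ` L = {x. \<forall>f. blinfun_apply f x \<le> p f}"
  proof (intro equalityI subsetI)
    fix x assume "x \<in> u ` L"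
    then show "x \<in> {x. \<forall>f. blinfun_apply f x \<le> p f}" using u by (auto simp: L_def)
  next
    fix x assume x: "x \<in> {x. \<forall>f. blinfun_apply f x \<le> p f}"
    have lL: "(\<lambda>f. blinfun_apply f x) \<in> L"
      using x by (auto simp: L_def linear_iff blinfun.add_left blinfun.scaleR_left)
    have "norm (u (\<lambda>f. blinfun_apply f x) - x) \<le> 0"
      using u[OF lL] by (intro norm_le_if_functionals_le) (simp add: blinfun.diff_right)
    then show "x \<in> u ` L" using lL by force
  qed
  show thesis
  proof
    have ne: "\<exists>x\<in>u ` L. blinfun_apply f x = p f" for f
    proof -
      obtain l where "linear l" "\<And>g. l g \<le> p g" "l f = p f" using Hahn_Banach_sublinear[OF p] by blast
      then have "l \<in> L" "l f = p f" by (auto simp: L_def)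
      then show ?thesis using u[of l f] by auto
    qed
    have "convex (u ` L)"
      unfolding uL by (intro convexI)
        (auto simp: blinfun.add_right blinfun.scaleR_right intro!: convex_bound_le)
    then show W: "u ` L \<in> cwk" using comp ne[of 0] by (auto simp: cwk_def)
    fix f
    show "support_fun f (u ` L) = p f"
    proof (rule antisym)
      show "support_fun f (u ` L) \<le> p f"
        using cwk_nonempty[OF W] uL by (intro support_fun_least) auto
      show "p f \<le> support_fun f (u ` L)"
        using ne[of f] support_fun_upper[OF cwk_bounded[OF W]] by metis
    qed
  qed
qed

section \<open>Strongly exposing functionals of weakly compact sets\<close>

lemma compactin_fipD:
  assumes "compactin X S" "\<And>C. C \<in> \<U> \<Longrightarrow> closedin X C"
    "\<And>\<F>. finite \<F> \<Longrightarrow> \<F> \<subseteq> \<U> \<Longrightarrow> S \<inter> \<Inter>\<F> \<noteq> {}"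
  shows "S \<inter> \<Inter>\<U> \<noteq> {}"
  using assms unfolding compactin_fip by meson

text \<open>A finite Baire argument: if \<open>U\<close> is not contained in one of the closed sets,
  removing that set leaves a nonempty open set covered by the others.\<close>

lemma open_subset_of_finite_closed_cover:
  assumes "finite J" "openin T U" "U \<noteq> {}" "\<And>j. j \<in> J \<Longrightarrow> closedin T (B j)" "U \<subseteq> (\<Union>j\<in>J. B j)"
  obtains V j where "j \<in> J" "openin T V" "V \<noteq> {}" "V \<subseteq> U" "V \<subseteq> B j"
  using assms
proof (induction arbitrary: U thesis rule: finite_induct)
  case empty
  then show ?case by simp
next
  case (insert i J)
  show ?case
  proof (cases "U \<subseteq> B i")
    case True
    then show ?thesis using insert.prems(1)[of i U] insert.prems by blast
  next
    case False
    have "openin T (U - B i)" using insert.prems by (intro openin_diff) auto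
    moreover have "U - B i \<noteq> {}" "U - B i \<subseteq> (\<Union>j\<in>J. B j)" using False insert.prems by auto
    ultimately show ?thesis using insert.IH[of "U - B i"] insert.prems(1,4)
      by (metis Diff_subset insertCI order_trans)
  qed
qed

text \<open>
  Otherwise one finds points \<open>x n\<close> and decreasing closed sets \<open>C n\<close> containing \<open>x n\<close> at distance
  at least \<open>e / 4\<close> from the convex hull of the earlier points; a point of all \<open>C n\<close> in the closed
  convex hull of the sequence, which exists by weak compactness, is impossible.
\<close>

lemma weakly_compact_small_open:
  fixes D :: "'a::real_normed_vector set"
  assumes D: "compactin weak_topology D" "D \<noteq> {}" and e: "0 < e"
  shows "\<exists>U. openin weak_topology U \<and> D \<inter> U \<noteq> {} \<and> (\<forall>x\<in>D \<inter> U. \<forall>y\<in>D \<inter> U. norm (x - y) \<le> e)"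
proof (rule ccontr)
  assume "\<not> ?thesis"
  then have large: "\<exists>x\<in>D \<inter> U. \<exists>y\<in>D \<inter> U. e < norm (x - y)" if "openin weak_topology U" "D \<inter> U \<noteq> {}" for U
    using that by (meson not_le)
  define T where "T = subtopology weak_topology D"
  have comp: "compact_space T" using D(1) by (simp add: T_def compact_space_subtopology)
  have top: "topspace T = D" by (simp add: T_def)
  have large: "\<exists>x\<in>V. \<exists>y\<in>V. e < norm (x - y)" if "openin T V" "V \<noteq> {}" for V
    using that large by (auto simp: T_def openin_subtopology Int_commute)
  have "Hausdorff_space T" by (simp add: T_def Hausdorff_space_subtopology Hausdorff_weak_topology)
  then have reg: "neighbourhood_base_of (closedin T) T"
    using compact_Hausdorff_imp_regular_space[OF comp] by (simp add: neighbourhood_base_of_closedin)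
  define R where "R = (\<lambda>(U, S) (U', S'). \<exists>C x. closedin T C \<and> U' \<subseteq> C \<and> C \<subseteq> U \<and> x \<in> U' \<and>
    (\<forall>y\<in>C. \<forall>k\<in>convex hull S. e / 4 \<le> norm (y - k)) \<and> S' = insert x S)"
  define Q where "Q = (\<lambda>(U, S :: 'a set). openin T U \<and> U \<noteq> {} \<and> finite S)"
  have step: "\<exists>q. Q q \<and> R p q" if p: "Q p" for p
  proof -
    obtain U S where US: "p = (U, S)" "openin T U" "U \<noteq> {}" "finite S"
      using p by (auto simp: Q_def)
    define K where "K = convex hull S"
    have "compact K" unfolding K_def by (rule finite_imp_compact_convex_hull[OF US(4)])
    then obtain J where J: "finite J" "J \<subseteq> K" "K \<subseteq> (\<Union>j\<in>J. ball j (e / 4))"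
      using compactE_image[of K K "\<lambda>j. ball j (e / 4)"] e by (metis UN_I centre_in_ball divide_pos_pos open_ball subsetI zero_less_numeral)
    have clo: "closedin T (D \<inter> cball j (e / 2))" for j
      unfolding T_def using closedin_weak_convex[OF convex_cball closed_cball]
      by (intro closedin_subtopology_Int_closedin) auto
    \<comment> \<open>A ball of radius \<open>e / 2\<close> has diameter at most \<open>e\<close>,
      so by assumption it contains no nonempty relatively open set; finitely many such balls cannot
      cover \<open>U\<close>.\<close>
    have "\<not> U \<subseteq> (\<Union>j\<in>J. D \<inter> cball j (e / 2))"
    proof
      assume "U \<subseteq> (\<Union>j\<in>J. D \<inter> cball j (e / 2))"
      then obtain V j where V: "openin T V" "V \<noteq> {}" "V \<subseteq> D \<inter> cball j (e / 2)"
        using open_subset_of_finite_closed_cover[OF J(1) US(2,3), of "\<lambda>j. D \<inter> cball j (e / 2)"] clo by metis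
      then obtain x y where "x \<in> cball j (e / 2)" "y \<in> cball j (e / 2)" "e < norm (x - y)"
        using large[OF V(1,2)] by blast
      then show False using dist_triangle2[of x y j] by (simp add: dist_norm norm_minus_commute)
    qed
    then obtain x where x: "x \<in> U" "x \<notin> (\<Union>j\<in>J. D \<inter> cball j (e / 2))" by blast
    have "openin T (U - (\<Union>j\<in>J. D \<inter> cball j (e / 2)))"
      using US(2) J(1) clo by (intro openin_diff closedin_Union) auto
    then obtain U' C where U': "openin T U'" "closedin T C" "x \<in> U'" "U' \<subseteq> C"
      "C \<subseteq> U - (\<Union>j\<in>J. D \<inter> cball j (e / 2))"
      using reg x unfolding neighbourhood_base_of by (metis DiffI)
    \<comment> \<open>Points outside the balls of radius \<open>e / 2\<close> around an
      \<open>e / 4\<close>-net of \<open>K\<close> stay at distance at least \<open>e / 4\<close>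
      from \<open>K\<close>.\<close>
    have "e / 4 \<le> norm (y - k)" if yk: "y \<in> C" "k \<in> K" for y k
    proof (rule ccontr)
      assume c: "\<not> ?thesis"
      obtain j where j: "j \<in> J" "norm (j - k) < e / 4" using J(3) yk(2) by (auto simp: dist_norm)
      have "dist j y \<le> e / 2"
        using c j(2) norm_triangle_ineq[of "j - k" "k - y"] by (simp add: dist_norm norm_minus_commute)
      moreover have "y \<in> D" using yk(1) U'(2) closedin_subset top by blast
      ultimately have "y \<in> (\<Union>j\<in>J. D \<inter> cball j (e / 2))" using j(1) by auto
      then show False using U'(5) yk(1) by blast
    qed
    then have "R p (U', insert x S)"
      using U' by (auto simp: R_def US(1) K_def intro!: exI[of _ C] exI[of _ x])
    moreover have "Q (U', insert x S)" using U' US by (auto simp: Q_def)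
    ultimately show ?thesis by blast
  qed
  have "Q (D, {})" using D(2) openin_topspace[of T] by (simp add: Q_def top)
  then obtain q where q: "\<And>n. Q (q n)" "\<And>n. R (q n) (q (Suc n))"
    using dependent_nat_choice[of "\<lambda>_. Q" "\<lambda>_. R"] step by metis
  define U where "U n = fst (q n)" for n
  define S where "S n = snd (q n)" for n
  define P where "P n C x \<longleftrightarrow> closedin T C \<and> U (Suc n) \<subseteq> C \<and> C \<subseteq> U n \<and> x \<in> U (Suc n) \<and>
    (\<forall>y\<in>C. \<forall>k\<in>convex hull S n. e / 4 \<le> norm (y - k)) \<and> S (Suc n) = insert x (S n)" for n C x
  have "\<forall>n. \<exists>C x. P n C x"
    using q(2) by (simp add: R_def U_def S_def P_def case_prod_unfold)
  then obtain C x where "P n (C n) (x n)" for n by metis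
  then have C: "\<And>n. closedin T (C n)" "\<And>n. U (Suc n) \<subseteq> C n" "\<And>n. C n \<subseteq> U n"
    "\<And>n. x n \<in> U (Suc n)" "\<And>n y k. y \<in> C n \<Longrightarrow> k \<in> convex hull S n \<Longrightarrow> e / 4 \<le> norm (y - k)"
    "\<And>n. S (Suc n) = insert (x n) (S n)" unfolding P_def by blast+
  have mono: "convex hull S m \<subseteq> convex hull S n" if "m \<le> n" for m n
  proof (rule hull_mono)
    show "S m \<subseteq> S n" by (rule lift_Suc_mono_le[OF _ that]) (use C(6) in blast)
  qed
  define M where "M = closure (\<Union>n. convex hull S n)"
  have "convex (\<Union>n. convex hull S n)"
  proof (rule convexI)
    fix a b and u v :: real assume "a \<in> (\<Union>n. convex hull S n)" "b \<in> (\<Union>n. convex hull S n)"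
      and uv: "0 \<le> u" "0 \<le> v" "u + v = 1"
    then obtain m n where "a \<in> convex hull S m" "b \<in> convex hull S n" by blast
    then have "a \<in> convex hull S (max m n)" "b \<in> convex hull S (max m n)"
      using mono[of m "max m n"] mono[of n "max m n"] by auto
    then have "u *\<^sub>R a + v *\<^sub>R b \<in> convex hull S (max m n)"
      using uv by (intro convexD convex_convex_hull)
    then show "u *\<^sub>R a + v *\<^sub>R b \<in> (\<Union>n. convex hull S n)" by blast
  qed
  then have "closedin weak_topology M"
    unfolding M_def by (intro closedin_weak_convex convex_closure) auto
  then have "closedin T (D \<inter> M)" unfolding T_def by (intro closedin_subtopology_Int_closedin) auto
  then have clo: "closedin T (C n \<inter> (D \<inter> M))" for n by (rule closedin_Int[OF C(1)])
  have "x n \<in> C n \<inter> (D \<inter> M)" for n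
  proof -
    have xC: "x n \<in> C n" using C(2,4) by blast
    have xD: "x n \<in> D" using xC closedin_subset[OF C(1)[of n]] top by blast
    have "x n \<in> convex hull S (Suc n)" unfolding C(6) by (rule hull_inc) simp
    then have "x n \<in> (\<Union>n. convex hull S n)" by blast
    then have "x n \<in> M" unfolding M_def by (rule subsetD[OF closure_subset])
    then show ?thesis using xC xD by blast
  qed
  then have ne: "C n \<inter> (D \<inter> M) \<noteq> {}" for n by blast
  have "C (Suc n) \<subseteq> C n" for n using C(2,3) by blast
  then have "decseq (\<lambda>n. C n \<inter> (D \<inter> M))"
    by (intro decseq_SucI) blast
  then have "(\<Inter>n. C n \<inter> (D \<inter> M)) \<noteq> {}"
    by (rule compact_space_imp_nest[OF comp clo ne])
  then obtain y where y: "\<And>n. y \<in> C n" "y \<in> M" by blast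
  \<comment> \<open>The common point is a norm limit of convex combinations of finitely many chosen
    points, yet it keeps distance \<open>e / 4\<close> from each of these hulls.\<close>
  then obtain k where "k \<in> (\<Union>n. convex hull S n)" "dist k y < e / 4"
    unfolding M_def closure_approachable using e by (meson divide_pos_pos zero_less_numeral)
  then obtain n where "k \<in> convex hull S n" "norm (y - k) < e / 4"
    by (auto simp: dist_norm norm_minus_commute)
  then show False using C(5)[OF y(1)] by fastforce
qed

text \<open>
  Only functionals near \<open>f0\<close> matter for a slice of \<open>W\<close> by a functional near \<open>f0\<close>, so \<open>W\<close> may be
  replaced by a minimal weakly closed subset \<open>D\<close> on which they all attain their maximum over \<open>W\<close>.
\<close>

lemma minimal_maximizing_set:
  fixes W :: "'a::real_normed_vector set"
  assumes W: "compactin weak_topology W" "W \<noteq> {}"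
  obtains D where "closedin weak_topology D" "D \<subseteq> W"
    "\<And>f. f \<in> V \<Longrightarrow> \<exists>x\<in>D. blinfun_apply f x = support_fun f W"
    "\<And>E. closedin weak_topology E \<Longrightarrow> E \<subseteq> D \<Longrightarrow>
      (\<And>f. f \<in> V \<Longrightarrow> \<exists>x\<in>E. blinfun_apply f x = support_fun f W) \<Longrightarrow> E = D"
proof -
  define \<D> where "\<D> = {D. closedin weak_topology D \<and> D \<subseteq> W \<and>
    (\<forall>f\<in>V. \<exists>x\<in>D. blinfun_apply f x = support_fun f W)}"
  have "W \<in> \<D>"
    using W support_fun_attained[OF W] compactin_imp_closedin[OF Hausdorff_weak_topology]
    by (auto simp: \<D>_def) metis
  have "\<exists>D\<in>\<D>. \<forall>E\<in>\<D>. E \<subseteq> D \<longrightarrow> E = D"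
  proof (rule predicate_Zorn[where P = "\<lambda>A B. B \<subseteq> A"])
    show "partial_order_on \<D> (relation_of (\<lambda>A B. B \<subseteq> A) \<D>)"
      by (rule partial_order_on_relation_ofI) auto
  next
    fix \<C> assume "\<C> \<in> Chains (relation_of (\<lambda>A B. B \<subseteq> A) \<D>)"
    then have \<C>: "\<C> \<subseteq> \<D>" and tot: "\<And>A B. A \<in> \<C> \<Longrightarrow> B \<in> \<C> \<Longrightarrow> A \<subseteq> B \<or> B \<subseteq> A"
      by (auto simp: Chains_def relation_of_def)
    show "\<exists>u\<in>\<D>. \<forall>a\<in>\<C>. u \<subseteq> a"
    proof (cases "\<C> = {}")
      case True
      then show ?thesis using \<open>W \<in> \<D>\<close> by auto
    next
      case False
      have clo: "closedin weak_topology A" if "A \<in> \<C>" for A using that \<C> by (auto simp: \<D>_def)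
      have att: "\<exists>x\<in>\<Inter>\<C>. blinfun_apply f x = support_fun f W" if f: "f \<in> V" for f
      proof -
        define H where "H A = {x \<in> A. blinfun_apply f x = support_fun f W}" for A
        have cloH: "closedin weak_topology (H A)" if "A \<in> \<C>" for A
        proof -
          have "H A = A \<inter> {x \<in> topspace weak_topology. blinfun_apply f x \<in> {support_fun f W}}"
            by (auto simp: H_def)
          moreover have "closedin weak_topology {x \<in> topspace weak_topology. blinfun_apply f x \<in> {support_fun f W}}"
            by (rule closedin_continuous_map_preimage[OF continuous_map_weak_functional]) simp
          ultimately show ?thesis using clo[OF that] by (simp only: closedin_Int)
        qed
        \<comment> \<open>A finite subfamily of a chain has a smallest member, and a maximizer in
          that member lies in all the others.\<close>
        have "W \<inter> \<Inter>\<F> \<noteq> {}" if fin: "finite \<F>" "\<F> \<subseteq> H ` \<C>" for \<F>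
        proof -
          obtain \<G> where \<G>: "\<G> \<subseteq> \<C>" "finite \<G>" "\<F> = H ` \<G>"
            using finite_subset_image[OF fin] by blast
          have "\<exists>A\<in>\<C>. \<forall>B\<in>\<G>. A \<subseteq> B"
            using \<G>(2,1)
          proof (induction rule: finite_induct)
            case empty
            then show ?case using False by blast
          next
            case (insert B \<G>)
            then obtain A where A: "A \<in> \<C>" "\<forall>B\<in>\<G>. A \<subseteq> B" by auto
            have B: "B \<in> \<C>" using insert.prems by simp
            show ?case
            proof (cases "A \<subseteq> B")
              case True
              then show ?thesis using A by auto
            next
              case False
              then have "B \<subseteq> A" using tot[OF A(1) B] by blast
              then show ?thesis using A(2) B by (intro bexI[of _ B]) auto
            qed
          qed
          then obtain A where A: "A \<in> \<C>" "\<forall>B\<in>\<G>. A \<subseteq> B" by blast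
          have "A \<in> \<D>" using A(1) \<C> by blast
          then obtain x where "x \<in> A" "blinfun_apply f x = support_fun f W" "A \<subseteq> W"
            using f by (auto simp: \<D>_def)
          then have "x \<in> W \<inter> \<Inter>\<F>" using A by (auto simp: \<G> H_def)
          then show ?thesis by blast
        qed
        moreover have "closedin weak_topology A" if "A \<in> H ` \<C>" for A using that cloH by auto
        ultimately have "W \<inter> \<Inter>(H ` \<C>) \<noteq> {}" using compactin_fipD[OF W(1), of "H ` \<C>"] by blast
        then show ?thesis using False by (auto simp: H_def)
      qed
      have "\<Inter>\<C> \<in> \<D>"
      proof -
        obtain A where "A \<in> \<C>" "A \<subseteq> W" using False \<C> by (auto simp: \<D>_def)
        then have "\<Inter>\<C> \<subseteq> W" by blast
        then show ?thesis using att closedin_Inter[OF False clo] by (simp add: \<D>_def)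
      qed
      then show ?thesis by blast
    qed
  qed
  then obtain D where D: "D \<in> \<D>" "\<And>E. E \<in> \<D> \<Longrightarrow> E \<subseteq> D \<Longrightarrow> E = D" by blast
  show thesis
    by (rule that[of D]) (use D in \<open>auto simp: \<D>_def intro!: D(2)\<close>)
qed

text \<open>Removing a small open piece \<open>U\<close> from the minimal set \<open>D\<close> loses
  the maximum of some \<open>f\<close> in \<open>V\<close>, so maximizers of \<open>f\<close> and of
  nearby functionals over \<open>D\<close> lie in \<open>U\<close>. Perturbing \<open>f\<close> by
  multiples of an arbitrary \<open>z\<close> in both directions then compares \<open>z\<close> on a
  slice of \<open>W\<close> with \<open>z\<close> on the small set
  \<open>D \<inter> U\<close>.\<close>

lemma small_slice_near:
  fixes W :: "'a::real_normed_vector set"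
  assumes W: "compactin weak_topology W" "W \<noteq> {}" and V: "open V" "V \<noteq> {}" and e: "0 < e"
  obtains f b where "f \<in> V" "0 < b"
    "\<And>x y. x \<in> W \<Longrightarrow> y \<in> W \<Longrightarrow> support_fun f W - b < blinfun_apply f x \<Longrightarrow>
      support_fun f W - b < blinfun_apply f y \<Longrightarrow> norm (x - y) \<le> e"
proof -
  define s where "s f = support_fun f W" for f
  obtain D where D: "closedin weak_topology D" "D \<subseteq> W"
    "\<And>f. f \<in> V \<Longrightarrow> \<exists>x\<in>D. blinfun_apply f x = s f"
    "\<And>E. closedin weak_topology E \<Longrightarrow> E \<subseteq> D \<Longrightarrow>
      (\<And>f. f \<in> V \<Longrightarrow> \<exists>x\<in>E. blinfun_apply f x = s f) \<Longrightarrow> E = D"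
    unfolding s_def using minimal_maximizing_set[OF W, of V] by metis
  have compD: "compactin weak_topology D" using closed_compactin[OF W(1) D(2,1)] .
  moreover have "D \<noteq> {}" using D(3) V(2) by blast
  ultimately obtain U where U: "openin weak_topology U" "D \<inter> U \<noteq> {}"
    "\<And>x y. x \<in> D \<inter> U \<Longrightarrow> y \<in> D \<inter> U \<Longrightarrow> norm (x - y) \<le> e / 2"
    using weakly_compact_small_open[of D "e / 2"] e by (meson half_gt_zero)
  have cloDU: "closedin weak_topology (D - U)" using D(1) U(1) by (rule closedin_diff)
  have "D - U \<noteq> D" using U(2) by blast
  then obtain f where f: "f \<in> V" "\<And>x. x \<in> D - U \<Longrightarrow> blinfun_apply f x \<noteq> s f"
    using D(4)[OF cloDU] by blast
  have bW: "bounded W" by (rule bounded_if_weakly_compact[OF W(1)])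
  have up: "blinfun_apply g x \<le> s g" if "x \<in> W" for g x
    unfolding s_def by (rule support_fun_upper[OF bW that])
  obtain a where a: "0 < a" "\<And>x. x \<in> D \<Longrightarrow> s f - a < blinfun_apply f x \<Longrightarrow> x \<in> U"
  proof (cases "D - U = {}")
    case True
    then show ?thesis using that[of 1] by auto
  next
    case False
    have cDU: "compactin weak_topology (D - U)" using closed_compactin[OF compD _ cloDU] by blast
    obtain x where x: "x \<in> D - U" "blinfun_apply f x = support_fun f (D - U)"
      using support_fun_attained[OF cDU False] by metis
    have "support_fun f (D - U) < s f" using up[of x f] f(2)[OF x(1)] x D(2) by force
    moreover have "blinfun_apply f y \<le> support_fun f (D - U)" if "y \<in> D - U" for y
      by (rule support_fun_upper[OF bounded_if_weakly_compact[OF cDU] that])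
    ultimately show ?thesis using that[of "s f - support_fun f (D - U)"] by force
  qed
  obtain M where M: "0 < M" "\<And>x. x \<in> W \<Longrightarrow> norm x \<le> M"
    using bW by (meson bounded_pos)
  obtain r where r: "0 < r" "ball f r \<subseteq> V" using V(1) f(1) open_contains_ball by blast
  \<comment> \<open>The bound by \<open>r\<close> keeps the perturbed functionals in
    \<open>V\<close>; \<open>2 * \<tau> * M < a\<close> keeps their maximizers within
    \<open>a\<close> of the maximum of \<open>f\<close>, hence in \<open>U\<close>.\<close>
  define \<tau> where "\<tau> = min (r / 2) (a / (4 * M))"
  have \<tau>: "0 < \<tau>" "\<tau> < r" "2 * \<tau> * M < a"
  proof -
    have "\<tau> * (4 * M) \<le> a" using M(1) by (simp add: \<tau>_def min_le_iff_disj pos_le_divide_eq[symmetric])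
    then show "2 * \<tau> * M < a" using a(1) by linarith
  qed (use r(1) a(1) M(1) in \<open>auto simp: \<tau>_def\<close>)
  \<comment> \<open>The slice depth \<open>\<tau> * e / 4\<close> costs \<open>e / 4\<close> for
    each of the two points, and \<open>D \<inter> U\<close> contributes the remaining
    \<open>e / 2\<close>.\<close>
  have "norm (x - y) \<le> e" if x: "x \<in> W" "s f - \<tau> * e / 4 < blinfun_apply f x"
    and y: "y \<in> W" "s f - \<tau> * e / 4 < blinfun_apply f y" for x y
  proof (rule norm_le_if_functionals_le)
    fix z :: "'a \<Rightarrow>\<^sub>L real" assume z: "norm z \<le> 1"
    have *: "\<exists>u\<in>D \<inter> U. blinfun_apply (f + c *\<^sub>R z) u = s (f + c *\<^sub>R z)" if c: "\<bar>c\<bar> = \<tau>" for c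
    proof -
      have nc: "norm (c *\<^sub>R z) \<le> \<tau>" using c z mult_left_mono[of "norm z" 1 \<tau>] \<tau>(1) by simp
      then have "f + c *\<^sub>R z \<in> V" using \<tau>(2) r(2) by (intro subsetD[OF r(2)]) (simp add: dist_norm)
      then obtain u where u: "u \<in> D" "blinfun_apply (f + c *\<^sub>R z) u = s (f + c *\<^sub>R z)" using D(3) by blast
      have cz: "\<bar>c * blinfun_apply z v\<bar> \<le> \<tau> * M" if "v \<in> W" for v
      proof -
        have "\<bar>blinfun_apply (c *\<^sub>R z) v\<bar> \<le> norm (c *\<^sub>R z) * norm v" by (rule blinfun_abs_le)
        also have "\<dots> \<le> \<tau> * M" using nc M(2)[OF that] \<tau>(1) by (intro mult_mono) auto
        finally show ?thesis by (simp add: blinfun.scaleR_left)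
      qed
      obtain v where v: "v \<in> D" "blinfun_apply f v = s f" using D(3)[OF f(1)] by blast
      have "s f - \<tau> * M \<le> blinfun_apply (f + c *\<^sub>R z) v"
        using cz[of v] v D(2) by (auto simp: blinfun.add_left blinfun.scaleR_left abs_le_iff)
      also have "\<dots> \<le> blinfun_apply (f + c *\<^sub>R z) u" using u(2) up v D(2) by auto
      also have "\<dots> \<le> blinfun_apply f u + \<tau> * M"
        using cz[of u] u(1) D(2) by (auto simp: blinfun.add_left blinfun.scaleR_left abs_le_iff)
      finally have "s f - a < blinfun_apply f u" using \<tau>(3) by (simp add: algebra_simps)
      then show ?thesis using u a(2) by blast
    qed
    obtain u v where u: "u \<in> D \<inter> U" "blinfun_apply (f + \<tau> *\<^sub>R z) u = s (f + \<tau> *\<^sub>R z)"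
      and v: "v \<in> D \<inter> U" "blinfun_apply (f + (- \<tau>) *\<^sub>R z) v = s (f + (- \<tau>) *\<^sub>R z)"
      using *[of \<tau>] *[of "- \<tau>"] \<tau>(1) by fastforce
    have "blinfun_apply f x + \<tau> * blinfun_apply z x \<le> blinfun_apply f u + \<tau> * blinfun_apply z u"
      using up[OF x(1), of "f + \<tau> *\<^sub>R z"] u(2) by (simp add: blinfun.add_left blinfun.scaleR_left)
    moreover have "blinfun_apply f y - \<tau> * blinfun_apply z y \<le> blinfun_apply f v - \<tau> * blinfun_apply z v"
      using up[OF y(1), of "f + (- \<tau>) *\<^sub>R z"] v(2)
      by (simp add: blinfun.diff_left blinfun.scaleR_left)
    moreover have "blinfun_apply f u \<le> s f" "blinfun_apply f v \<le> s f" using up u(1) v(1) D(2) by auto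
    moreover have "\<tau> * blinfun_apply z (u - v) \<le> \<tau> * (e / 2)"
      using blinfun_le_norm[OF z, of "u - v"] U(3)[OF u(1) v(1)] \<tau>(1) by (intro mult_left_mono) auto
    ultimately have "\<tau> * blinfun_apply z (x - y) \<le> \<tau> * e"
      using x(2) y(2) by (simp add: blinfun.diff_right right_diff_distrib)
    then show "blinfun_apply z (x - y) \<le> e" using \<tau>(1) by simp
  qed
  then show thesis using that[OF f(1), of "\<tau> * e / 4"] \<tau>(1) e by (simp add: s_def)
qed

text \<open>Functionals with a slice of diameter at most \<open>e\<close> form an open set, dense by
  the previous lemma; Baire's theorem in the dual gives one functional that works for all
  \<open>e\<close>.\<close>

theorem strongly_exposing_functional:
  fixes W :: "'a::real_normed_vector set"
  assumes W: "compactin weak_topology W" "W \<noteq> {}"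
  obtains f where "\<And>e. 0 < e \<Longrightarrow> \<exists>b>0. \<forall>x\<in>W. \<forall>y\<in>W. support_fun f W - b < blinfun_apply f x \<longrightarrow>
      support_fun f W - b < blinfun_apply f y \<longrightarrow> norm (x - y) \<le> e"
proof -
  define E where "E e = {f. \<exists>b>0. \<forall>x\<in>W. \<forall>y\<in>W. support_fun f W - b < blinfun_apply f x \<longrightarrow>
      support_fun f W - b < blinfun_apply f y \<longrightarrow> norm (x - y) \<le> e}" for e
  have bW: "bounded W" by (rule bounded_if_weakly_compact[OF W(1)])
  obtain M where M: "0 < M" "\<And>x. x \<in> W \<Longrightarrow> norm x \<le> M"
    using bW by (meson bounded_pos)
  have "open (E e)" for e
    unfolding open_dist
  proof
    fix f assume "f \<in> E e"
    then obtain b where b: "0 < b" "\<And>x y. x \<in> W \<Longrightarrow> y \<in> W \<Longrightarrow> support_fun f W - b < blinfun_apply f x \<Longrightarrow>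
      support_fun f W - b < blinfun_apply f y \<Longrightarrow> norm (x - y) \<le> e" by (auto simp: E_def)
    \<comment> \<open>Values and maxima change by at most \<open>b / 4\<close> each, so the slice of
      depth \<open>b / 2\<close> for \<open>g\<close> lies in the slice of depth \<open>b\<close>
      for \<open>f\<close>.\<close>
    have "g \<in> E e" if "dist g f < b / (4 * M)" for g
    proof -
      have small: "\<bar>blinfun_apply g x - blinfun_apply f x\<bar> \<le> b / 4" if x: "x \<in> W" for x
      proof -
        have "\<bar>blinfun_apply (g - f) x\<bar> \<le> norm (g - f) * norm x" by (rule blinfun_abs_le)
        also have "\<dots> \<le> b / (4 * M) * M"
          using \<open>dist g f < _\<close> M(2)[OF x] M(1) b(1) by (intro mult_mono) (auto simp: dist_norm)
        finally show ?thesis using M(1) by (simp add: blinfun.diff_left)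
      qed
      have "support_fun f W \<le> support_fun g W + b / 4"
      proof (rule support_fun_least[OF W(2)])
        fix x assume "x \<in> W"
        then show "blinfun_apply f x \<le> support_fun g W + b / 4"
          using small[of x] support_fun_upper[OF bW, of x g] by linarith
      qed
      then have "support_fun f W - b < blinfun_apply f x"
        if "x \<in> W" "support_fun g W - b / 2 < blinfun_apply g x" for x
        using small[OF that(1)] that(2) b(1) by linarith
      then have "\<forall>x\<in>W. \<forall>y\<in>W. support_fun g W - b / 2 < blinfun_apply g x \<longrightarrow>
        support_fun g W - b / 2 < blinfun_apply g y \<longrightarrow> norm (x - y) \<le> e" using b(2) by blast
      then show ?thesis using b(1) unfolding E_def by (intro CollectI exI[of _ "b / 2"]) auto
    qed
    then show "\<exists>d>0. \<forall>g. dist g f < d \<longrightarrow> g \<in> E e"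
      using b(1) M(1) by (intro exI[of _ "b / (4 * M)"]) auto
  qed
  moreover have "closure (E e) = UNIV" if "0 < e" for e
  proof -
    have "E e \<inter> V \<noteq> {}" if V: "open V" "V \<noteq> {}" for V
    proof -
      obtain f b where "f \<in> V" "0 < b"
        "\<And>x y. x \<in> W \<Longrightarrow> y \<in> W \<Longrightarrow> support_fun f W - b < blinfun_apply f x \<Longrightarrow>
        support_fun f W - b < blinfun_apply f y \<Longrightarrow> norm (x - y) \<le> e"
        using small_slice_near[OF W V \<open>0 < e\<close>] by metis
      then have "f \<in> E e \<inter> V" by (auto simp: E_def)
      then show ?thesis by blast
    qed
    from this[of "- closure (E e)"] show ?thesis using closure_subset[of "E e"] by auto
  qed
  ultimately have "euclidean closure_of \<Inter>(range (\<lambda>n. E (inverse (real (Suc n))))) = topspace euclidean"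
    by (intro Baire_category) (auto simp: completely_metrizable_space_euclidean)
  then have "\<Inter>(range (\<lambda>n. E (inverse (real (Suc n))))) \<noteq> {}" by auto
  then obtain f where f: "\<And>n. f \<in> E (inverse (real (Suc n)))" by blast
  show thesis
  proof
    fix e :: real assume "0 < e"
    then obtain n where n: "inverse (real (Suc n)) < e" using reals_Archimedean by blast
    obtain b where b: "0 < b" "\<forall>x\<in>W. \<forall>y\<in>W. support_fun f W - b < blinfun_apply f x \<longrightarrow>
      support_fun f W - b < blinfun_apply f y \<longrightarrow> norm (x - y) \<le> inverse (real (Suc n))"
      using f[of n] by (auto simp: E_def)
    have "norm (x - y) \<le> e" if "x \<in> W" "y \<in> W" "support_fun f W - b < blinfun_apply f x"
      "support_fun f W - b < blinfun_apply f y" for x y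
    proof -
      have "norm (x - y) \<le> inverse (real (Suc n))" using b(2) that by blast
      then show ?thesis using n by linarith
    qed
    then show "\<exists>b>0. \<forall>x\<in>W. \<forall>y\<in>W. support_fun f W - b < blinfun_apply f x \<longrightarrow>
      support_fun f W - b < blinfun_apply f y \<longrightarrow> norm (x - y) \<le> e"
      using b(1) by blast
  qed
qed

section \<open>Uniform countable additivity of the Pettis integral\<close>

text \<open>
  An Orlicz-Pettis argument: the subseries sums form the image of the Cantor set under a weakly
  continuous map, and changing the \<open>n\<close>-th coordinate of a point of the Cantor set does not leave a
  given neighbourhood if \<open>n\<close> is large.
\<close>

lemma subseries_weakly_summable_imp_null:
  fixes x :: "nat \<Rightarrow> 'a::real_normed_vector"
  assumes abs: "\<And>f :: 'a \<Rightarrow>\<^sub>L real. summable (\<lambda>j. \<bar>blinfun_apply f (x j)\<bar>)"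
    and ex: "\<And>b :: nat \<Rightarrow> real. (\<And>j. b j \<in> {0, 1}) \<Longrightarrow>
      \<exists>y. \<forall>f. blinfun_apply f y = (\<Sum>j. b j * blinfun_apply f (x j))"
  shows "x \<longlonglongrightarrow> 0"
proof (rule LIMSEQ_I)
  fix r :: real assume r: "0 < r"
  define K where "K = PiE UNIV (\<lambda>_ :: nat. {0, 1 :: real})"
  have K: "b \<in> K \<longleftrightarrow> (\<forall>j. b j \<in> {0, 1})" for b by (auto simp: K_def PiE_iff)
  have "compactin (product_topology (\<lambda>_. euclideanreal) UNIV) K"
    unfolding K_def by (simp add: compactin_PiE)
  then have compK: "compact K" by (simp add: euclidean_product_topology)
  define Y where "Y b = (SOME y. \<forall>f. blinfun_apply f y = (\<Sum>j. b j * blinfun_apply f (x j)))"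
    for b :: "nat \<Rightarrow> real"
  have Y: "blinfun_apply f (Y b) = (\<Sum>j. b j * blinfun_apply f (x j))" if "b \<in> K" for f b
    using someI_ex[OF ex[of b]] that unfolding Y_def K by blast
  have le1: "\<bar>b j * c\<bar> \<le> \<bar>c\<bar>" if "b \<in> K" for b j and c :: real
    using that by (auto simp: K abs_mult dest!: spec[of _ j])
  have cont: "continuous_map (top_of_set K) weak_topology Y"
  proof (rule continuous_map_into_weak)
    fix f :: "'a \<Rightarrow>\<^sub>L real"
    \<comment> \<open>Absolute summability makes the Weierstrass test applicable, so each functional
      of the subseries sum is continuous on the Cantor set.\<close>
    have "uniform_limit K (\<lambda>n b. \<Sum>j<n. b j * blinfun_apply f (x j))
      (\<lambda>b. \<Sum>j. b j * blinfun_apply f (x j)) sequentially"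
      using abs[of f] le1 by (intro Weierstrass_m_test) auto
    moreover have "continuous_on K (\<lambda>b. \<Sum>j<n. b j * blinfun_apply f (x j))" for n
      by (intro continuous_intros continuous_on_subset[OF continuous_on_product_coordinates]) auto
    ultimately have "continuous_on K (\<lambda>b. \<Sum>j. b j * blinfun_apply f (x j))"
      by (intro uniform_limit_theorem[of _ "\<lambda>n b. \<Sum>j<n. b j * blinfun_apply f (x j)"]) auto
    then have "continuous_on K (\<lambda>b. blinfun_apply f (Y b))"
      by (rule continuous_on_eq) (simp add: Y)
    then show "continuous_map (top_of_set K) euclideanreal (\<lambda>b. blinfun_apply f (Y b))" by simp
  qed
  have "compactin weak_topology (Y ` K)"
    using compK by (intro image_compactin[OF _ cont]) (simp add: compactin_subtopology)
  moreover have "(\<lambda>_. 0) \<in> K" by (simp add: K)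
  ultimately obtain U where U: "openin weak_topology U" "Y ` K \<inter> U \<noteq> {}"
    "\<And>u v. u \<in> Y ` K \<inter> U \<Longrightarrow> v \<in> Y ` K \<inter> U \<Longrightarrow> norm (u - v) \<le> r / 2"
    using weakly_compact_small_open[of "Y ` K" "r / 2"] r by (metis empty_iff half_gt_zero imageI)
  then obtain b where b: "b \<in> K" "Y b \<in> U" by blast
  have "openin (top_of_set K) {c \<in> K. Y c \<in> U}"
    using openin_continuous_map_preimage[OF cont U(1)] by simp
  then obtain V where V: "open V" "{c \<in> K. Y c \<in> U} = K \<inter> V"
    by (auto simp: openin_open)
  have near: "\<forall>\<^sub>F n in sequentially. b(n := c) \<in> V" for c
  proof -
    have "limitin (product_topology (\<lambda>_. euclideanreal) UNIV) (\<lambda>n. b(n := c)) b sequentially"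
      unfolding limitin_componentwise
    proof (intro conjI ballI)
      fix j
      have "\<forall>\<^sub>F n in sequentially. b j = (b(n := c)) j"
        by (rule eventually_sequentiallyI[of "Suc j"]) auto
      then have "(\<lambda>n. (b(n := c)) j) \<longlonglongrightarrow> b j" by (rule Lim_transform_eventually[OF tendsto_const])
      then show "limitin euclideanreal (\<lambda>n. (b(n := c)) j) (b j) sequentially" by simp
    qed auto
    then have "(\<lambda>n. b(n := c)) \<longlonglongrightarrow> b" by (simp add: euclidean_product_topology)
    moreover have "b \<in> V" using b V(2) by blast
    ultimately show ?thesis using V(1) topological_tendstoD by blast
  qed
  have "norm (x n) \<le> r / 2" if n: "b(n := 1) \<in> V" "b(n := 0) \<in> V" for n
  proof -
    have k: "b(n := 1) \<in> K" "b(n := 0) \<in> K" using b(1) by (auto simp: K)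
    have sm: "summable (\<lambda>j. c j * blinfun_apply f (x j))" if "c \<in> K" for c f
      using le1[OF that] by (intro summable_comparison_test'[OF abs[of f]]) simp
    \<comment> \<open>The two subseries differ in the single term \<open>x n\<close>, which is
      thereby a difference of two points of the small piece of the image.\<close>
    have "norm (Y (b(n := 1)) - Y (b(n := 0)) - x n) \<le> 0"
    proof (rule norm_le_if_functionals_le)
      fix f :: "'a \<Rightarrow>\<^sub>L real"
      have "blinfun_apply f (Y (b(n := 1))) - blinfun_apply f (Y (b(n := 0)))
        = (\<Sum>j. (b(n := 1)) j * blinfun_apply f (x j) - (b(n := 0)) j * blinfun_apply f (x j))"
        unfolding Y[OF k(1)] Y[OF k(2)] by (rule suminf_diff[OF sm[OF k(1)] sm[OF k(2)]])
      also have "\<dots> = (\<Sum>j\<in>{n}. (b(n := 1)) j * blinfun_apply f (x j) - (b(n := 0)) j * blinfun_apply f (x j))"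
        by (rule suminf_finite) auto
      finally show "blinfun_apply f (Y (b(n := 1)) - Y (b(n := 0)) - x n) \<le> 0"
        by (simp add: blinfun.diff_right)
    qed
    then have "x n = Y (b(n := 1)) - Y (b(n := 0))" by simp
    moreover have "b(n := 1) \<in> {c \<in> K. Y c \<in> U}" "b(n := 0) \<in> {c \<in> K. Y c \<in> U}"
      unfolding V(2) using k n by auto
    then have "norm (Y (b(n := 1)) - Y (b(n := 0))) \<le> r / 2" by (intro U(3)) auto
    ultimately show ?thesis by simp
  qed
  then have "\<forall>\<^sub>F n in sequentially. norm (x n) \<le> r / 2"
    using eventually_conj[OF near[of 1] near[of 0]] by (auto elim: eventually_mono)
  then obtain N where "\<And>n. n \<ge> N \<Longrightarrow> norm (x n) \<le> r / 2" by (auto simp: eventually_sequentially)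
  then have "norm (x n - 0) < r" if "n \<ge> N" for n using that[THEN \<open>\<And>n. n \<ge> N \<Longrightarrow> norm (x n) \<le> r / 2\<close>] r by simp
  then show "\<exists>N. \<forall>n\<ge>N. norm (x n - 0) < r" by blast
qed

lemma set_integral_sums:
  fixes g :: "'b \<Rightarrow> real"
  assumes "\<And>i::nat. A i \<in> sets M" "disjoint_family A" "set_integrable M (\<Union>i. A i) g"
  shows "(\<lambda>i. LINT t:A i|M. g t) sums (LINT t:(\<Union>i. A i)|M. g t)"
proof -
  have int: "set_integrable M (A i) g" for i
    using assms by (intro set_integrable_subset[OF assms(3)]) auto
  have "(\<lambda>n. LINT t:(\<Union>i<n. A i)|M. g t) \<longlonglongrightarrow> (LINT t:(\<Union>n. \<Union>i<n. A i)|M. g t)"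
  proof (rule set_integral_cont_up)
    show "incseq (\<lambda>n. \<Union>i<n. A i)" by (intro incseq_SucI UN_mono) auto
    have "(\<Union>n. \<Union>i<n. A i) = (\<Union>i. A i)" by blast
    then show "set_integrable M (\<Union>n. \<Union>i<n. A i) g" using assms(3) by simp
  qed (use assms(1) in auto)
  moreover have "(\<Union>n. \<Union>i<n. A i) = (\<Union>i. A i)" by blast
  moreover have "(LINT t:(\<Union>i<n. A i)|M. g t) = (\<Sum>i<n. LINT t:A i|M. g t)" for n
    using int assms(1,2) by (intro set_integral_finite_Union) (auto intro: disjoint_family_on_mono)
  ultimately show ?thesis by (simp add: sums_def)
qed

lemma sets_unit_iff: "A \<in> sets (lebesgue_on {0..1::real}) \<longleftrightarrow> A \<in> sets lebesgue \<and> A \<subseteq> {0..1}"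
  by (subst sets_restrict_space_iff) auto

lemma scalarly_integrable_set_integrable:
  assumes "scalarly_integrable \<Gamma>" "A \<in> sets lebesgue" "A \<subseteq> {0..1}"
  shows "set_integrable lebesgue A (\<lambda>t. support_fun f (\<Gamma> t))"
proof -
  have "set_integrable lebesgue {0..1} (\<lambda>t. support_fun f (\<Gamma> t))"
    unfolding set_integrable_def using assms(1)
    by (subst integrable_restrict_space[symmetric]) (auto simp: scalarly_integrable_def)
  then show ?thesis using assms(2,3) by (rule set_integrable_subset)
qed

text \<open>In each integral set a point of almost maximal norm is chosen. Every subseries of these
  points is dominated by the support function of the integral over a union, hence is summed by a
  vector; so the points tend to 0 and, being almost maximal, control the whole sets.\<close>

lemma pettis_uniformly_null:
  fixes \<Gamma> :: "real \<Rightarrow> 'a::banach set"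
  assumes P: "pettis_integrable \<Gamma>" and C: "\<And>j. C j \<in> sets lebesgue" "\<And>j. C j \<subseteq> {0..1}"
    and disj: "disjoint_family C" and e: "0 < e"
  shows "\<forall>\<^sub>F j in sequentially. \<forall>f. norm f \<le> 1 \<longrightarrow> \<bar>LINT t:C j|lebesgue. support_fun f (\<Gamma> t)\<bar> \<le> e"
proof -
  have "\<exists>W\<in>cwk. \<forall>f. support_fun f W = (LINT t:A|lebesgue. support_fun f (\<Gamma> t))"
    if "A \<in> sets lebesgue" "A \<subseteq> {0..1}" for A
    using P that by (simp add: pettis_integrable_def is_pettis_integral_def sets_unit_iff)
  then obtain V where V: "\<And>A. A \<in> sets lebesgue \<Longrightarrow> A \<subseteq> {0..1} \<Longrightarrow> V A \<in> cwk"
    "\<And>A f. A \<in> sets lebesgue \<Longrightarrow> A \<subseteq> {0..1} \<Longrightarrow>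
      support_fun f (V A) = (LINT t:A|lebesgue. support_fun f (\<Gamma> t))" by metis
  have int: "set_integrable lebesgue A (\<lambda>t. support_fun f (\<Gamma> t))"
    if "A \<in> sets lebesgue" "A \<subseteq> {0..1}" for A f
    using P that by (simp add: pettis_integrable_def scalarly_integrable_set_integrable)
  have "\<exists>x\<in>V (C j). \<forall>y\<in>V (C j). norm y \<le> norm x + e / 2" for j
  proof -
    have b: "bdd_above (norm ` V (C j))" and ne: "norm ` V (C j) \<noteq> {}"
      using cwk_bounded[OF V(1)[OF C]] cwk_nonempty[OF V(1)[OF C]]
      by (auto simp: bounded_iff bdd_above_def)
    then obtain x where x: "x \<in> V (C j)" "Sup (norm ` V (C j)) - e / 2 < norm x"
      using less_cSUP_iff[of "V (C j)" norm "Sup (norm ` V (C j)) - e / 2"] e by auto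
    have "norm y \<le> norm x + e / 2" if "y \<in> V (C j)" for y
      using cSup_upper[OF imageI[OF that, of norm] b] x(2) by simp
    then show ?thesis using x(1) by blast
  qed
  then obtain x where x: "\<And>j. x j \<in> V (C j)" "\<And>j y. y \<in> V (C j) \<Longrightarrow> norm y \<le> norm (x j) + e / 2"
    by metis
  have "x \<longlonglongrightarrow> 0"
  proof (rule subseries_weakly_summable_imp_null)
    have up: "blinfun_apply f (x j) \<le> (LINT t:C j|lebesgue. support_fun f (\<Gamma> t))" for f j
      using support_fun_upper[OF cwk_bounded[OF V(1)[OF C]] x(1)] V(2)[OF C] by metis
    show abs: "summable (\<lambda>j. \<bar>blinfun_apply f (x j)\<bar>)" for f :: "'a \<Rightarrow>\<^sub>L real"
    proof -
      \<comment> \<open>The integral of \<open>g\<close> bounds \<open>f\<close> and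
        \<open>- f\<close> at \<open>x j\<close> alike, which gives absolute summability.\<close>
      define g where "g t = \<bar>support_fun f (\<Gamma> t)\<bar> + \<bar>support_fun (- f) (\<Gamma> t)\<bar>" for t
      have ig: "set_integrable lebesgue A g" if "A \<in> sets lebesgue" "A \<subseteq> {0..1}" for A
        unfolding g_def using int[OF that] by (intro set_integral_add set_integrable_abs)
      have sg: "summable (\<lambda>j. LINT t:C j|lebesgue. g t)"
        using set_integral_sums[OF C(1) disj ig] C by (auto intro: sums_summable)
      have le: "\<bar>blinfun_apply f (x j)\<bar> \<le> (LINT t:C j|lebesgue. g t)" for j
      proof -
        have "(LINT t:C j|lebesgue. support_fun h (\<Gamma> t)) \<le> (LINT t:C j|lebesgue. g t)"
          if "h = f \<or> h = - f" for h
          using that by (intro set_integral_mono int ig C) (auto simp: g_def)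
        then have "blinfun_apply f (x j) \<le> (LINT t:C j|lebesgue. g t)"
          "blinfun_apply (- f) (x j) \<le> (LINT t:C j|lebesgue. g t)"
          using up[of f j] up[of "- f" j] order_trans by blast+
        then show ?thesis by (simp add: blinfun.minus_left)
      qed
      show ?thesis by (rule summable_comparison_test'[OF sg]) (simp add: le)
    qed
    fix b :: "nat \<Rightarrow> real" assume b: "\<And>j. b j \<in> {0, 1}"
    define B where "B j = (if b j = 1 then C j else {})" for j
    have B: "B j \<in> sets lebesgue" "B j \<subseteq> {0..1}" for j using C by (auto simp: B_def)
    have UB: "(\<Union>j. B j) \<in> sets lebesgue" "(\<Union>j. B j) \<subseteq> {0..1}" using B by auto
    have dB: "disjoint_family B" using disj by (auto simp: B_def disjoint_family_on_def)
    define l where "l f = (\<Sum>j. b j * blinfun_apply f (x j))" for f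
    have sm: "summable (\<lambda>j. b j * blinfun_apply f (x j))" for f
    proof (rule summable_comparison_test'[OF abs[of f]])
      show "norm (b j * blinfun_apply f (x j)) \<le> \<bar>blinfun_apply f (x j)\<bar>" for j
        using b[of j] by auto
    qed
    have "linear l"
    proof (rule linearI)
      show "l (f + g) = l f + l g" for f g
        unfolding l_def by (simp add: suminf_add[OF sm sm] blinfun.add_left ring_distribs)
      show "l (c *\<^sub>R f) = c *\<^sub>R l f" for c f
        unfolding l_def using suminf_mult[OF sm[of f], of c] by (simp add: blinfun.scaleR_left mult.left_commute)
    qed
    moreover have "l f \<le> support_fun f (V (\<Union>j. B j))" for f
    proof -
      have s: "(\<lambda>j. LINT t:B j|lebesgue. support_fun f (\<Gamma> t)) sums (LINT t:(\<Union>j. B j)|lebesgue. support_fun f (\<Gamma> t))"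
        by (rule set_integral_sums[OF B(1) dB int[OF UB]])
      have "b j * blinfun_apply f (x j) \<le> (LINT t:B j|lebesgue. support_fun f (\<Gamma> t))" for j
        using b[of j] up[of f j] by (auto simp: B_def set_lebesgue_integral_def)
      then have "l f \<le> (\<Sum>j. LINT t:B j|lebesgue. support_fun f (\<Gamma> t))"
        unfolding l_def using sm s by (intro suminf_le) (auto simp: sums_iff)
      then show ?thesis using s by (simp add: V(2)[OF UB] sums_iff)
    qed
    ultimately obtain y where "\<And>f. l f = blinfun_apply f y"
      using dominated_evaluation[OF V(1)[OF UB]] by metis
    then show "\<exists>y. \<forall>f. blinfun_apply f y = (\<Sum>j. b j * blinfun_apply f (x j))"
      unfolding l_def by metis
  qed
  then have "\<forall>\<^sub>F j in sequentially. norm (x j) < e / 2"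
    using e by (auto simp: tendsto_iff dest: spec[of _ "e / 2"])
  then show ?thesis
  proof (rule eventually_mono)
    fix j assume j: "norm (x j) < e / 2"
    show "\<forall>f. norm f \<le> 1 \<longrightarrow> \<bar>LINT t:C j|lebesgue. support_fun f (\<Gamma> t)\<bar> \<le> e"
    proof (intro allI impI)
      fix f :: "'a \<Rightarrow>\<^sub>L real" assume f: "norm f \<le> 1"
      have "\<bar>support_fun f (V (C j))\<bar> \<le> norm f * e"
        using x(2)[of _ j] j by (intro support_fun_le_norm cwk_nonempty V(1) C) fastforce
      also have "\<dots> \<le> e" using f e mult_right_mono[of "norm f" 1 e] by simp
      finally show "\<bar>LINT t:C j|lebesgue. support_fun f (\<Gamma> t)\<bar> \<le> e" by (simp add: V(2)[OF C])
    qed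
  qed
qed

text \<open>
  Otherwise disjoint sets \<open>C k \<subseteq> E (N k) - E (N (k + 1))\<close> with large integrals can be chosen, where
  the passage from the absolute value to the function costs a factor 2.
\<close>

lemma pettis_uniformly_absolutely_null:
  fixes \<Gamma> :: "real \<Rightarrow> 'a::banach set"
  assumes P: "pettis_integrable \<Gamma>" and E: "\<And>n. E n \<in> sets lebesgue" "\<And>n. E n \<subseteq> {0..1}"
    and dec: "decseq E" and em: "(\<Inter>n. E n) = {}" and e: "0 < e"
  shows "\<exists>N. \<forall>f. norm f \<le> 1 \<longrightarrow> (LINT t:E N|lebesgue. \<bar>support_fun f (\<Gamma> t)\<bar>) \<le> e"
proof (rule ccontr)
  assume "\<not> ?thesis"
  then have big: "\<exists>f. norm f \<le> 1 \<and> e < (LINT t:E N|lebesgue. \<bar>support_fun f (\<Gamma> t)\<bar>)" for N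
    by (meson not_le)
  have int: "set_integrable lebesgue A (\<lambda>t. support_fun f (\<Gamma> t))"
    if "A \<in> sets lebesgue" "A \<subseteq> {0..1}" for A f
    using P that by (simp add: pettis_integrable_def scalarly_integrable_set_integrable)
  have step: "\<exists>M C. N < M \<and> C \<in> sets lebesgue \<and> C \<subseteq> E N - E M \<and>
    (\<exists>f. norm f \<le> 1 \<and> e / 5 < \<bar>LINT t:C|lebesgue. support_fun f (\<Gamma> t)\<bar>)" for N
  proof -
    obtain f where f: "norm f \<le> 1" "e < (LINT t:E N|lebesgue. \<bar>support_fun f (\<Gamma> t)\<bar>)"
      using big by blast
    define g where "g t = support_fun f (\<Gamma> t)" for t
    have ia: "set_integrable lebesgue A (\<lambda>t. \<bar>g t\<bar>)" if "A \<in> sets lebesgue" "A \<subseteq> {0..1}" for A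
      unfolding g_def using int[OF that] by (rule set_integrable_abs)
    have "(\<lambda>n. LINT t:E n|lebesgue. \<bar>g t\<bar>) \<longlonglongrightarrow> (LINT t:(\<Inter>n. E n)|lebesgue. \<bar>g t\<bar>)"
      by (rule set_integral_cont_down[OF E(1) dec ia[OF E]])
    then have "(\<lambda>n. LINT t:E n|lebesgue. \<bar>g t\<bar>) \<longlonglongrightarrow> 0"
      by (simp add: em set_lebesgue_integral_def)
    then have "\<forall>\<^sub>F n in sequentially. (LINT t:E n|lebesgue. \<bar>g t\<bar>) < e / 2"
      using e by (intro order_tendstoD) auto
    then obtain M' where M': "\<And>n. n \<ge> M' \<Longrightarrow> (LINT t:E n|lebesgue. \<bar>g t\<bar>) < e / 2"
      by (auto simp: eventually_sequentially)
    \<comment> \<open>\<open>Suc N\<close> in the maximum makes the new index strictly larger, as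
      the iteration requires.\<close>
    define M where "M = max M' (Suc N)"
    have M: "N < M" "(LINT t:E M|lebesgue. \<bar>g t\<bar>) < e / 2" using M' by (auto simp: M_def)
    have EM: "E M \<subseteq> E N" using dec M(1) by (simp add: decseqD)
    define D where "D = E N - E M"
    have D: "D \<in> sets lebesgue" "D \<subseteq> {0..1}" using E by (auto simp: D_def)
    have "E N = D \<union> E M" "D \<inter> E M = {}" using EM by (auto simp: D_def)
    then have "(LINT t:E N|lebesgue. \<bar>g t\<bar>) = (LINT t:D|lebesgue. \<bar>g t\<bar>) + (LINT t:E M|lebesgue. \<bar>g t\<bar>)"
      using set_integral_Un[OF _ ia[OF D] ia[OF E]] by metis
    then have large: "e / 2 < (LINT t:D|lebesgue. \<bar>g t\<bar>)" using f(2) M(2) by (simp add: g_def)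
    define Dp where "Dp = {t \<in> D. 0 \<le> g t}"
    have "(\<lambda>t. indicator D t *\<^sub>R g t) \<in> borel_measurable lebesgue"
      using int[OF D, of f] unfolding set_integrable_def g_def by (rule borel_measurable_integrable)
    then have "{t \<in> space lebesgue. 0 \<le> indicator D t *\<^sub>R g t} \<in> sets lebesgue"
      by (intro borel_measurable_le) auto
    then have "D \<inter> {t \<in> space lebesgue. 0 \<le> indicator D t *\<^sub>R g t} \<in> sets lebesgue" using D(1) by auto
    moreover have "D \<inter> {t \<in> space lebesgue. 0 \<le> indicator D t *\<^sub>R g t} = Dp"
      by (auto simp: Dp_def)
    ultimately have Dp: "Dp \<in> sets lebesgue" "Dp \<subseteq> {0..1}" using D(2) by (auto simp: Dp_def)
    define Dn where "Dn = D - Dp"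
    have Dn: "Dn \<in> sets lebesgue" "Dn \<subseteq> {0..1}" using D Dp by (auto simp: Dn_def)
    have "D = Dp \<union> Dn" "Dp \<inter> Dn = {}" by (auto simp: Dn_def Dp_def)
    then have "(LINT t:D|lebesgue. \<bar>g t\<bar>) = (LINT t:Dp|lebesgue. \<bar>g t\<bar>) + (LINT t:Dn|lebesgue. \<bar>g t\<bar>)"
      using set_integral_Un[OF _ ia[OF Dp] ia[OF Dn]] by metis
    also have "(LINT t:Dp|lebesgue. \<bar>g t\<bar>) = (LINT t:Dp|lebesgue. g t)"
      by (rule set_lebesgue_integral_cong) (use Dp in \<open>auto simp: Dp_def\<close>)
    also have "(LINT t:Dn|lebesgue. \<bar>g t\<bar>) = (LINT t:Dn|lebesgue. - g t)"
      by (rule set_lebesgue_integral_cong) (use Dn in \<open>auto simp: Dn_def Dp_def\<close>)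
    also have "\<dots> = - (LINT t:Dn|lebesgue. g t)"
      unfolding g_def by (rule set_integral_uminus[OF int[OF Dn]])
    \<comment> \<open>The positive and negative parts together exceed \<open>e / 2\<close>, so one
      exceeds \<open>e / 4\<close>; \<open>e / 5\<close> leaves room.\<close>
    finally have "e / 5 < \<bar>LINT t:Dp|lebesgue. g t\<bar> \<or> e / 5 < \<bar>LINT t:Dn|lebesgue. g t\<bar>"
      using large e by linarith
    moreover have "Dp \<subseteq> E N - E M" "Dn \<subseteq> E N - E M" by (auto simp: Dn_def Dp_def D_def)
    ultimately show ?thesis using M(1) Dp(1) Dn(1) f(1) unfolding g_def by blast
  qed
  then obtain M C where MC: "\<And>N. N < M N" "\<And>N. C N \<in> sets lebesgue" "\<And>N. C N \<subseteq> E N - E (M N)"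
    "\<And>N. \<exists>f. norm f \<le> 1 \<and> e / 5 < \<bar>LINT t:C N|lebesgue. support_fun f (\<Gamma> t)\<bar>" by metis
  define N where "N k = (M ^^ k) 0" for k
  have N: "N (Suc k) = M (N k)" for k by (simp add: N_def)
  have mono: "N i \<le> N j" if "i \<le> j" for i j
    by (rule lift_Suc_mono_le[OF _ that]) (unfold N, rule less_imp_le, rule MC(1))
  have "C (N i) \<inter> C (N j) = {}" if "i < j" for i j
  proof -
    have "C (N i) \<inter> E (N j) = {}"
      using MC(3)[of "N i"] decseqD[OF dec mono[of "Suc i" j]] that by (auto simp: N)
    then show ?thesis using MC(3)[of "N j"] by blast
  qed
  then have "disjoint_family (\<lambda>k. C (N k))"
    unfolding disjoint_family_on_def by (metis inf_commute linorder_neqE_nat)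
  moreover have "C (N k) \<subseteq> {0..1}" for k using MC(3)[of "N k"] E(2)[of "N k"] by blast
  ultimately have "\<forall>\<^sub>F k in sequentially. \<forall>f. norm f \<le> 1 \<longrightarrow>
      \<bar>LINT t:C (N k)|lebesgue. support_fun f (\<Gamma> t)\<bar> \<le> e / 5"
    using e MC(2) by (intro pettis_uniformly_null[OF P]) auto
  then obtain k where "\<forall>f. norm f \<le> 1 \<longrightarrow> \<bar>LINT t:C (N k)|lebesgue. support_fun f (\<Gamma> t)\<bar> \<le> e / 5"
    by (auto simp: eventually_sequentially)
  then show False using MC(4)[of "N k"] by (meson not_le)
qed

section \<open>Riemann sums and gauges\<close>

lemma riemann_sum_cwk:
  assumes "\<forall>t\<in>{0..1}. \<Gamma> t \<in> cwk" "finite p" "\<And>t I. (t, I) \<in> p \<Longrightarrow> t \<in> {0..1}"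
  shows "riemann_sum \<Gamma> p \<in> cwk"
  unfolding riemann_sum_def using assms(1,3)
  by (intro cwk_sum[OF assms(2)]) (auto intro!: cwk_scale)

lemma support_fun_riemann_sum:
  assumes "\<forall>t\<in>{0..1}. \<Gamma> t \<in> cwk" "finite p" "\<And>t I. (t, I) \<in> p \<Longrightarrow> t \<in> {0..1}"
  shows "support_fun f (riemann_sum \<Gamma> p) = (\<Sum>(t, I)\<in>p. measure lborel I * support_fun f (\<Gamma> t))"
proof -
  have *: "\<Gamma> t \<in> cwk" if "(t, I) \<in> p" for t I using assms that by blast
  have "support_fun f (riemann_sum \<Gamma> p)
      = (\<Sum>w\<in>p. support_fun f (case w of (t, I) \<Rightarrow> (*\<^sub>R) (measure lborel I) ` \<Gamma> t))"
    unfolding riemann_sum_def using * by (intro support_fun_sum[OF assms(2)]) (auto intro!: cwk_scale)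
  also have "\<dots> = (\<Sum>(t, I)\<in>p. measure lborel I * support_fun f (\<Gamma> t))"
    using * by (intro sum.cong) (auto simp: support_fun_scale cwk_bounded cwk_nonempty)
  finally show ?thesis .
qed

lemma support_fun_near_riemann_sum:
  fixes \<Gamma> :: "real \<Rightarrow> 'a::real_normed_vector set"
  assumes \<Gamma>: "\<forall>t\<in>{0..1}. \<Gamma> t \<in> cwk" and W: "W \<in> cwk" and p: "free_tagged_partition p"
    and d: "hausdorff_dist W (riemann_sum \<Gamma> p) < e" and f: "norm f \<le> 1"
  shows "\<bar>support_fun f W - (\<Sum>(t, I)\<in>p. measure lborel I * support_fun f (\<Gamma> t))\<bar> \<le> e"
proof -
  have p': "finite p" "\<And>t I. (t, I) \<in> p \<Longrightarrow> t \<in> {0..1}"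
    using p by (auto simp: free_tagged_partition_def)
  have R: "riemann_sum \<Gamma> p \<in> cwk" by (rule riemann_sum_cwk[OF \<Gamma> p'])
  have le: "\<bar>support_fun g W - support_fun g (riemann_sum \<Gamma> p)\<bar> \<le> norm g * hausdorff_dist W (riemann_sum \<Gamma> p)" for g
    using W R by (intro support_fun_hausdorff_dist cwk_bounded cwk_nonempty)
  have "norm f * hausdorff_dist W (riemann_sum \<Gamma> p) \<le> e"
  proof (cases "0 \<le> hausdorff_dist W (riemann_sum \<Gamma> p)")
    case True
    then show ?thesis using mult_right_mono[OF f True] d by simp
  next
    \<comment> \<open>As a maximum of real suprema the distance is not nonnegative by definition; on
      bounded nonempty sets it dominates some \<open>infdist\<close>.\<close>
    case False
    obtain x where "x \<in> W" using cwk_nonempty[OF W] by blast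
    then have "infdist x (riemann_sum \<Gamma> p) \<le> hausdorff_dist W (riemann_sum \<Gamma> p)"
      unfolding hausdorff_dist_def
      using bdd_above_infdist[OF cwk_bounded[OF W] cwk_nonempty[OF R]]
      by (intro max.coboundedI1 cSUP_upper)
    then show ?thesis using False infdist_nonneg[of x "riemann_sum \<Gamma> p"] by linarith
  qed
  then show ?thesis using le[of f] by (simp add: support_fun_riemann_sum[OF \<Gamma> p'])
qed

text \<open>The predicate \<open>P\<close> lets Perron and free partitions share their estimates.
  The bound is non-strict because it is converted back by \<open>hausdorff_dist_le\<close>.\<close>

definition adapted_gauge ::
  "((real \<times> real set) set \<Rightarrow> bool) \<Rightarrow> (real \<Rightarrow> 'a::real_normed_vector set) \<Rightarrow> 'a set \<Rightarrow> real \<Rightarrow>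
    (real \<Rightarrow> real) \<Rightarrow> bool" where
  "adapted_gauge P \<Gamma> W e \<delta> \<longleftrightarrow> (\<forall>t\<in>{0..1}. 0 < \<delta> t) \<and>
    (\<forall>p f. P p \<longrightarrow> (\<lambda>t. ball t (\<delta> t)) fine p \<longrightarrow> norm f \<le> 1 \<longrightarrow>
      \<bar>support_fun f W - (\<Sum>(t, I)\<in>p. measure lborel I * support_fun f (\<Gamma> t))\<bar> \<le> e)"

abbreviation "perron_gauge \<equiv> adapted_gauge (\<lambda>p. p tagged_division_of {0..1})"
abbreviation "free_gauge \<equiv> adapted_gauge free_tagged_partition"

lemma adapted_gaugeD:
  assumes "adapted_gauge P \<Gamma> W e \<delta>"
  shows "\<And>t. t \<in> {0..1} \<Longrightarrow> 0 < \<delta> t"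
    "\<And>p f. P p \<Longrightarrow> (\<lambda>t. ball t (\<delta> t)) fine p \<Longrightarrow> norm f \<le> 1 \<Longrightarrow>
      \<bar>support_fun f W - (\<Sum>(t, I)\<in>p. measure lborel I * support_fun f (\<Gamma> t))\<bar> \<le> e"
  using assms unfolding adapted_gauge_def by (simp, metis)

lemma H_integral_gauge:
  fixes \<Gamma> :: "real \<Rightarrow> 'a::real_normed_vector set"
  assumes \<Gamma>: "\<forall>t\<in>{0..1}. \<Gamma> t \<in> cwk" and W: "W \<in> cwk" "is_H_integral \<Gamma> W" and e: "0 < e"
  shows "\<exists>\<delta>. perron_gauge \<Gamma> W e \<delta> \<and> \<delta> \<in> borel_measurable (lebesgue_on {0..1})"
proof -
  obtain \<delta> :: "real \<Rightarrow> real" where \<delta>: "\<forall>t\<in>{0..1}. 0 < \<delta> t" "\<delta> \<in> borel_measurable (lebesgue_on {0..1})"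
    "\<forall>p. p tagged_division_of {0..1} \<and> (\<lambda>t. ball t (\<delta> t)) fine p \<longrightarrow> hausdorff_dist W (riemann_sum \<Gamma> p) < e"
    using W(2)[unfolded is_H_integral_def, rule_format, OF e] by (elim exE conjE) blast
  have "\<bar>support_fun f W - (\<Sum>(t, I)\<in>p. measure lborel I * support_fun f (\<Gamma> t))\<bar> \<le> e"
    if p: "p tagged_division_of {0..1}" "(\<lambda>t. ball t (\<delta> t)) fine p" and f: "norm f \<le> 1" for p f
  proof (rule support_fun_near_riemann_sum[OF \<Gamma> W(1) _ _ f])
    show "free_tagged_partition p" using p(1) tagged_division_iff_free_tagged_partition by blast
    show "hausdorff_dist W (riemann_sum \<Gamma> p) < e" using \<delta>(3) p by blast
  qed
  then have "perron_gauge \<Gamma> W e \<delta>" using \<delta>(1) by (simp add: adapted_gauge_def)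
  then show ?thesis using \<delta>(2) by blast
qed

lemma mcshane_integral_gauge:
  fixes \<Gamma> :: "real \<Rightarrow> 'a::real_normed_vector set"
  assumes \<Gamma>: "\<forall>t\<in>{0..1}. \<Gamma> t \<in> cwk" and W: "W \<in> cwk" "is_mcshane_integral \<Gamma> W" and e: "0 < e"
  shows "\<exists>\<delta>. free_gauge \<Gamma> W e \<delta>"
proof -
  obtain \<delta> :: "real \<Rightarrow> real" where \<delta>: "\<forall>t\<in>{0..1}. 0 < \<delta> t"
    "\<forall>p. free_tagged_partition p \<and> (\<lambda>t. ball t (\<delta> t)) fine p \<longrightarrow> hausdorff_dist W (riemann_sum \<Gamma> p) < e"
    using W(2)[unfolded is_mcshane_integral_def, rule_format, OF e] by (elim exE conjE) blast
  have "\<bar>support_fun f W - (\<Sum>(t, I)\<in>p. measure lborel I * support_fun f (\<Gamma> t))\<bar> \<le> e"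
    if p: "free_tagged_partition p" "(\<lambda>t. ball t (\<delta> t)) fine p" and f: "norm f \<le> 1" for p f
    using \<delta>(2) p by (intro support_fun_near_riemann_sum[OF \<Gamma> W(1) p(1) _ f]) blast
  then show ?thesis using \<delta>(1) by (intro exI[of _ \<delta>]) (simp add: adapted_gauge_def)
qed

lemma free_gauge_imp_perron_gauge: "free_gauge \<Gamma> W e \<delta> \<Longrightarrow> perron_gauge \<Gamma> W e \<delta>"
  by (simp add: adapted_gauge_def tagged_division_iff_free_tagged_partition)

lemma support_fun_scale_functional:
  assumes "C \<in> cwk" "0 \<le> c"
  shows "support_fun (c *\<^sub>R f) C = c * support_fun f C"
  by (rule sublinear_scale[OF sublinear_support_fun[OF cwk_bounded[OF assms(1)] cwk_nonempty[OF assms(1)]] assms(2)])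

text \<open>The functions \<open>\<delta>\<close> are positive on the unit interval only, whereas
  \<open>gauge\<close> concerns all reals; radius 1 is a default for the other points.\<close>

lemma gauge_on_unit_interval:
  assumes "\<And>t. t \<in> {0..1} \<Longrightarrow> 0 < \<delta> t"
  shows "gauge (\<lambda>t :: real. if t \<in> {0..1} then ball t (\<delta> t) else ball t 1)"
  using assms by (auto simp: gauge_def)

lemma fine_unit_interval_cong:
  assumes "\<And>t. t \<in> {0..1::real} \<Longrightarrow> \<gamma> t = \<gamma>' t" "p tagged_division_of {0..1}" "\<gamma> fine p"
  shows "\<gamma>' fine p"
  unfolding fine_def
proof
  fix w assume w: "w \<in> p"
  then have "fst w \<in> {0..1}" using tagged_division_ofD(2,3)[OF assms(2), of "fst w" "snd w"] by auto
  moreover have "snd w \<subseteq> \<gamma> (fst w)" using w fineD[OF assms(3), of "fst w" "snd w"] by simp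
  ultimately show "case w of (x, k) \<Rightarrow> k \<subseteq> \<gamma>' x" using assms(1) by (simp add: case_prod_unfold)
qed

text \<open>On the unit ball this is the definition of the Henstock-Kurzweil integral; other
  functionals are scaled into the ball, positive homogeneity of support functions doing the
  rest.\<close>

lemma perron_gauges_has_integral:
  fixes \<Gamma> :: "real \<Rightarrow> 'a::real_normed_vector set"
  assumes \<Gamma>: "\<forall>t\<in>{0..1}. \<Gamma> t \<in> cwk" and W: "W \<in> cwk"
    and gauges: "\<And>e. 0 < e \<Longrightarrow> \<exists>\<delta>. perron_gauge \<Gamma> W e \<delta>"
  shows "((\<lambda>t. support_fun f (\<Gamma> t)) has_integral support_fun f W) {0..1}"
proof -
  have unit: "((\<lambda>t. support_fun f (\<Gamma> t)) has_integral support_fun f W) {0..1}" if f: "norm f \<le> 1" for f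
    unfolding box_real(2)[symmetric] has_integral
  proof (intro allI impI)
    fix e :: real assume e: "0 < e"
    obtain \<delta> where \<delta>: "perron_gauge \<Gamma> W (e / 2) \<delta>"
      using gauges[OF half_gt_zero[OF e]] by blast
    define \<gamma> where "\<gamma> t = (if t \<in> {0..1} then ball t (\<delta> t) else ball t 1)" for t
    have \<gamma>: "gauge \<gamma>" "\<And>t. t \<in> {0..1} \<Longrightarrow> \<gamma> t = ball t (\<delta> t)"
      using gauge_on_unit_interval[OF adapted_gaugeD(1)[OF \<delta>]] by (auto simp: \<gamma>_def[abs_def])
    show "\<exists>\<gamma>. gauge \<gamma> \<and> (\<forall>\<D>. \<D> tagged_division_of cbox 0 1 \<and> \<gamma> fine \<D> \<longrightarrow>
        norm ((\<Sum>(x, k)\<in>\<D>. measure lborel k *\<^sub>R support_fun f (\<Gamma> x)) - support_fun f W) < e)"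
    proof (intro exI[of _ \<gamma>] conjI allI impI)
      fix \<D> assume "\<D> tagged_division_of cbox (0::real) 1 \<and> \<gamma> fine \<D>"
      then have D: "\<D> tagged_division_of {0..1::real}" "\<gamma> fine \<D>" by auto
      have fD: "(\<lambda>t. ball t (\<delta> t)) fine \<D>" by (rule fine_unit_interval_cong[OF \<gamma>(2) D])
      then show "norm ((\<Sum>(x, k)\<in>\<D>. measure lborel k *\<^sub>R support_fun f (\<Gamma> x)) - support_fun f W) < e"
        using adapted_gaugeD(2)[OF \<delta> D(1) fD f] e by (simp add: abs_minus_commute)
    qed (rule \<gamma>)
  qed
  define c where "c = norm f + 1"
  have c: "0 < c" by (simp add: c_def add_nonneg_pos)
  have "norm ((1 / c) *\<^sub>R f) \<le> 1" using c by (simp add: c_def divide_simps)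
  from has_integral_mult_right[OF unit[OF this], of c]
  have "((\<lambda>t. c * support_fun ((1 / c) *\<^sub>R f) (\<Gamma> t)) has_integral support_fun f W) {0..1}"
    using c W by (simp add: support_fun_scale_functional)
  then show ?thesis
    by (rule has_integral_eq[rotated]) (use c \<Gamma> in \<open>simp add: support_fun_scale_functional\<close>)
qed

lemma H_integral_has_integral:
  fixes \<Gamma> :: "real \<Rightarrow> 'a::real_normed_vector set"
  assumes \<Gamma>: "\<forall>t\<in>{0..1}. \<Gamma> t \<in> cwk" and W: "W \<in> cwk" "is_H_integral \<Gamma> W"
  shows "((\<lambda>t. support_fun f (\<Gamma> t)) has_integral support_fun f W) {0..1}"
  using H_integral_gauge[OF \<Gamma> W] by (intro perron_gauges_has_integral[OF \<Gamma> W(1)]) blast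

text \<open>Distinct tagged intervals that are identified by retagging have empty interior.\<close>

lemma retag_partition:
  fixes u :: "real \<times> real set \<Rightarrow> real" and h :: "real \<Rightarrow> real"
  assumes q: "q tagged_division_of {0..1::real}" and u: "\<And>x K. (x, K) \<in> q \<Longrightarrow> u (x, K) \<in> {0..1}"
    and fine: "\<And>x K. (x, K) \<in> q \<Longrightarrow> K \<subseteq> \<gamma> (u (x, K))"
  defines "q' \<equiv> (\<lambda>w. (u w, snd w)) ` q"
  shows "free_tagged_partition q'" "\<gamma> fine q'"
    "(\<Sum>(t, K)\<in>q'. measure lborel K * h t) = (\<Sum>w\<in>q. measure lborel (snd w) * h (u w))"
    "(\<And>x K. (x, K) \<in> q \<Longrightarrow> u (x, K) \<in> K) \<Longrightarrow> q' tagged_division_of {0..1}"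
proof -
  have fq: "free_tagged_partition q" using q tagged_division_iff_free_tagged_partition by blast
  then have fin: "finite q" and iv: "\<And>x K. (x, K) \<in> q \<Longrightarrow> \<exists>a b. a \<le> b \<and> K = {a..b}"
    and dj: "\<And>P Q. P \<in> q \<Longrightarrow> Q \<in> q \<Longrightarrow> P \<noteq> Q \<Longrightarrow> interior (snd P) \<inter> interior (snd Q) = {}"
    and un: "\<Union> (snd ` q) = {0..1}"
    unfolding free_tagged_partition_def by (simp, fast, simp, simp)
  have "snd ` q' = snd ` q" by (simp add: q'_def image_image)
  then show free: "free_tagged_partition q'"
    unfolding free_tagged_partition_def using fin un
  proof (intro conjI ballI impI)
    show "finite q'" using fin by (simp add: q'_def)
  next
    fix w assume "w \<in> q'"
    then obtain x K where "(x, K) \<in> q" "w = (u (x, K), K)" by (auto simp: q'_def)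
    then show "case w of (t, I) \<Rightarrow> t \<in> {0..1} \<and> (\<exists>a b. a \<le> b \<and> I = {a..b})" using u iv by auto
  next
    fix P Q assume "P \<in> q'" "Q \<in> q'" "P \<noteq> Q"
    then obtain P' Q' where "P' \<in> q" "Q' \<in> q" "P = (u P', snd P')" "Q = (u Q', snd Q')"
      by (auto simp: q'_def)
    then show "interior (snd P) \<inter> interior (snd Q) = {}" using dj[of P' Q'] \<open>P \<noteq> Q\<close> by auto
  qed simp
  show "\<gamma> fine q'" unfolding fine_def
  proof
    fix w assume "w \<in> q'"
    then obtain x K where "(x, K) \<in> q" "w = (u (x, K), K)" by (auto simp: q'_def)
    then show "case w of (x, k) \<Rightarrow> k \<subseteq> \<gamma> x" using fine by simp
  qed
  have "(\<Sum>w\<in>q'. case w of (t, K) \<Rightarrow> measure lborel K * h t)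
      = (\<Sum>w\<in>q. case (u w, snd w) of (t, K) \<Rightarrow> measure lborel K * h t)"
    unfolding q'_def
  proof (rule sum.reindex_nontrivial[OF fin, unfolded o_def])
    fix P Q assume PQ: "P \<in> q" "Q \<in> q" "P \<noteq> Q" "(u P, snd P) = (u Q, snd Q)"
    obtain a b where ab: "a \<le> b" "snd P = {a..b}" using iv[of "fst P" "snd P"] PQ(1) by auto
    have "interior (snd P) = {}" using dj[OF PQ(1-3)] PQ(4) by simp
    then have "a = b" using ab by simp
    then show "(case (u P, snd P) of (t, K) \<Rightarrow> measure lborel K * h t) = 0" using ab(2) by simp
  qed
  then show "(\<Sum>(t, K)\<in>q'. measure lborel K * h t) = (\<Sum>w\<in>q. measure lborel (snd w) * h (u w))"
    by simp
  show "q' tagged_division_of {0..1}" if "\<And>x K. (x, K) \<in> q \<Longrightarrow> u (x, K) \<in> K"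
    unfolding tagged_division_iff_free_tagged_partition using free that by (auto simp: q'_def)
qed

section \<open>Division of the unit interval into cells of equal length\<close>

definition cell :: "nat \<Rightarrow> nat \<Rightarrow> real set" where
  "cell N q = {real q / real N..real (Suc q) / real N}"

lemma cell_division:
  assumes "0 < N"
  shows "cell N ` {..<N} division_of {0..1}" "inj_on (cell N) {..<N}"
proof -
  have N: "0 < real N" using assms by simp
  show "inj_on (cell N) {..<N}"
  proof (rule inj_onI)
    fix i j assume "cell N i = cell N j"
    moreover have "real k / real N \<le> real (Suc k) / real N" for k using N by (simp add: divide_right_mono)
    ultimately have "real i / real N = real j / real N"
      unfolding cell_def using Icc_eq_Icc by (metis (no_types, lifting))
    then show "i = j" using N by simp
  qed
  have sep: "interior (cell N i) \<inter> interior (cell N j) = {}" if "i < j" for i j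
  proof -
    have "real (Suc i) / real N \<le> real j / real N" using that N by (intro divide_right_mono) auto
    then show ?thesis by (auto simp: cell_def)
  qed
  show "cell N ` {..<N} division_of {0..1}"
    unfolding division_of_def
  proof (intro conjI ballI impI)
    fix K assume "K \<in> cell N ` {..<N}"
    then obtain i where i: "i < N" "K = cell N i" by auto
    have "real (Suc i) / real N \<le> 1" using i(1) N by simp
    moreover have "0 \<le> real i / real N" by simp
    moreover have "real i / real N \<le> real (Suc i) / real N" using N by (simp add: divide_right_mono)
    ultimately show "K \<subseteq> {0..1}" "K \<noteq> {}" by (auto simp: i(2) cell_def)
    show "\<exists>a b. K = cbox a b" unfolding i(2) cell_def by (metis box_real(2))
  next
    fix K L assume "K \<in> cell N ` {..<N}" "L \<in> cell N ` {..<N}" "K \<noteq> L"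
    then obtain i j where "K = cell N i" "L = cell N j" "i \<noteq> j" by auto
    then show "interior K \<inter> interior L = {}" using sep[of i j] sep[of j i] by (metis inf_commute linorder_neqE_nat)
  next
    have "t \<in> \<Union> (cell N ` {..<N})" if t: "t \<in> {0..1}" for t
    \<comment> \<open>For \<open>t = 1\<close> the floor used below would give the index
      \<open>N\<close>, one too many.\<close>
    proof (cases "t = 1")
      case True
      then have "t \<in> cell N (N - 1)" using assms by (simp add: cell_def divide_simps)
      then show ?thesis using assms by (intro UN_I[of "N - 1"]) auto
    next
      case False
      define i where "i = nat \<lfloor>t * real N\<rfloor>"
      have "0 \<le> t * real N" "t * real N < real N" using t False N by auto
      then have "real i \<le> t * real N" "t * real N \<le> real (Suc i)" "i < N"
        by (auto simp: i_def) linarith+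
      then have "t \<in> cell N i" using N by (simp add: cell_def field_simps)
      then show ?thesis using \<open>i < N\<close> by blast
    qed
    moreover have "cell N i \<subseteq> {0..1}" if "i < N" for i
    proof -
      have "real (Suc i) / real N \<le> 1" using that N by simp
      moreover have "0 \<le> real i / real N" by simp
      ultimately show ?thesis by (auto simp: cell_def)
    qed
    ultimately show "\<Union> (cell N ` {..<N}) = {0..1}" by blast
  qed simp
qed

section \<open>Selections\<close>

lemma sum_singletons: "finite I \<Longrightarrow> (\<Sum>i\<in>I. {x i}) = {\<Sum>i\<in>I. x i}" for x :: "_ \<Rightarrow> 'a::comm_monoid_add"
  by (induction rule: finite_induct) (auto simp: set_zero set_plus_def)

lemma sum_in_set_sum:
  fixes x :: "_ \<Rightarrow> 'a::comm_monoid_add"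
  assumes "finite I" "\<And>i. i \<in> I \<Longrightarrow> x i \<in> C i"
  shows "(\<Sum>i\<in>I. x i) \<in> (\<Sum>i\<in>I. C i)"
  using assms by (induction rule: finite_induct) (auto simp: set_zero)

lemma riemann_sum_singletons:
  assumes "finite p"
  shows "riemann_sum (\<lambda>t. {g t}) p = {\<Sum>(t, I)\<in>p. measure lborel I *\<^sub>R g t}"
proof -
  have "riemann_sum (\<lambda>t. {g t}) p = (\<Sum>w\<in>p. {measure lborel (snd w) *\<^sub>R g (fst w)})"
    unfolding riemann_sum_def by (intro sum.cong) auto
  then show ?thesis by (simp add: sum_singletons[OF assms] case_prod_unfold)
qed

text \<open>
  Maximizing over \<open>\<Gamma> t\<close> a functional that strongly exposes a point of the integral forces the
  Riemann sums of the selection to converge to that point.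
\<close>

theorem H_integrable_selection:
  fixes \<Gamma> :: "real \<Rightarrow> 'a::real_normed_vector set"
  assumes \<Gamma>: "\<forall>t\<in>{0..1}. \<Gamma> t \<in> cwk" and W: "W \<in> cwk" "is_H_integral \<Gamma> W"
  shows "\<exists>g. g \<in> selections \<Gamma> \<and> H_integrable_fun g"
proof -
  obtain f where f: "\<And>e. 0 < e \<Longrightarrow> \<exists>b>0. \<forall>x\<in>W. \<forall>y\<in>W. support_fun f W - b < blinfun_apply f x \<longrightarrow>
      support_fun f W - b < blinfun_apply f y \<longrightarrow> norm (x - y) \<le> e"
    using strongly_exposing_functional[OF cwk_compact[OF W(1)] cwk_nonempty[OF W(1)]] by metis
  obtain w where w: "w \<in> W" "blinfun_apply f w = support_fun f W"
    using support_fun_attained[OF cwk_compact[OF W(1)] cwk_nonempty[OF W(1)]] by metis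
  have "\<exists>x\<in>\<Gamma> t. blinfun_apply f x = support_fun f (\<Gamma> t)" if "t \<in> {0..1}" for t
    using support_fun_attained[OF cwk_compact cwk_nonempty, of "\<Gamma> t" f] \<Gamma> that by metis
  then obtain g where g: "\<And>t. t \<in> {0..1} \<Longrightarrow> g t \<in> \<Gamma> t"
    "\<And>t. t \<in> {0..1} \<Longrightarrow> blinfun_apply f (g t) = support_fun f (\<Gamma> t)" by metis
  have "is_H_integral (\<lambda>t. {g t}) {w}"
    unfolding is_H_integral_def
  proof (intro allI impI)
    fix \<epsilon> :: real assume \<epsilon>: "0 < \<epsilon>"
    obtain b where b: "0 < b" "\<And>x y. x \<in> W \<Longrightarrow> y \<in> W \<Longrightarrow> support_fun f W - b < blinfun_apply f x \<Longrightarrow>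
      support_fun f W - b < blinfun_apply f y \<Longrightarrow> norm (x - y) \<le> \<epsilon> / 2"
      using f[of "\<epsilon> / 2"] \<epsilon> by auto
    define c where "c = norm f + 1"
    have c: "0 < c" "norm f \<le> c" by (simp_all add: c_def add_nonneg_pos)
    \<comment> \<open>The Riemann sum \<open>y\<close> loses at most \<open>c * d\<close> against
      the maximum of \<open>f\<close>, and the nearby \<open>z\<close> in \<open>W\<close> another
      \<open>c * d\<close>; \<open>2 * (c * d) \<le> b\<close> puts \<open>z\<close> in the slice.
      The bound \<open>\<epsilon> / 4\<close> is for the distance from \<open>y\<close> to
      \<open>z\<close>.\<close>
    define d where "d = min (\<epsilon> / 4) (b / (2 * c))"
    have d: "0 < d" "d \<le> \<epsilon> / 4" "2 * (c * d) \<le> b"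
      using \<epsilon> b(1) c(1) by (auto simp: d_def min_le_iff_disj field_simps min_def)
    obtain \<delta> :: "real \<Rightarrow> real" where \<delta>: "\<forall>t\<in>{0..1}. 0 < \<delta> t" "\<delta> \<in> borel_measurable (lebesgue_on {0..1})"
      "\<forall>p. p tagged_division_of {0..1} \<and> (\<lambda>t. ball t (\<delta> t)) fine p \<longrightarrow> hausdorff_dist W (riemann_sum \<Gamma> p) < d"
      using W(2)[unfolded is_H_integral_def, rule_format, OF d(1)] by (elim exE conjE) blast
    have "hausdorff_dist {w} (riemann_sum (\<lambda>t. {g t}) p) < \<epsilon>"
      if p: "p tagged_division_of {0..1}" "(\<lambda>t. ball t (\<delta> t)) fine p" for p
    proof -
      have fin: "finite p" using p(1) by (rule tagged_division_of_finite)
      have tag: "t \<in> {0..1}" if "(t, I) \<in> p" for t I using tagged_division_ofD(2,3)[OF p(1) that] by blast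
      define y where "y = (\<Sum>(t, I)\<in>p. measure lborel I *\<^sub>R g t)"
      define R where "R = riemann_sum \<Gamma> p"
      have R: "R \<in> cwk" unfolding R_def by (rule riemann_sum_cwk[OF \<Gamma> fin tag])
      have yR: "y \<in> R"
        unfolding y_def R_def riemann_sum_def using g(1) tag by (intro sum_in_set_sum fin) auto
      have "blinfun_apply f y = (\<Sum>(t, I)\<in>p. measure lborel I * blinfun_apply f (g t))"
        by (simp add: y_def blinfun.sum_right blinfun.scaleR_right case_prod_unfold)
      also have "\<dots> = (\<Sum>(t, I)\<in>p. measure lborel I * support_fun f (\<Gamma> t))"
        using g(2) tag by (intro sum.cong) auto
      also have "\<dots> = support_fun f R"
        unfolding R_def by (rule support_fun_riemann_sum[OF \<Gamma> fin, symmetric]) (rule tag)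
      finally have fy: "blinfun_apply f y = support_fun f R" .
      have h: "hausdorff_dist W R < d" using \<delta>(3) p unfolding R_def by blast
      have "infdist y W \<le> hausdorff_dist W R"
        unfolding hausdorff_dist_def using yR bdd_above_infdist[OF cwk_bounded[OF R] cwk_nonempty[OF W(1)]]
        by (intro max.coboundedI2 cSUP_upper)
      then have "infdist y W < d" using h by simp
      then obtain z where z: "z \<in> W" "dist y z < d"
        using cwk_nonempty[OF W(1)] cINF_less_iff[of W "dist y" d] by (auto simp: infdist_notempty)
      have fd: "norm f * r \<le> c * d" if "r \<le> d" for r
        using mult_left_mono[OF that norm_ge_zero[of f]] mult_right_mono[OF c(2), of d] d(1) by linarith
      have "support_fun f W - c * d \<le> blinfun_apply f y"
        using support_fun_hausdorff_dist[OF cwk_bounded[OF W(1)] cwk_nonempty[OF W(1)] cwk_bounded[OF R]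
            cwk_nonempty[OF R], of f] fd[of "hausdorff_dist W R"] h unfolding fy by linarith
      moreover have "\<bar>blinfun_apply f (y - z)\<bar> < c * d"
      proof -
        have "\<bar>blinfun_apply f (y - z)\<bar> \<le> norm f * norm (y - z)" by (rule blinfun_abs_le)
        also have "\<dots> \<le> c * norm (y - z)" by (rule mult_right_mono[OF c(2)]) simp
        also have "\<dots> < c * d" using z(2) c(1) by (simp add: dist_norm)
        finally show ?thesis .
      qed
      ultimately have "support_fun f W - b < blinfun_apply f z" using d(3) by (simp add: blinfun.diff_right)
      then have "norm (z - w) \<le> \<epsilon> / 2" using b z(1) w by (intro b(2)) auto
      then have "dist w y < \<epsilon>"
        using z(2) d(2) \<epsilon> dist_triangle[of w y z] by (simp add: dist_norm norm_minus_commute)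
      then show ?thesis by (simp add: riemann_sum_singletons[OF fin] y_def)
    qed
    then show "\<exists>\<delta> :: real \<Rightarrow> real. (\<forall>t\<in>{0..1}. 0 < \<delta> t) \<and> \<delta> \<in> borel_measurable (lebesgue_on {0..1}) \<and>
      (\<forall>p. p tagged_division_of {0..1} \<and> (\<lambda>t. ball t (\<delta> t)) fine p \<longrightarrow>
        hausdorff_dist {w} (riemann_sum (\<lambda>t. {g t}) p) < \<epsilon>)" using \<delta>(1,2) by blast
  qed
  then have "g \<in> selections \<Gamma> \<and> H_integrable_fun g"
    using g(1) by (auto simp: selections_def H_integrable_fun_def)
  then show ?thesis by blast
qed

section \<open>Series of convex weakly compact sets\<close>

context
  fixes C :: "nat \<Rightarrow> 'a::banach set"
  assumes C: "\<And>n. C n \<in> cwk"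
    and tails: "\<And>e. 0 < e \<Longrightarrow> \<exists>N. \<forall>f G. norm f \<le> 1 \<longrightarrow> finite G \<longrightarrow> G \<subseteq> {N..} \<longrightarrow>
      \<bar>\<Sum>n\<in>G. support_fun f (C n)\<bar> \<le> e"
begin

text \<open>The pointwise sum of the support functions is sublinear and approximated by the partial
  sums uniformly on the unit ball, so \<open>cwk_representation\<close> provides the set
  \<open>S\<close>.\<close>

lemma uniformly_summable_set_sums:
  obtains S where "set_sums C S" "\<And>f. (\<lambda>n. support_fun f (C n)) sums support_fun f S"
proof -
  have unit: "summable (\<lambda>n. support_fun f (C n))" if f: "norm f \<le> 1" for f
    unfolding summable_Cauchy
  proof (intro allI impI)
    fix e :: real assume "0 < e"
    then obtain N where N: "\<And>f G. norm f \<le> 1 \<Longrightarrow> finite G \<Longrightarrow> G \<subseteq> {N..} \<Longrightarrow>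
      \<bar>\<Sum>n\<in>G. support_fun f (C n)\<bar> \<le> e / 2" using tails[of "e / 2"] by (metis half_gt_zero)
    have "norm (\<Sum>n=m..<k. support_fun f (C n)) < e" if "m \<ge> N" for m k
      using N[OF f, of "{m..<k}"] that \<open>0 < e\<close> by fastforce
    then show "\<exists>N. \<forall>m\<ge>N. \<forall>k. norm (\<Sum>n=m..<k. support_fun f (C n)) < e" by blast
  qed
  have hom: "support_fun f (C n) = c * support_fun ((1 / c) *\<^sub>R f) (C n)" if "0 < c" for f c n
    using support_fun_scale_functional[OF C[of n], of "1 / c" f] that by simp
  have sm: "summable (\<lambda>n. support_fun f (C n))" for f
  proof -
    define c where "c = norm f + 1"
    have c: "0 < c" by (simp add: c_def add_nonneg_pos)
    have "norm ((1 / c) *\<^sub>R f) \<le> 1" using c by (simp add: c_def divide_simps)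
    then have "summable (\<lambda>n. c * support_fun ((1 / c) *\<^sub>R f) (C n))" by (intro summable_mult unit)
    then show ?thesis using hom[OF c, of f] by simp
  qed
  define p where "p f = (\<Sum>n. support_fun f (C n))" for f
  have p: "sublinear p"
  proof (rule sublinearI)
    show "p (f + g) \<le> p f + p g" for f g
      unfolding p_def suminf_add[OF sm sm]
      by (intro suminf_le sm summable_add sublinear_add[OF sublinear_support_fun] cwk_bounded cwk_nonempty C)
    show "p (c *\<^sub>R f) \<le> c * p f" if "0 < c" for c f
      unfolding p_def using that suminf_mult[OF sm, of c f] by (simp add: support_fun_scale_functional[OF C])
    show "p 0 = 0" using sublinear_zero[OF sublinear_support_fun[OF cwk_bounded[OF C] cwk_nonempty[OF C]]]
      by (simp add: p_def)
  qed
  have part: "(\<Sum>k<n. C k) \<in> cwk" for n by (intro cwk_sum C) simp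
  have partf: "support_fun f (\<Sum>k<n. C k) = (\<Sum>k<n. support_fun f (C k))" for f n
    by (intro support_fun_sum C) simp
  have near: "\<exists>N. \<forall>n\<ge>N. \<forall>f. \<bar>p f - support_fun f (\<Sum>k<n. C k)\<bar> \<le> e * norm f" if e: "0 < e" for e
  proof -
    obtain N where N: "\<And>f G. norm f \<le> 1 \<Longrightarrow> finite G \<Longrightarrow> G \<subseteq> {N..} \<Longrightarrow>
      \<bar>\<Sum>n\<in>G. support_fun f (C n)\<bar> \<le> e" using tails[OF e] by metis
    have u: "\<bar>p f - support_fun f (\<Sum>k<n. C k)\<bar> \<le> e" if n: "n \<ge> N" and f: "norm f \<le> 1" for n f
    proof (rule tendsto_upperbound)
      show "(\<lambda>m. \<bar>(\<Sum>k<m. support_fun f (C k)) - support_fun f (\<Sum>k<n. C k)\<bar>) \<longlonglongrightarrow>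
          \<bar>p f - support_fun f (\<Sum>k<n. C k)\<bar>"
        unfolding p_def by (intro tendsto_intros summable_LIMSEQ sm)
      have "\<bar>(\<Sum>k<m. support_fun f (C k)) - support_fun f (\<Sum>k<n. C k)\<bar> \<le> e" if "m \<ge> n" for m
      proof -
        have "(\<Sum>k<m. support_fun f (C k)) - support_fun f (\<Sum>k<n. C k) = (\<Sum>k=n..<m. support_fun f (C k))"
          unfolding partf using sum_diff_nat_ivl[of 0 n m "\<lambda>k. support_fun f (C k)"] that
          by (simp add: atLeast0LessThan)
        then show ?thesis using N[OF f, of "{n..<m}"] n by fastforce
      qed
      then show "\<forall>\<^sub>F m in sequentially. \<bar>(\<Sum>k<m. support_fun f (C k)) - support_fun f (\<Sum>k<n. C k)\<bar> \<le> e"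
        by (rule eventually_sequentiallyI)
    qed simp
    have "\<bar>p f - support_fun f (\<Sum>k<n. C k)\<bar> \<le> e * norm f" if n: "n \<ge> N" for n f
    proof (cases "f = 0")
      case True
      then show ?thesis
        using sublinear_zero[OF p] sublinear_zero[OF sublinear_support_fun[OF cwk_bounded[OF part] cwk_nonempty[OF part]]]
        by simp
    next
      case False
      define g where "g = (1 / norm f) *\<^sub>R f"
      have g: "f = norm f *\<^sub>R g" "norm g \<le> 1" using False by (simp_all add: g_def)
      have "p f = norm f * p g" using sublinear_scale[OF p, of "norm f" g] g(1) by simp
      moreover have "support_fun f (\<Sum>k<n. C k) = norm f * support_fun g (\<Sum>k<n. C k)"
        using support_fun_scale_functional[OF part[of n], of "norm f" g] g(1) by simp
      ultimately have "\<bar>p f - support_fun f (\<Sum>k<n. C k)\<bar> = norm f * \<bar>p g - support_fun g (\<Sum>k<n. C k)\<bar>"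
        by (simp add: right_diff_distrib[symmetric] abs_mult)
      also have "\<dots> \<le> norm f * e" using u[OF n g(2)] by (rule mult_left_mono) simp
      finally show ?thesis by (simp add: mult.commute)
    qed
    then show ?thesis by blast
  qed
  obtain S where S: "S \<in> cwk" "\<And>f. support_fun f S = p f"
  proof (rule cwk_representation[OF p])
    fix e :: real assume "0 < e"
    then obtain N where "\<And>f. \<bar>p f - support_fun f (\<Sum>k<N. C k)\<bar> \<le> e * norm f" using near by blast
    then have "p f \<le> support_fun f (\<Sum>k<N. C k) + e * norm f" for f by (smt (verit))
    then show "\<exists>C\<in>cwk. \<forall>f. p f \<le> support_fun f C + e * norm f" using part by blast
  qed blast
  have "(\<lambda>n. hausdorff_dist (\<Sum>k<n. C k) S) \<longlonglongrightarrow> 0"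
  proof (rule LIMSEQ_I)
    fix r :: real assume r: "0 < r"
    then obtain N where N: "\<And>n f. n \<ge> N \<Longrightarrow> \<bar>p f - support_fun f (\<Sum>k<n. C k)\<bar> \<le> r / 2 * norm f"
      using near[of "r / 2"] by auto
    have "norm (hausdorff_dist (\<Sum>k<n. C k) S - 0) < r" if n: "n \<ge> N" for n
    proof -
      have le: "hausdorff_dist (\<Sum>k<n. C k) S \<le> r / 2"
      proof (rule hausdorff_dist_le)
        fix f :: "'a \<Rightarrow>\<^sub>L real" assume "norm f \<le> 1"
        then have "r / 2 * norm f \<le> r / 2" using r by (simp add: mult_le_cancel_left1)
        then show "\<bar>support_fun f (\<Sum>k<n. C k) - support_fun f S\<bar> \<le> r / 2"
          unfolding S(2) using N[OF n, of f] by linarith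
      qed (use part S(1) in \<open>simp_all add: cwk_bounded cwk_convex cwk_nonempty\<close>)
      obtain x where x: "x \<in> S" using cwk_nonempty[OF S(1)] by blast
      have "0 \<le> infdist x (\<Sum>k<n. C k)" by (rule infdist_nonneg)
      also have "\<dots> \<le> hausdorff_dist (\<Sum>k<n. C k) S"
        unfolding hausdorff_dist_def
        using x bdd_above_infdist[OF cwk_bounded[OF S(1)] cwk_nonempty[OF part]]
        by (intro max.coboundedI2 cSUP_upper)
      finally show ?thesis using le r by simp
    qed
    then show "\<exists>N. \<forall>n\<ge>N. norm (hausdorff_dist (\<Sum>k<n. C k) S - 0) < r" by blast
  qed
  then have "set_sums C S" using S(1) by (simp add: set_sums_def)
  moreover have "(\<lambda>n. support_fun f (C n)) sums support_fun f S" for f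
    unfolding S(2) p_def by (rule summable_sums[OF sm])
  ultimately show thesis using that by blast
qed

end

text \<open>The tail condition concerns arbitrary finite sets of indices, so it survives a
  permutation: only finitely many indices are sent below \<open>N\<close>.\<close>

lemma uniformly_summable_unconditional:
  fixes C :: "nat \<Rightarrow> 'a::banach set"
  assumes C: "\<And>n. C n \<in> cwk"
    and tails: "\<And>e. 0 < e \<Longrightarrow> \<exists>N. \<forall>f G. norm f \<le> 1 \<longrightarrow> finite G \<longrightarrow> G \<subseteq> {N..} \<longrightarrow>
      \<bar>\<Sum>n\<in>G. support_fun f (C n)\<bar> \<le> e"
  shows "unconditionally_convergent C"
  unfolding unconditionally_convergent_def
proof (intro allI impI)
  fix \<pi> :: "nat \<Rightarrow> nat" assume "bij \<pi>"
  then have inj: "inj \<pi>" by (rule bij_is_inj)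
  have "\<exists>N. \<forall>f G. norm f \<le> 1 \<longrightarrow> finite G \<longrightarrow> G \<subseteq> {N..} \<longrightarrow>
      \<bar>\<Sum>n\<in>G. support_fun f ((C \<circ> \<pi>) n)\<bar> \<le> e" if e: "0 < e" for e
  proof -
    obtain N where N: "\<And>f G. norm f \<le> 1 \<Longrightarrow> finite G \<Longrightarrow> G \<subseteq> {N..} \<Longrightarrow>
      \<bar>\<Sum>n\<in>G. support_fun f (C n)\<bar> \<le> e" using tails[OF e] by metis
    have "finite (\<pi> -` {..<N})" by (intro finite_vimageI inj) simp
    then obtain N' where N': "\<pi> -` {..<N} \<subseteq> {..<N'}" using finite_nat_iff_bounded by blast
    have "\<bar>\<Sum>n\<in>G. support_fun f ((C \<circ> \<pi>) n)\<bar> \<le> e" if "norm f \<le> 1" "finite G" "G \<subseteq> {N'..}" for f G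
    proof -
      have "\<pi> ` G \<subseteq> {N..}" using N' that(3) by (force simp: not_less[symmetric])
      then have "\<bar>\<Sum>n\<in>\<pi> ` G. support_fun f (C n)\<bar> \<le> e" using that by (intro N) auto
      then show ?thesis by (subst (asm) sum.reindex) (auto intro: inj_on_subset[OF inj])
    qed
    then show ?thesis by blast
  qed
  then obtain S where "set_sums (C \<circ> \<pi>) S"
    using uniformly_summable_set_sums[of "C \<circ> \<pi>"] C by (metis comp_apply)
  then show "\<exists>S. set_sums (C \<circ> \<pi>) S" ..
qed

section \<open>Oscillation of Henstock integrable multifunctions\<close>

text \<open>Two fine Perron partitions are built that differ only in the tags of the cells in
  \<open>F\<close>. Each sum is within \<open>e\<close> of the integral, and their difference is the
  sum in question, so no estimate on the remaining intervals is involved.\<close>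

lemma perron_gauge_swap:
  fixes \<Gamma> :: "real \<Rightarrow> 'a::real_normed_vector set"
  assumes \<delta>: "perron_gauge \<Gamma> W e \<delta>" and N: "0 < N" and F: "F \<subseteq> {..<N}" and f: "norm f \<le> 1"
    and u: "\<And>q. q \<in> F \<Longrightarrow> u q \<in> cell N q \<and> 1 / real N < \<delta> (u q)"
    and v: "\<And>q. q \<in> F \<Longrightarrow> v q \<in> cell N q \<and> 1 / real N < \<delta> (v q)"
  shows "(\<Sum>q\<in>F. 1 / real N * (support_fun f (\<Gamma> (u q)) - support_fun f (\<Gamma> (v q)))) \<le> 2 * e"
proof -
  define h where "h t = support_fun f (\<Gamma> t)" for t
  have N': "0 < real N" using N by simp
  have width: "real (Suc q) / real N - real q / real N = 1 / real N" for q
    using N' by (simp add: diff_divide_distrib[symmetric])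
  have cell01: "cell N q \<subseteq> {0..1}" if "q < N" for q
    using division_ofD(2)[OF cell_division(1)[OF N]] that by blast
  have sub: "cell N q \<subseteq> ball t (\<delta> t)" if "t \<in> cell N q" "1 / real N < \<delta> t" for q t
  proof
    fix y assume "y \<in> cell N q"
    then have "\<bar>y - t\<bar> \<le> 1 / real N" using that(1) width[of q] by (auto simp: cell_def abs_le_iff)
    then show "y \<in> ball t (\<delta> t)" using that(2) by (simp add: dist_real_def abs_minus_commute)
  qed
  \<comment> \<open>Outside \<open>F\<close> the left endpoint is an arbitrary tag; such cells need
    not be fine and may be subdivided.\<close>
  define u' where "u' q = (if q \<in> F then u q else real q / real N)" for q
  have u'cell: "u' q \<in> cell N q" for q
    using u N' by (auto simp: u'_def cell_def divide_right_mono)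
  define p where "p = (\<lambda>q. (u' q, cell N q)) ` {..<N}"
  have "p tagged_division_of {0..1}"
  proof (rule tagged_division_ofI)
    show "finite p" by (simp add: p_def)
    have "{K. \<exists>x. (x, K) \<in> p} = cell N ` {..<N}" by (auto simp: p_def)
    then show "\<Union> {K. \<exists>x. (x, K) \<in> p} = {0..1}" using division_ofD(6)[OF cell_division(1)[OF N]] by simp
  next
    fix x K assume "(x, K) \<in> p"
    then obtain q where q: "q < N" "x = u' q" "K = cell N q" by (auto simp: p_def)
    then show "x \<in> K" "K \<subseteq> {0..1}" using u'cell cell01 by auto
    show "\<exists>a b. K = cbox a b" unfolding q(3) cell_def by (metis box_real(2))
  next
    fix x K y L assume "(x, K) \<in> p" "(y, L) \<in> p" "(x, K) \<noteq> (y, L)"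
    then obtain q r where "q < N" "r < N" "K = cell N q" "L = cell N r" "q \<noteq> r" by (auto simp: p_def)
    moreover from this have "K \<noteq> L" using cell_division(2)[OF N] by (auto simp: inj_on_def)
    ultimately show "interior K \<inter> interior L = {}"
      using division_ofD(5)[OF cell_division(1)[OF N], of K L] by blast
  qed
  then have p: "p tagged_division_of cbox 0 1" by simp
  define \<gamma> where "\<gamma> t = (if t \<in> {0..1} then ball t (\<delta> t) else ball t 1)" for t
  have \<gamma>: "gauge \<gamma>" "\<And>t. t \<in> {0..1} \<Longrightarrow> \<gamma> t = ball t (\<delta> t)"
    using gauge_on_unit_interval[OF adapted_gaugeD(1)[OF \<delta>]] by (auto simp: \<gamma>_def[abs_def])
  \<comment> \<open>The refinement keeps every tagged cell that is already fine, in particular those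
    with index in \<open>F\<close>.\<close>
  obtain Q where Q: "Q tagged_division_of cbox 0 1" "\<gamma> fine Q" "\<forall>(x, K)\<in>p. K \<subseteq> \<gamma> x \<longrightarrow> (x, K) \<in> Q"
    by (rule tagged_division_finer[OF p \<gamma>(1)])
  have Q1: "Q tagged_division_of {0..1}" using Q(1) by simp
  have fin: "finite Q" using Q1 by (rule tagged_division_of_finite)
  have fineQ: "(\<lambda>t. ball t (\<delta> t)) fine Q" by (rule fine_unit_interval_cong[OF \<gamma>(2) Q1 Q(2)])
  define E where "E = (\<lambda>q. (u q, cell N q)) ` F"
  have EQ: "E \<subseteq> Q"
  proof
    fix w assume "w \<in> E"
    then obtain q where q: "q \<in> F" "w = (u q, cell N q)" by (auto simp: E_def)
    then have "w \<in> p" using F by (force simp: p_def u'_def)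
    moreover have "u q \<in> {0..1}" using u[OF q(1)] cell01[of q] F q(1) by blast
    then have "cell N q \<subseteq> \<gamma> (u q)" using \<gamma>(2) sub u[OF q(1)] by simp
    ultimately show "w \<in> Q" using Q(3) q(2) by blast
  qed
  define r where "r w = (if w \<in> E then v (inv_into F (cell N) (snd w)) else fst w)" for w
  have injF: "inj_on (cell N) F" using cell_division(2)[OF N] F by (rule inj_on_subset)
  have rE: "r (u q, cell N q) = v q" if "q \<in> F" for q
    using that injF by (auto simp: r_def E_def)
  have cases: "(\<exists>q\<in>F. w = (u q, cell N q) \<and> r w = v q) \<or> w \<notin> E \<and> r w = fst w" for w
  proof (cases "w \<in> E")
    case True
    then obtain q where "q \<in> F" "w = (u q, cell N q)" by (auto simp: E_def)
    then show ?thesis using rE by blast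
  qed (simp add: r_def)
  have rK: "r (x, K) \<in> K \<and> K \<subseteq> ball (r (x, K)) (\<delta> (r (x, K)))" if "(x, K) \<in> Q" for x K
    using cases[of "(x, K)"]
  proof (elim disjE bexE conjE)
    fix q assume "q \<in> F" "(x, K) = (u q, cell N q)" "r (x, K) = v q"
    then show ?thesis using v[of q] sub[of "v q" q] by simp
  next
    assume "r (x, K) = fst (x, K)"
    then show ?thesis using tagged_division_ofD(2)[OF Q1 that] fineD[OF fineQ that] by simp
  qed
  have r01: "r (x, K) \<in> {0..1}" if "(x, K) \<in> Q" for x K
    using rK[OF that] tagged_division_ofD(3)[OF Q1 that] by blast
  define Q' where "Q' = (\<lambda>w. (r w, snd w)) ` Q"
  have Q': "Q' tagged_division_of {0..1}" "(\<lambda>t. ball t (\<delta> t)) fine Q'"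
    "(\<Sum>(t, K)\<in>Q'. measure lborel K * h t) = (\<Sum>w\<in>Q. measure lborel (snd w) * h (r w))"
    unfolding Q'_def
    by (rule retag_partition[OF Q1, where u = r and \<gamma> = "\<lambda>t. ball t (\<delta> t)"]; use rK r01 in blast)+
  have "(\<Sum>w\<in>Q. measure lborel (snd w) * h (fst w)) - (\<Sum>w\<in>Q. measure lborel (snd w) * h (r w))
      = (\<Sum>w\<in>Q. measure lborel (snd w) * (h (fst w) - h (r w)))"
    by (simp add: sum_subtractf right_diff_distrib)
  also have "\<dots> = (\<Sum>w\<in>E. measure lborel (snd w) * (h (fst w) - h (r w)))"
    by (rule sum.mono_neutral_right[OF fin EQ]) (auto simp: r_def)
  also have "\<dots> = (\<Sum>q\<in>F. measure lborel (cell N q) * (h (u q) - h (v q)))"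
    unfolding E_def using injF rE by (subst sum.reindex) (auto simp: inj_on_def)
  also have "\<dots> = (\<Sum>q\<in>F. 1 / real N * (h (u q) - h (v q)))"
  proof (rule sum.cong[OF refl])
    fix q
    have "measure lborel (cell N q) = 1 / real N"
      unfolding cell_def using width[of q] N' by (simp add: divide_right_mono)
    then show "measure lborel (cell N q) * (h (u q) - h (v q)) = 1 / real N * (h (u q) - h (v q))" by simp
  qed
  finally have eq: "(\<Sum>q\<in>F. 1 / real N * (h (u q) - h (v q))) =
      (\<Sum>w\<in>Q. measure lborel (snd w) * h (fst w)) - (\<Sum>(t, K)\<in>Q'. measure lborel K * h t)"
    using Q'(3) by simp
  have "\<bar>support_fun f W - (\<Sum>w\<in>Q. measure lborel (snd w) * h (fst w))\<bar> \<le> e"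
    using adapted_gaugeD(2)[OF \<delta> Q1 fineQ f] by (simp add: h_def case_prod_unfold)
  moreover have "\<bar>support_fun f W - (\<Sum>(t, K)\<in>Q'. measure lborel K * h t)\<bar> \<le> e"
    using adapted_gaugeD(2)[OF \<delta> Q'(1,2) f] by (simp add: h_def)
  ultimately have "(\<Sum>q\<in>F. 1 / real N * (h (u q) - h (v q))) \<le> 2 * e" unfolding eq by linarith
  then show ?thesis by (simp add: h_def)
qed

text \<open>The points are chosen independently for each index, so the supremum of the sums is the
  sum of the suprema. Boundedness belongs to the claim, since real suprema of unbounded sets carry
  no information.\<close>

lemma sum_SUP_le:
  fixes g :: "'i \<Rightarrow> 'b \<Rightarrow> real"
  assumes F: "finite F" and X: "\<And>q. q \<in> F \<Longrightarrow> X q \<noteq> {}" and nonneg: "\<And>q x. 0 \<le> g q x"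
    and le: "\<And>w. (\<And>q. q \<in> F \<Longrightarrow> w q \<in> X q) \<Longrightarrow> (\<Sum>q\<in>F. g q (w q)) \<le> c"
  shows "\<And>q. q \<in> F \<Longrightarrow> bdd_above (g q ` X q)" "(\<Sum>q\<in>F. SUP x\<in>X q. g q x) \<le> c"
proof -
  have "\<forall>q. \<exists>x. q \<in> F \<longrightarrow> x \<in> X q" using X by blast
  then obtain w0 where w0: "\<And>q. q \<in> F \<Longrightarrow> w0 q \<in> X q" by metis
  show bdd: "bdd_above (g q ` X q)" if q: "q \<in> F" for q
  proof (rule bdd_aboveI2)
    fix x assume x: "x \<in> X q"
    have "g q x \<le> (\<Sum>k\<in>F. g k ((w0(q := x)) k))"
      using member_le_sum[OF q, of "\<lambda>k. g k ((w0(q := x)) k)"] nonneg F by simp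
    also have "\<dots> \<le> c" by (rule le) (use x w0 in auto)
    finally show "g q x \<le> c" .
  qed
  show "(\<Sum>q\<in>F. SUP x\<in>X q. g q x) \<le> c"
  proof (rule field_le_epsilon)
    fix e :: real assume e: "0 < e"
    define d where "d = e / (real (card F) + 1)"
    have d: "0 < d" "real (card F) * d \<le> e" using e by (simp_all add: d_def field_simps)
    have "\<exists>x\<in>X q. (SUP x\<in>X q. g q x) - d < g q x" if "q \<in> F" for q
      using less_cSUP_iff[OF X[OF that] bdd[OF that], of "(SUP x\<in>X q. g q x) - d"] d(1) by simp
    then obtain w where w: "\<And>q. q \<in> F \<Longrightarrow> w q \<in> X q" "\<And>q. q \<in> F \<Longrightarrow> (SUP x\<in>X q. g q x) - d < g q (w q)"
      by metis
    have "(\<Sum>q\<in>F. SUP x\<in>X q. g q x) \<le> (\<Sum>q\<in>F. g q (w q) + d)"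
      using w(2) by (intro sum_mono) (simp add: less_imp_le algebra_simps)
    also have "\<dots> = (\<Sum>q\<in>F. g q (w q)) + real (card F) * d" by (simp add: sum.distrib)
    also have "\<dots> \<le> c + e" using le[OF w(1)] d(2) by (intro add_mono) auto
    finally show "(\<Sum>q\<in>F. SUP x\<in>X q. g q x) \<le> c + e" .
  qed
qed

text \<open>Measurability of the gauge enters here: the sets where it is at most
  \<open>1 / (n + 1)\<close> are measurable and decrease to the empty set, so one of them has
  measure below \<open>c\<close>. Off it, any two points of a common cell may be exchanged as
  tags.\<close>

lemma H_integral_stage:
  fixes \<Gamma> :: "real \<Rightarrow> 'a::real_normed_vector set"
  assumes \<Gamma>: "\<forall>t\<in>{0..1}. \<Gamma> t \<in> cwk" and W: "W \<in> cwk" "is_H_integral \<Gamma> W" and b: "0 < b" and c: "0 < c"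
  shows "\<exists>N D. 0 < N \<and> D \<in> sets lebesgue \<and> D \<subseteq> {0..1} \<and> measure lebesgue ({0..1} - D) \<le> c \<and>
    (\<forall>f F u v. norm f \<le> 1 \<longrightarrow> F \<subseteq> {..<N} \<longrightarrow> (\<forall>q\<in>F. u q \<in> D \<inter> cell N q \<and> v q \<in> D \<inter> cell N q) \<longrightarrow>
      (\<Sum>q\<in>F. 1 / real N * \<bar>support_fun f (\<Gamma> (u q)) - support_fun f (\<Gamma> (v q))\<bar>) \<le> b)"
proof -
  obtain \<delta> where \<delta>: "perron_gauge \<Gamma> W (b / 2) \<delta>" "\<delta> \<in> borel_measurable (lebesgue_on {0..1})"
    using H_integral_gauge[OF \<Gamma> W, of "b / 2"] b by auto
  define E where "E n = {t \<in> space (lebesgue_on {0..1}). \<delta> t \<le> 1 / real (Suc n)}" for n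
  have E: "E n \<in> sets (lebesgue_on {0..1})" for n
    unfolding E_def using \<delta>(2) by measurable
  have EL: "E n \<in> sets lebesgue" "E n \<subseteq> {0..1}" for n using E[of n] by (auto simp: sets_unit_iff)
  have "decseq E"
  proof (rule decseq_SucI)
    fix n
    have "1 / real (Suc (Suc n)) \<le> 1 / real (Suc n)" by (simp add: frac_le)
    then show "E (Suc n) \<subseteq> E n" unfolding E_def by auto
  qed
  have "(\<Inter>n. E n) = {}"
  proof (rule ccontr)
    assume "(\<Inter>n. E n) \<noteq> {}"
    then obtain t where t: "\<And>n. t \<in> E n" by blast
    then have "0 < \<delta> t" using adapted_gaugeD(1)[OF \<delta>(1), of t] EL(2) by blast
    then obtain n where "1 / real (Suc n) < \<delta> t" using reals_Archimedean[of "\<delta> t"] by (auto simp: inverse_eq_divide)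
    then show False using t[of n] by (simp add: E_def)
  qed
  have "(\<lambda>n. measure (lebesgue_on {0..1}) (E n)) \<longlonglongrightarrow> measure (lebesgue_on {0..1}) (\<Inter>n. E n)"
    by (intro finite_measure.finite_Lim_measure_decseq finite_measure_lebesgue_on \<open>decseq E\<close>) (use E in auto)
  then have "(\<lambda>n. measure lebesgue (E n)) \<longlonglongrightarrow> 0"
    using \<open>(\<Inter>n. E n) = {}\<close> EL(2) by (simp add: measure_restrict_space)
  then have "\<forall>\<^sub>F n in sequentially. measure lebesgue (E n) < c" using c by (intro order_tendstoD) auto
  then obtain n where n: "measure lebesgue (E n) < c" by (auto simp: eventually_sequentially)
  define D where "D = {0..1} - E n"
  have "D \<in> sets lebesgue" "D \<subseteq> {0..1}" using EL by (auto simp: D_def)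
  moreover have "{0..1} - D = E n" using EL(2)[of n] by (auto simp: D_def)
  then have "measure lebesgue ({0..1} - D) \<le> c" using n by simp
  moreover have "(\<Sum>q\<in>F. 1 / real (Suc n) * \<bar>support_fun f (\<Gamma> (u q)) - support_fun f (\<Gamma> (v q))\<bar>) \<le> b"
    if f: "norm f \<le> 1" and F: "F \<subseteq> {..<Suc n}"
      and uv: "\<forall>q\<in>F. u q \<in> D \<inter> cell (Suc n) q \<and> v q \<in> D \<inter> cell (Suc n) q" for f F u v
  proof -
    \<comment> \<open>Ordering each pair by its values turns differences into absolute values;
      swapping costs twice the gauge error \<open>b / 2\<close>.\<close>
    define P where "P q \<longleftrightarrow> support_fun f (\<Gamma> (v q)) \<le> support_fun f (\<Gamma> (u q))" for q
    define u' where "u' q = (if P q then u q else v q)" for q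
    define v' where "v' q = (if P q then v q else u q)" for q
    have D: "1 / real (Suc n) < \<delta> t" if "t \<in> D" for t using that by (auto simp: D_def E_def)
    have "(\<Sum>q\<in>F. 1 / real (Suc n) * (support_fun f (\<Gamma> (u' q)) - support_fun f (\<Gamma> (v' q)))) \<le> 2 * (b / 2)"
      using uv D by (intro perron_gauge_swap[OF \<delta>(1) _ F f]) (auto simp: u'_def v'_def simp del: of_nat_Suc)
    moreover have "support_fun f (\<Gamma> (u' q)) - support_fun f (\<Gamma> (v' q)) =
        \<bar>support_fun f (\<Gamma> (u q)) - support_fun f (\<Gamma> (v q))\<bar>" for q
      by (auto simp: u'_def v'_def P_def)
    ultimately show ?thesis by simp
  qed
  ultimately show ?thesis by (intro exI[of _ "Suc n"] exI[of _ D]) auto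
qed

lemma sum_geometric_tail_le:
  fixes I :: "nat set"
  assumes "finite I" "I \<subseteq> {k..}" "0 \<le> e"
  shows "(\<Sum>i\<in>I. e * (1 / 2) ^ Suc i) \<le> e * (1 / 2 :: real) ^ k"
proof -
  obtain m where m: "I \<subseteq> {..<m}" using assms(1) finite_nat_iff_bounded by blast
  have "(\<Sum>i\<in>I. e * (1 / 2) ^ Suc i) \<le> (\<Sum>i\<in>{k..<k + m}. e * (1 / 2) ^ Suc i)"
    using m assms(2,3) by (intro sum_mono2) fastforce+
  also have "\<dots> = e * (1 / 2) ^ k - e * (1 / 2) ^ (k + m)"
  proof -
    define x :: real where "x = 1 / 2"
    have "(\<Sum>i\<in>{k..<k + m}. e * x ^ Suc i) = e * x ^ k - e * x ^ (k + m)"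
      by (induction m) (simp_all, simp add: x_def)
    then show ?thesis by (simp only: x_def)
  qed
  also have "\<dots> \<le> e * (1 / 2) ^ k" using assms(3) by simp
  finally show ?thesis .
qed

text \<open>
  Stage \<open>i\<close> uses a gauge for the error \<open>e / 2 ^ i\<close> and cuts the part not covered by earlier stages of
  a set where that gauge exceeds \<open>1 / N i\<close> into cells of length \<open>1 / N i\<close>.
\<close>

lemma H_integral_oscillation:
  fixes \<Gamma> :: "real \<Rightarrow> 'a::real_normed_vector set"
  assumes \<Gamma>: "\<forall>t\<in>{0..1}. \<Gamma> t \<in> cwk" and W: "W \<in> cwk" "is_H_integral \<Gamma> W" and e: "0 < e"
  shows "\<exists>B \<omega>. countable_partition B \<and> (\<forall>f m. 0 \<le> \<omega> f m) \<and>
    (\<forall>f m u v. norm f \<le> 1 \<longrightarrow> u \<in> B m \<longrightarrow> v \<in> B m \<longrightarrow> measure lebesgue (B m) \<noteq> 0 \<longrightarrow>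
      \<bar>support_fun f (\<Gamma> u) - support_fun f (\<Gamma> v)\<bar> \<le> \<omega> f m) \<and>
    (\<forall>f M. norm f \<le> 1 \<longrightarrow> finite M \<longrightarrow> (\<Sum>m\<in>M. measure lebesgue (B m) * \<omega> f m) \<le> e) \<and>
    (\<forall>\<eta>>0. \<exists>M0. finite M0 \<and> (\<forall>f M. norm f \<le> 1 \<longrightarrow> finite M \<longrightarrow> M \<inter> M0 = {} \<longrightarrow>
      (\<Sum>m\<in>M. measure lebesgue (B m) * \<omega> f m) \<le> \<eta>))"
proof -
  define b where "b i = e * (1 / 2) ^ Suc i" for i
  have b: "0 < b i" for i using e by (simp add: b_def)
  define Q where "Q i N D \<longleftrightarrow> 0 < N \<and> D \<in> sets lebesgue \<and> D \<subseteq> {0..1} \<and> measure lebesgue ({0..1} - D) \<le> (1 / 2) ^ i \<and>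
    (\<forall>f F u v. norm f \<le> 1 \<longrightarrow> F \<subseteq> {..<N} \<longrightarrow> (\<forall>q\<in>F. u q \<in> D \<inter> cell N q \<and> v q \<in> D \<inter> cell N q) \<longrightarrow>
      (\<Sum>q\<in>F. 1 / real N * \<bar>support_fun f (\<Gamma> (u q)) - support_fun f (\<Gamma> (v q))\<bar>) \<le> b i)" for i N D
  have "\<forall>i. \<exists>N D. Q i N D"
    unfolding Q_def using H_integral_stage[OF \<Gamma> W b] by simp
  then obtain N D where ND: "Q i (N i) (D i)" for i by metis
  have N: "0 < N i" and D: "D i \<in> sets lebesgue" "D i \<subseteq> {0..1}"
    "measure lebesgue ({0..1} - D i) \<le> (1 / 2) ^ i" for i
    using ND[of i] by (simp_all add: Q_def)
  have osc: "(\<Sum>q\<in>F. 1 / real (N i) * \<bar>support_fun f (\<Gamma> (u q)) - support_fun f (\<Gamma> (v q))\<bar>) \<le> b i"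
    if "norm f \<le> 1" "F \<subseteq> {..<N i}" "\<And>q. q \<in> F \<Longrightarrow> u q \<in> D i \<inter> cell (N i) q \<and> v q \<in> D i \<inter> cell (N i) q"
    for i f F u v
    using ND[of i] that unfolding Q_def by simp
  \<comment> \<open>The first \<open>disjointed\<close> removes what earlier stages cover, the
    second the endpoints shared by neighbouring cells.\<close>
  define Bp where "Bp p = (if snd p < N (fst p) then disjointed D (fst p) \<inter> disjointed (cell (N (fst p))) (snd p) else {})" for p
  define Z where "Z = {0..1} - (\<Union>i. D i)"
  \<comment> \<open>Index 0 is reserved for the points covered by no stage, a null set; the other
    indices encode pairs of stage and cell.\<close>
  define B where "B n = (case n of 0 \<Rightarrow> Z | Suc m \<Rightarrow> Bp (prod_decode m))" for n
  have cellL: "cell n q \<in> sets lebesgue" for n q by (simp add: cell_def)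
  have Bp: "Bp p \<in> sets lebesgue" "Bp p \<subseteq> D (fst p)" "Bp p \<subseteq> cell (N (fst p)) (snd p)" for p
    using D(1) cellL disjointed_subset[of D "fst p"] disjointed_subset[of "cell (N (fst p))" "snd p"]
    by (auto simp: Bp_def disjointed_def)
  have Bp_empty: "Bp (i, q) = {}" if "\<not> q < N i" for i q using that by (simp add: Bp_def)
  have disjBp: "Bp p \<inter> Bp r = {}" if "p \<noteq> r" for p r
  proof (cases "fst p = fst r")
    case True
    then have "snd p \<noteq> snd r" using that by (simp add: prod_eq_iff)
    then show ?thesis
      using True disjoint_family_disjointed[of "cell (N (fst p))"]
      by (auto simp: Bp_def disjoint_family_on_def)
  next
    case False
    then show ?thesis using disjoint_family_disjointed[of D] by (auto simp: Bp_def disjoint_family_on_def)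
  qed
  have UBp: "(\<Union>p. Bp p) = (\<Union>i. D i)"
  proof (intro equalityI subsetI)
    fix t assume "t \<in> (\<Union>i. D i)"
    then have "t \<in> (\<Union>i. disjointed D i)" by (simp only: UN_disjointed_eq)
    then obtain i where i: "t \<in> disjointed D i" by blast
    then have "t \<in> {0..1}" using D(2)[of i] disjointed_subset[of D i] by blast
    then have "t \<in> (\<Union>q\<in>{0..<N i}. cell (N i) q)"
      using division_ofD(6)[OF cell_division(1)[OF N[of i]]] by (simp add: atLeast0LessThan)
    then have "t \<in> (\<Union>q\<in>{0..<N i}. disjointed (cell (N i)) q)" by (simp only: finite_UN_disjointed_eq)
    then obtain q where "q < N i" "t \<in> disjointed (cell (N i)) q" by auto
    then have "t \<in> Bp (i, q)" using i by (simp add: Bp_def)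
    then show "t \<in> (\<Union>p. Bp p)" by blast
  qed (use Bp(2) in blast)
  have Bp01: "Bp p \<subseteq> {0..1}" for p using Bp(2) D(2) by blast
  have B01: "B n \<subseteq> {0..1}" for n
    by (cases n) (simp add: B_def Z_def, simp only: B_def nat.case Bp01)
  have "countable_partition B"
    unfolding countable_partition_def sets_unit_iff
  proof (intro conjI allI)
    show "B n \<in> sets lebesgue" for n
      using D(1) Bp(1) by (auto simp: B_def Z_def split: nat.split)
    show "B n \<subseteq> {0..1}" for n by (rule B01)
    show "disjoint_family B"
      unfolding disjoint_family_on_def
    proof (intro ballI impI)
      have ZB: "Z \<inter> Bp p = {}" for p using Bp(2)[of p] by (auto simp: Z_def)
      fix m n :: nat assume "m \<noteq> n"
      then show "B m \<inter> B n = {}"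
      proof (induction m n rule: linorder_wlog)
        case (le m n)
        then obtain k where k: "n = Suc k" by (cases n) auto
        show ?case
        proof (cases m)
          case 0
          then show ?thesis using ZB[of "prod_decode k"] by (simp add: k B_def)
        next
          case (Suc j)
          then have "prod_decode j \<noteq> prod_decode k" using le k by (simp add: prod_decode_eq)
          then show ?thesis using disjBp[of "prod_decode j" "prod_decode k"] by (simp add: Suc k B_def)
        qed
      next
        case (sym m n)
        then show ?case by (simp add: Int_commute)
      qed
    qed
    show "(\<Union>n. B n) = {0..1}"
    proof (intro equalityI subsetI)
      fix t :: real assume t: "t \<in> {0..1}"
      show "t \<in> (\<Union>n. B n)"
      proof (cases "t \<in> (\<Union>i. D i)")
        case True
        then obtain p where "t \<in> Bp p" unfolding UBp[symmetric] by blast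
        then have "t \<in> B (Suc (prod_encode p))" by (simp add: B_def)
        then show ?thesis by blast
      next
        case False
        then have "t \<in> B 0" using t by (simp add: B_def Z_def)
        then show ?thesis by blast
      qed
    qed (use B01 in blast)
  qed
  have Z0: "measure lebesgue Z = 0"
  proof (rule ccontr)
    assume "measure lebesgue Z \<noteq> 0"
    then have "0 < measure lebesgue Z" using measure_nonneg[of lebesgue Z] by linarith
    then obtain i where i: "(1 / 2) ^ i < measure lebesgue Z" using real_arch_pow_inv[of "measure lebesgue Z" "1/2"] by auto
    have "{0..1} - D i \<in> lmeasurable" using D(1) by (intro fmeasurable_Diff) auto
    then have "measure lebesgue Z \<le> measure lebesgue ({0..1} - D i)"
      using D(1) by (intro measure_mono_fmeasurable) (auto simp: Z_def)
    then show False using D(3)[of i] i by linarith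
  qed
  \<comment> \<open>Null members get 0: the oscillation there is multiplied by measure 0, and no
    bound is asked for on them.\<close>
  define \<omega>p where "\<omega>p f p = (if measure lebesgue (Bp p) = 0 then 0
    else SUP w\<in>Bp p \<times> Bp p. \<bar>support_fun f (\<Gamma> (fst w)) - support_fun f (\<Gamma> (snd w))\<bar>)" for f p
  define \<omega> where "\<omega> f n = (case n of 0 \<Rightarrow> 0 | Suc m \<Rightarrow> \<omega>p f (prod_decode m))" for f n
  have bdd: "bdd_above ((\<lambda>w. \<bar>support_fun f (\<Gamma> (fst w)) - support_fun f (\<Gamma> (snd w))\<bar>) ` (Bp p \<times> Bp p))"
    if f: "norm f \<le> 1" for f p
  proof (rule bdd_aboveI2)
    fix w assume w: "w \<in> Bp p \<times> Bp p"
    then have "snd p < N (fst p)" by (auto simp: Bp_def split: if_splits)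
    moreover have "fst w \<in> Bp p" "snd w \<in> Bp p" using w by auto
    then have "fst w \<in> D (fst p) \<inter> cell (N (fst p)) (snd p)" "snd w \<in> D (fst p) \<inter> cell (N (fst p)) (snd p)"
      using Bp(2,3)[of p] by blast+
    ultimately have "1 / real (N (fst p)) * \<bar>support_fun f (\<Gamma> (fst w)) - support_fun f (\<Gamma> (snd w))\<bar> \<le> b (fst p)"
      using osc[OF f, of "{snd p}" "fst p" "\<lambda>_. fst w" "\<lambda>_. snd w"] by simp
    then show "\<bar>support_fun f (\<Gamma> (fst w)) - support_fun f (\<Gamma> (snd w))\<bar> \<le> real (N (fst p)) * b (fst p)"
      using N[of "fst p"] by (simp add: field_simps)
  qed
  have \<omega>p_upper: "\<bar>support_fun f (\<Gamma> u) - support_fun f (\<Gamma> v)\<bar> \<le> \<omega>p f p"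
    if "norm f \<le> 1" "u \<in> Bp p" "v \<in> Bp p" "measure lebesgue (Bp p) \<noteq> 0" for f p u v
    using cSUP_upper[OF _ bdd[OF that(1)], of "(u, v)" p] that by (simp add: \<omega>p_def)
  have \<omega>p_nonneg: "0 \<le> \<omega>p f p" if "norm f \<le> 1" for f p
  proof (cases "measure lebesgue (Bp p) = 0")
    case False
    then have "Bp p \<noteq> {}" by auto
    then obtain u where "u \<in> Bp p" by blast
    then show ?thesis using \<omega>p_upper[OF that, of u p u] False by simp
  qed (simp add: \<omega>p_def)
  have mBp: "measure lebesgue (Bp p) \<le> 1 / real (N (fst p))" for p
  proof -
    have "measure lebesgue (Bp p) \<le> measure lebesgue (cell (N (fst p)) (snd p))"
      using Bp by (intro measure_mono_fmeasurable) (auto simp: cell_def)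
    also have "\<dots> = 1 / real (N (fst p))"
      unfolding cell_def using N[of "fst p"] by (simp add: divide_right_mono diff_divide_distrib[symmetric])
    finally show ?thesis .
  qed
  \<comment> \<open>One stage contributes at most \<open>b i\<close>: members have measure at most
    \<open>1 / N i\<close>, the weight in the exchange estimate, and \<open>sum_SUP_le\<close>
    passes from chosen pairs to suprema.\<close>
  have row: "(\<Sum>q\<in>F. measure lebesgue (Bp (i, q)) * \<omega>p f (i, q)) \<le> b i"
    if f: "norm f \<le> 1" and F: "finite F" for f i F
  proof -
    define F' where "F' = {q \<in> F. measure lebesgue (Bp (i, q)) \<noteq> 0}"
    define g where "g = (\<lambda>q :: nat. \<lambda>w. 1 / real (N i) * \<bar>support_fun f (\<Gamma> (fst w)) - support_fun f (\<Gamma> (snd w))\<bar>)"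
    have F': "finite F'" "F' \<subseteq> F" using F by (auto simp: F'_def)
    have F'N: "q < N i" if "q \<in> F'" for q
      by (rule ccontr) (use that Bp_empty[of q i] in \<open>simp add: F'_def\<close>)
    have ne: "Bp (i, q) \<times> Bp (i, q) \<noteq> {}" if "q \<in> F'" for q using that by (auto simp: F'_def)
    have le: "(\<Sum>q\<in>F'. g q (w q)) \<le> b i" if w: "\<And>q. q \<in> F' \<Longrightarrow> w q \<in> Bp (i, q) \<times> Bp (i, q)" for w
      unfolding g_def
    proof (rule osc[OF f])
      show "F' \<subseteq> {..<N i}" using F'N by auto
      show "fst (w q) \<in> D i \<inter> cell (N i) q \<and> snd (w q) \<in> D i \<inter> cell (N i) q" if "q \<in> F'" for q
        using w[OF that] Bp(2,3)[of "(i, q)"] by (auto simp: mem_Times_iff)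
    qed
    have g0: "0 \<le> g q w" for q w by (simp add: g_def)
    have S1: "bdd_above (g q ` (Bp (i, q) \<times> Bp (i, q)))" if q: "q \<in> F'" for q
    proof (rule sum_SUP_le(1)[OF F'(1), where X = "\<lambda>q. Bp (i, q) \<times> Bp (i, q)" and c = "b i"])
      show "(\<Sum>q\<in>F'. g q (w q)) \<le> b i" if "\<And>q. q \<in> F' \<Longrightarrow> w q \<in> Bp (i, q) \<times> Bp (i, q)" for w
        by (rule le[OF that])
    qed (use ne g0 q in blast)+
    have S2: "(\<Sum>q\<in>F'. SUP w\<in>Bp (i, q) \<times> Bp (i, q). g q w) \<le> b i"
    proof (rule sum_SUP_le(2)[OF F'(1), where X = "\<lambda>q. Bp (i, q) \<times> Bp (i, q)" and c = "b i"])
      show "(\<Sum>q\<in>F'. g q (w q)) \<le> b i" if "\<And>q. q \<in> F' \<Longrightarrow> w q \<in> Bp (i, q) \<times> Bp (i, q)" for w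
        by (rule le[OF that])
    qed (use ne g0 in blast)+
    have "measure lebesgue (Bp (i, q)) * \<omega>p f (i, q) \<le> (SUP w\<in>Bp (i, q) \<times> Bp (i, q). g q w)" if q: "q \<in> F'" for q
    proof -
      have Ni: "0 < real (N i)" using N by simp
      have "\<omega>p f (i, q) \<le> real (N i) * (SUP w\<in>Bp (i, q) \<times> Bp (i, q). g q w)"
      proof -
        have "\<bar>support_fun f (\<Gamma> (fst w)) - support_fun f (\<Gamma> (snd w))\<bar>
            \<le> real (N i) * (SUP w\<in>Bp (i, q) \<times> Bp (i, q). g q w)" if "w \<in> Bp (i, q) \<times> Bp (i, q)" for w
        proof -
          have "real (N i) * g q w \<le> real (N i) * (SUP w\<in>Bp (i, q) \<times> Bp (i, q). g q w)"
            using Ni by (intro mult_left_mono cSUP_upper that S1[OF q]) auto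
          then show ?thesis using Ni by (simp add: g_def)
        qed
        then show ?thesis using q unfolding \<omega>p_def F'_def by (auto intro!: cSUP_least ne[OF q])
      qed
      then have "1 / real (N i) * \<omega>p f (i, q) \<le> (SUP w\<in>Bp (i, q) \<times> Bp (i, q). g q w)"
        using Ni by (simp add: field_simps)
      moreover have "measure lebesgue (Bp (i, q)) * \<omega>p f (i, q) \<le> 1 / real (N i) * \<omega>p f (i, q)"
        using mBp[of "(i, q)"] \<omega>p_nonneg[OF f] by (intro mult_right_mono) auto
      ultimately show ?thesis by linarith
    qed
    then have "(\<Sum>q\<in>F'. measure lebesgue (Bp (i, q)) * \<omega>p f (i, q)) \<le> (\<Sum>q\<in>F'. SUP w\<in>Bp (i, q) \<times> Bp (i, q). g q w)"
      by (rule sum_mono)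
    also have "\<dots> \<le> b i" by (rule S2)
    also have "(\<Sum>q\<in>F'. measure lebesgue (Bp (i, q)) * \<omega>p f (i, q)) = (\<Sum>q\<in>F. measure lebesgue (Bp (i, q)) * \<omega>p f (i, q))"
      by (rule sum.mono_neutral_left[OF F F'(2)]) (auto simp: F'_def)
    finally show ?thesis .
  qed
  have pairs: "(\<Sum>p\<in>P. measure lebesgue (Bp p) * \<omega>p f p) \<le> e * (1 / 2) ^ k"
    if f: "norm f \<le> 1" and P: "finite P" "fst ` P \<subseteq> {k..}" for f P k
  proof -
    have "(\<Sum>p\<in>P. measure lebesgue (Bp p) * \<omega>p f p) \<le> (\<Sum>p\<in>fst ` P \<times> snd ` P. measure lebesgue (Bp p) * \<omega>p f p)"
    proof (rule sum_mono2)
      show "P \<subseteq> fst ` P \<times> snd ` P" by (rule subset_fst_snd)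
      show "0 \<le> measure lebesgue (Bp p) * \<omega>p f p" for p using \<omega>p_nonneg[OF f] by simp
    qed (use P(1) in simp)
    also have "\<dots> = (\<Sum>i\<in>fst ` P. \<Sum>q\<in>snd ` P. measure lebesgue (Bp (i, q)) * \<omega>p f (i, q))"
      by (simp add: sum.cartesian_product case_prod_unfold)
    also have "\<dots> \<le> (\<Sum>i\<in>fst ` P. b i)" using row[OF f] P(1) by (intro sum_mono) auto
    also have "\<dots> \<le> e * (1 / 2) ^ k"
      unfolding b_def using P e by (intro sum_geometric_tail_le) auto
    finally show ?thesis .
  qed
  \<comment> \<open>The assumption on \<open>M\<close> says that it contains no index of an actual
    cell of a stage before \<open>k\<close>.\<close>
  have nats: "(\<Sum>m\<in>M. measure lebesgue (B m) * \<omega> f m) \<le> e * (1 / 2) ^ k"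
    if f: "norm f \<le> 1" and M: "finite M"
      and zero: "\<And>i q. Suc (prod_encode (i, q)) \<in> M \<Longrightarrow> i < k \<Longrightarrow> \<not> q < N i" for f M k
  proof -
    define M' where "M' = {m \<in> M. m \<noteq> 0 \<and> k \<le> fst (prod_decode (m - 1))}"
    have M': "finite M'" "M' \<subseteq> M" using M by (auto simp: M'_def)
    have "(\<Sum>m\<in>M. measure lebesgue (B m) * \<omega> f m) = (\<Sum>m\<in>M'. measure lebesgue (B m) * \<omega> f m)"
    proof (rule sum.mono_neutral_right[OF M M'(2)], rule ballI)
      fix m assume m: "m \<in> M - M'"
      show "measure lebesgue (B m) * \<omega> f m = 0"
      proof (cases m)
        case (Suc j)
        obtain i q where iq: "prod_decode j = (i, q)" by (metis surj_pair)
        then have "j = prod_encode (i, q)" by (metis prod_decode_inverse)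
        moreover have "i < k" using m Suc iq by (auto simp: M'_def)
        ultimately have "Bp (i, q) = {}" using zero m Suc Bp_empty by auto
        then show ?thesis using Suc iq by (simp add: B_def)
      qed (simp add: \<omega>_def)
    qed
    also have "\<dots> = (\<Sum>m\<in>M'. (\<lambda>p. measure lebesgue (Bp p) * \<omega>p f p) (prod_decode (m - 1)))"
      by (intro sum.cong) (auto simp: M'_def B_def \<omega>_def split: nat.split)
    also have "\<dots> = (\<Sum>p\<in>(\<lambda>m. prod_decode (m - 1)) ` M'. measure lebesgue (Bp p) * \<omega>p f p)"
    proof (rule sum.reindex[symmetric, unfolded o_def])
      show "inj_on (\<lambda>m. prod_decode (m - 1)) M'"
        by (intro inj_onI) (auto simp: M'_def prod_decode_eq)
    qed
    also have "\<dots> \<le> e * (1 / 2) ^ k" using M' by (intro pairs[OF f]) (auto simp: M'_def)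
    finally show ?thesis .
  qed
  have "(\<Sum>m\<in>M. measure lebesgue (B m) * \<omega> f m) \<le> e" if "norm f \<le> 1" "finite M" for f M
    using nats[OF that, of 0] by simp
  moreover have "\<exists>M0. finite M0 \<and> (\<forall>f M. norm f \<le> 1 \<longrightarrow> finite M \<longrightarrow> M \<inter> M0 = {} \<longrightarrow>
      (\<Sum>m\<in>M. measure lebesgue (B m) * \<omega> f m) \<le> \<eta>)" if "0 < \<eta>" for \<eta>
  proof -
    have "0 < \<eta> / e" using that e by simp
    then obtain k where "(1 / 2) ^ k < \<eta> / e" using real_arch_pow_inv[of "\<eta> / e" "1/2"] by auto
    then have k: "e * (1 / 2) ^ k \<le> \<eta>" using e by (simp add: field_simps)
    define M0 where "M0 = (\<lambda>p. Suc (prod_encode p)) ` (SIGMA i:{..<k}. {..<N i})"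
    have "(\<Sum>m\<in>M. measure lebesgue (B m) * \<omega> f m) \<le> \<eta>" if "norm f \<le> 1" "finite M" "M \<inter> M0 = {}" for f M
    proof (rule order_trans[OF nats[OF that(1,2), of k] k])
      fix i q assume as: "Suc (prod_encode (i, q)) \<in> M" "i < k"
      show "\<not> q < N i"
      proof
        assume "q < N i"
        then have "Suc (prod_encode (i, q)) \<in> M0" using as by (auto simp: M0_def)
        then show False using as that(3) by blast
      qed
    qed
    moreover have "finite M0" by (simp add: M0_def)
    ultimately show ?thesis by blast
  qed
  moreover have "\<bar>support_fun f (\<Gamma> u) - support_fun f (\<Gamma> v)\<bar> \<le> \<omega> f m"
    if "norm f \<le> 1" "u \<in> B m" "v \<in> B m" "measure lebesgue (B m) \<noteq> 0" for f u v m
    using that Z0 \<omega>p_upper[OF that(1)] by (cases m) (auto simp: B_def \<omega>_def)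
  \<comment> \<open>The bounds are known on the unit ball only; setting the values to 0 elsewhere
    makes nonnegativity hold for all functionals.\<close>
  moreover define \<omega>' where "\<omega>' f m = (if norm f \<le> 1 then \<omega> f m else 0)" for f m
  have "0 \<le> \<omega>' f m" for f m using \<omega>p_nonneg by (auto simp: \<omega>'_def \<omega>_def split: nat.split)
  ultimately show ?thesis using \<open>countable_partition B\<close>
    by (intro exI[of _ B] exI[of _ \<omega>']) (simp add: \<omega>'_def)
qed

section \<open>Henstock and Pettis integrability imply Birkhoff integrability\<close>

lemma birkhoff_term_cwk:
  assumes "\<forall>t\<in>{0..1}. \<Gamma> t \<in> cwk" "A n \<noteq> {} \<longrightarrow> t n \<in> {0..1}"
  shows "birkhoff_term \<Gamma> A t n \<in> cwk"
  using assms cwk_singleton[of 0] by (auto simp: birkhoff_term_def intro!: cwk_scale)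

lemma support_fun_birkhoff_term:
  assumes "\<forall>t\<in>{0..1}. \<Gamma> t \<in> cwk" "A n \<noteq> {} \<longrightarrow> t n \<in> {0..1}"
  shows "support_fun f (birkhoff_term \<Gamma> A t n) = measure lebesgue (A n) * support_fun f (\<Gamma> (t n))"
  using assms by (auto simp: birkhoff_term_def support_fun_scale cwk_bounded cwk_nonempty)

lemma sum_group_le:
  fixes a w :: "nat \<Rightarrow> real"
  assumes G: "finite G" and w: "\<And>m. 0 \<le> w m"
    and le: "\<And>m. (\<Sum>n\<in>{n \<in> G. r n = m}. a n) \<le> b m"
  shows "(\<Sum>n\<in>G. a n * w (r n)) \<le> (\<Sum>m\<in>r ` G. b m * w m)"
proof -
  have "(\<Sum>n\<in>G. a n * w (r n)) = (\<Sum>m\<in>r ` G. \<Sum>n\<in>{n \<in> G. r n = m}. a n * w (r n))"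
    by (rule sum.image_gen[OF G])
  also have "\<dots> = (\<Sum>m\<in>r ` G. (\<Sum>n\<in>{n \<in> G. r n = m}. a n) * w m)"
    by (intro sum.cong refl) (simp add: sum_distrib_right)
  also have "\<dots> \<le> (\<Sum>m\<in>r ` G. b m * w m)"
    using le w by (intro sum_mono mult_right_mono) auto
  finally show ?thesis .
qed

lemma unit_lmeasurable: "A \<in> sets lebesgue \<Longrightarrow> A \<subseteq> {0..1::real} \<Longrightarrow> A \<in> lmeasurable"
  by (rule fmeasurableI2[of "{0..1}"]) auto

lemma sum_measure_disjoint_le:
  assumes "finite G" "disjoint_family_on A G" "\<And>n. n \<in> G \<Longrightarrow> A n \<in> sets lebesgue"
    "\<And>n. n \<in> G \<Longrightarrow> A n \<subseteq> B" "B \<in> sets lebesgue" "B \<subseteq> {0..1::real}"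
  shows "(\<Sum>n\<in>G. measure lebesgue (A n)) \<le> measure lebesgue B"
proof -
  have B: "B \<in> lmeasurable" using assms(5,6) by (rule unit_lmeasurable)
  have A: "A n \<in> lmeasurable" if "n \<in> G" for n
    by (rule fmeasurableI2[OF B assms(4,3)[OF that]])
  have "(\<Sum>n\<in>G. measure lebesgue (A n)) = measure lebesgue (\<Union>n\<in>G. A n)"
  proof (rule measure_finite_Union[symmetric, OF assms(1) _ assms(2)])
    show "A ` G \<subseteq> sets lebesgue" using assms(3) by blast
    show "emeasure lebesgue (A n) \<noteq> \<infinity>" if "n \<in> G" for n
      unfolding infinity_ennreal_def by (rule fmeasurableD2[OF A[OF that]])
  qed
  also have "\<dots> \<le> measure lebesgue B"
    using assms by (intro measure_mono_fmeasurable B) auto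
  finally show ?thesis .
qed

lemma osc_integral_le:
  fixes g :: "real \<Rightarrow> real"
  assumes A: "A \<in> sets lebesgue" "A \<subseteq> {0..1}" and g: "set_integrable lebesgue A g"
    and le: "\<And>s. s \<in> A \<Longrightarrow> \<bar>c - g s\<bar> \<le> w"
  shows "\<bar>measure lebesgue A * c - (LINT s:A|lebesgue. g s)\<bar> \<le> measure lebesgue A * w"
proof -
  have Am: "A \<in> lmeasurable" using A by (rule unit_lmeasurable)
  have const: "set_integrable lebesgue A (\<lambda>_. d)" "(LINT s:A|lebesgue. d) = measure lebesgue A * d" for d :: real
    using Am by (auto simp: set_integrable_def set_lebesgue_integral_def fmeasurable_def)
  have "measure lebesgue A * c - (LINT s:A|lebesgue. g s) = (LINT s:A|lebesgue. c - g s)"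
    using set_integral_diff(2)[OF const(1)[of c] g] const(2)[of c] by simp
  moreover have "\<bar>LINT s:A|lebesgue. c - g s\<bar> \<le> (LINT s:A|lebesgue. \<bar>c - g s\<bar>)"
    using set_integral_norm_bound[OF set_integral_diff(1)[OF const(1)[of c] g]] by simp
  moreover have "\<dots> \<le> (LINT s:A|lebesgue. w)"
    by (rule set_integral_mono[OF set_integrable_abs[OF set_integral_diff(1)[OF const(1)[of c] g]] const(1) le])
  ultimately show ?thesis using const(2)[of w] by simp
qed

text \<open>Each term of a Birkhoff series differs from the integral over \<open>A n\<close> by at
  most measure times oscillation. These errors sum to at most \<open>e\<close> for all functionals
  of the ball at once, so the series inherits convergence and value from the countably additive
  integrals.\<close>

theorem H_pettis_imp_birkhoff:
  fixes \<Gamma> :: "real \<Rightarrow> 'a::banach set"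
  assumes \<Gamma>: "\<forall>t\<in>{0..1}. \<Gamma> t \<in> cwk" and W: "W \<in> cwk" "is_H_integral \<Gamma> W" and P: "pettis_integrable \<Gamma>"
  shows "is_birkhoff_integral \<Gamma> W"
  unfolding is_birkhoff_integral_def
proof (intro allI impI)
  fix \<epsilon> :: real assume \<epsilon>: "0 < \<epsilon>"
  define e where "e = \<epsilon> / 2"
  have e: "0 < e" "e < \<epsilon>" using \<epsilon> by (auto simp: e_def)
  obtain B \<omega> where B: "countable_partition B" and \<omega>0: "\<forall>f m. 0 \<le> \<omega> f m"
    and osc: "\<forall>f m u v. norm f \<le> 1 \<longrightarrow> u \<in> B m \<longrightarrow> v \<in> B m \<longrightarrow> measure lebesgue (B m) \<noteq> 0 \<longrightarrow>
      \<bar>support_fun f (\<Gamma> u) - support_fun f (\<Gamma> v)\<bar> \<le> \<omega> f m"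
    and total: "\<forall>f M. norm f \<le> 1 \<longrightarrow> finite M \<longrightarrow> (\<Sum>m\<in>M. measure lebesgue (B m) * \<omega> f m) \<le> e"
    and tail: "\<forall>\<eta>>0. \<exists>M0. finite M0 \<and> (\<forall>f M. norm f \<le> 1 \<longrightarrow> finite M \<longrightarrow> M \<inter> M0 = {} \<longrightarrow>
      (\<Sum>m\<in>M. measure lebesgue (B m) * \<omega> f m) \<le> \<eta>)"
    using H_integral_oscillation[OF \<Gamma> W e(1)] by (elim exE conjE)
  have BL: "B m \<in> sets lebesgue" "B m \<subseteq> {0..1}" for m
    using B by (auto simp: countable_partition_def sets_unit_iff)
  have int: "set_integrable lebesgue A (\<lambda>t. support_fun f (\<Gamma> t))"
    if "A \<in> sets lebesgue" "A \<subseteq> {0..1}" for A f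
    using P that by (simp add: pettis_integrable_def scalarly_integrable_set_integrable)
  have sW: "support_fun f W = (LINT t:{0..1}|lebesgue. support_fun f (\<Gamma> t))" for f
    using has_integral_unique[OF H_integral_has_integral[OF \<Gamma> W] has_integral_set_lebesgue[OF int]] by simp
  have "unconditionally_convergent (birkhoff_term \<Gamma> A t) \<and>
      (\<exists>S. set_sums (birkhoff_term \<Gamma> A t) S \<and> hausdorff_dist W S < \<epsilon>)"
    if A: "countable_partition A" and fin: "\<forall>n. \<exists>m. A n \<subseteq> B m" and t: "\<forall>n. A n \<noteq> {} \<longrightarrow> t n \<in> A n" for A t
  proof -
    have AL: "A n \<in> sets lebesgue" "A n \<subseteq> {0..1}" and disjA: "disjoint_family A" and UA: "(\<Union>n. A n) = {0..1}" for n
      using A by (auto simp: countable_partition_def sets_unit_iff)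
    obtain r where r: "\<And>n. A n \<subseteq> B (r n)" using fin by metis
    have t01: "A n \<noteq> {} \<longrightarrow> t n \<in> {0..1}" for n using t AL by blast
    define C where "C = birkhoff_term \<Gamma> A t"
    have C: "C n \<in> cwk" for n unfolding C_def by (rule birkhoff_term_cwk[OF \<Gamma> t01])
    have sC: "support_fun f (C n) = measure lebesgue (A n) * support_fun f (\<Gamma> (t n))" for f n
      unfolding C_def by (rule support_fun_birkhoff_term[OF \<Gamma> t01])
    have near: "\<bar>support_fun f (C n) - (LINT s:A n|lebesgue. support_fun f (\<Gamma> s))\<bar> \<le> measure lebesgue (A n) * \<omega> f (r n)"
      and near_abs: "\<bar>support_fun f (C n)\<bar> \<le> (LINT s:A n|lebesgue. \<bar>support_fun f (\<Gamma> s)\<bar>) + measure lebesgue (A n) * \<omega> f (r n)"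
      if f: "norm f \<le> 1" for f n
    proof -
      show 1: "\<bar>support_fun f (C n) - (LINT s:A n|lebesgue. support_fun f (\<Gamma> s))\<bar> \<le> measure lebesgue (A n) * \<omega> f (r n)"
      \<comment> \<open>On null members no oscillation bound is available, but term and integral
        both vanish.\<close>
      proof (cases "measure lebesgue (B (r n)) = 0")
        case True
        have Bm: "B (r n) \<in> lmeasurable" using BL by (rule unit_lmeasurable)
        then have "negligible (B (r n))" using True by (simp add: negligible_iff_measure)
        then have "negligible (A n)" using r negligible_subset by blast
        then have null: "A n \<in> null_sets lebesgue" by (simp add: negligible_iff_null_sets)
        then have "measure lebesgue (A n) = 0" by (simp add: null_sets_def measure_def)
        moreover have "AE s in lebesgue. indicator (A n) s *\<^sub>R support_fun f (\<Gamma> s) = 0"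
          using AE_not_in[OF null] by eventually_elim simp
        then have "(LINT s:A n|lebesgue. support_fun f (\<Gamma> s)) = 0"
          unfolding set_lebesgue_integral_def by (rule integral_eq_zero_AE)
        ultimately show ?thesis by (simp add: sC)
      next
        case False
        have "\<bar>support_fun f (\<Gamma> (t n)) - support_fun f (\<Gamma> s)\<bar> \<le> \<omega> f (r n)" if s: "s \<in> A n" for s
        proof -
          have "t n \<in> B (r n)" "s \<in> B (r n)" using r[of n] t s by auto
          then show ?thesis using osc f False by blast
        qed
        then show ?thesis unfolding sC by (rule osc_integral_le[OF AL int[OF AL]])
      qed
      have "\<bar>LINT s:A n|lebesgue. support_fun f (\<Gamma> s)\<bar> \<le> (LINT s:A n|lebesgue. \<bar>support_fun f (\<Gamma> s)\<bar>)"
        using set_integral_norm_bound[OF int[OF AL]] by simp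
      then show "\<bar>support_fun f (C n)\<bar> \<le> (LINT s:A n|lebesgue. \<bar>support_fun f (\<Gamma> s)\<bar>) + measure lebesgue (A n) * \<omega> f (r n)"
        using 1 by linarith
    qed
    have grp: "(\<Sum>n\<in>{n \<in> G. r n = m}. measure lebesgue (A n)) \<le> measure lebesgue (B m)" if "finite G" for G m
    proof (rule sum_measure_disjoint_le)
      show "disjoint_family_on A {n \<in> G. r n = m}" using disjA by (auto simp: disjoint_family_on_def)
      show "A n \<subseteq> B m" if "n \<in> {n \<in> G. r n = m}" for n using that r by blast
    qed (use that AL BL in auto)
    have group: "(\<Sum>n\<in>G. measure lebesgue (A n) * \<omega> f (r n)) \<le> (\<Sum>m\<in>r ` G. measure lebesgue (B m) * \<omega> f m)"
      if "finite G" for f G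
      using that \<omega>0 grp[OF that] by (intro sum_group_le) auto
    define E where "E N = (\<Union>n\<in>{N..}. A n)" for N
    have E: "E N \<in> sets lebesgue" "E N \<subseteq> {0..1}" for N using AL by (auto simp: E_def)
    have decE: "decseq E" unfolding E_def by (intro decseq_SucI UN_mono) auto
    have emE: "(\<Inter>N. E N) = {}"
    proof (rule ccontr)
      assume "(\<Inter>N. E N) \<noteq> {}"
      then obtain s where s: "\<And>N. s \<in> E N" by blast
      then obtain n where n: "s \<in> A n" by (auto simp: E_def)
      obtain k where "Suc n \<le> k" "s \<in> A k" using s[of "Suc n"] by (auto simp: E_def)
      then have "A k \<inter> A n = {}" using disjA by (simp add: disjoint_family_on_def)
      then show False using n \<open>s \<in> A k\<close> by blast
    qed
    have EM: "E N \<in> lmeasurable" for N using E by (rule unit_lmeasurable)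
    \<comment> \<open>One third of \<open>\<eta>\<close> each: for the integrals over the far sets,
      for far sets inside the finitely many members of \<open>M0\<close>, whose measure tends to 0,
      and for sets inside the other members.\<close>
    have tails: "\<exists>N. \<forall>f G. norm f \<le> 1 \<longrightarrow> finite G \<longrightarrow> G \<subseteq> {N..} \<longrightarrow> \<bar>\<Sum>n\<in>G. support_fun f (C n)\<bar> \<le> \<eta>"
      if \<eta>: "0 < \<eta>" for \<eta>
    proof -
      obtain N1 where N1: "\<And>f. norm f \<le> 1 \<Longrightarrow> (LINT s:E N1|lebesgue. \<bar>support_fun f (\<Gamma> s)\<bar>) \<le> \<eta> / 3"
        using pettis_uniformly_absolutely_null[OF P E decE emE, of "\<eta> / 3"] \<eta> by auto
      obtain M0 where M0: "finite M0" "\<And>f M. norm f \<le> 1 \<Longrightarrow> finite M \<Longrightarrow> M \<inter> M0 = {} \<Longrightarrow>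
        (\<Sum>m\<in>M. measure lebesgue (B m) * \<omega> f m) \<le> \<eta> / 3"
        using tail \<eta> by (metis zero_less_divide_iff zero_less_numeral)
      \<comment> \<open>A common bound for the oscillations on the members of positive measure in
        \<open>M0\<close>, from the total bound applied to single members. Null members contribute
        0, by division by zero.\<close>
      define c where "c = (\<Sum>m\<in>M0. e / measure lebesgue (B m))"
      have c: "0 \<le> c" unfolding c_def using e(1) by (intro sum_nonneg) auto
      have \<omega>c: "measure lebesgue (A n) * \<omega> f (r n) \<le> measure lebesgue (A n) * c" if "norm f \<le> 1" "r n \<in> M0" for f n
      proof (cases "measure lebesgue (B (r n)) = 0")
        case True
        have "measure lebesgue (A n) \<le> measure lebesgue (B (r n))"
          by (intro measure_mono_fmeasurable unit_lmeasurable r AL BL)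
        then have "measure lebesgue (A n) = 0"
          using True measure_nonneg[of lebesgue "A n"] by simp
        then show ?thesis by simp
      next
        case False
        then have pos: "0 < measure lebesgue (B (r n))" using measure_nonneg[of lebesgue "B (r n)"] by linarith
        have "measure lebesgue (B (r n)) * \<omega> f (r n) \<le> e" using total that(1) by (auto dest!: spec[of _ f] spec[of _ "{r n}"])
        then have "\<omega> f (r n) \<le> e / measure lebesgue (B (r n))" using pos by (simp add: field_simps)
        also have "\<dots> \<le> c" unfolding c_def using M0(1) that(2) e(1) by (intro member_le_sum) auto
        finally show ?thesis by (rule mult_left_mono) simp
      qed
      have "(\<lambda>N. measure lebesgue (E N)) \<longlonglongrightarrow> measure lebesgue (\<Inter>N. E N)"
      proof (rule Lim_measure_decseq[OF _ decE])
        show "range E \<subseteq> sets lebesgue" using E(1) by blast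
        show "emeasure lebesgue (E N) \<noteq> \<infinity>" for N
          unfolding infinity_ennreal_def by (rule fmeasurableD2[OF EM])
      qed
      then have "(\<lambda>N. c * measure lebesgue (E N)) \<longlonglongrightarrow> c * 0" unfolding emE by (intro tendsto_intros) simp
      then have "\<forall>\<^sub>F N in sequentially. c * measure lebesgue (E N) < \<eta> / 3" using \<eta> by (intro order_tendstoD) auto
      then obtain N2 where N2: "c * measure lebesgue (E N2) < \<eta> / 3" by (auto simp: eventually_sequentially)
      have "\<bar>\<Sum>n\<in>G. support_fun f (C n)\<bar> \<le> \<eta>" if f: "norm f \<le> 1" and G: "finite G" "G \<subseteq> {max N1 N2..}" for f G
      proof -
        have dG: "disjoint_family_on A G'" for G' using disjA by (auto simp: disjoint_family_on_def)
        have "\<bar>\<Sum>n\<in>G. support_fun f (C n)\<bar> \<le> (\<Sum>n\<in>G. \<bar>support_fun f (C n)\<bar>)" by (rule sum_abs)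
        also have "\<dots> \<le> (\<Sum>n\<in>G. LINT s:A n|lebesgue. \<bar>support_fun f (\<Gamma> s)\<bar>) + (\<Sum>n\<in>G. measure lebesgue (A n) * \<omega> f (r n))"
          unfolding sum.distrib[symmetric] by (intro sum_mono near_abs f)
        also have "(\<Sum>n\<in>G. LINT s:A n|lebesgue. \<bar>support_fun f (\<Gamma> s)\<bar>) \<le> \<eta> / 3"
        proof -
          have GE: "(\<Union>n\<in>G. A n) \<subseteq> E N1" unfolding E_def using G(2) by (intro UN_mono) auto
          have ia: "set_integrable lebesgue D (\<lambda>s. \<bar>support_fun f (\<Gamma> s)\<bar>)" if "D \<in> sets lebesgue" "D \<subseteq> {0..1}" for D
            by (rule set_integrable_abs[OF int[OF that]])
          have GL: "(\<Union>n\<in>G. A n) \<in> sets lebesgue" using G(1) AL by (intro sets.finite_UN) auto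
          have "(\<Sum>n\<in>G. LINT s:A n|lebesgue. \<bar>support_fun f (\<Gamma> s)\<bar>) = (LINT s:(\<Union>n\<in>G. A n)|lebesgue. \<bar>support_fun f (\<Gamma> s)\<bar>)"
            using AL ia by (intro set_integral_finite_Union[symmetric] G(1) dG) auto
          also have "\<dots> \<le> (LINT s:E N1|lebesgue. \<bar>support_fun f (\<Gamma> s)\<bar>)"
            using GE ia[OF E] ia[OF GL] E(2)[of N1] unfolding set_lebesgue_integral_def set_integrable_def
            by (intro integral_mono) (auto split: split_indicator)
          also have "\<dots> \<le> \<eta> / 3" by (rule N1[OF f])
          finally show ?thesis .
        qed
        also have "(\<Sum>n\<in>G. measure lebesgue (A n) * \<omega> f (r n)) \<le> \<eta> / 3 + \<eta> / 3"
        proof -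
          define G1 where "G1 = {n \<in> G. r n \<in> M0}"
          define G2 where "G2 = {n \<in> G. r n \<notin> M0}"
          have fG: "finite G1" "finite G2" and GG: "G = G1 \<union> G2" "G1 \<inter> G2 = {}" using G(1) by (auto simp: G1_def G2_def)
          have "(\<Sum>n\<in>G1. measure lebesgue (A n) * \<omega> f (r n)) \<le> (\<Sum>n\<in>G1. measure lebesgue (A n) * c)"
            using \<omega>c[OF f] by (intro sum_mono) (auto simp: G1_def)
          also have "\<dots> = c * (\<Sum>n\<in>G1. measure lebesgue (A n))" by (simp add: sum_distrib_left mult.commute)
          also have "\<dots> \<le> c * measure lebesgue (E N2)"
          proof (rule mult_left_mono[OF sum_measure_disjoint_le c])
            show "A n \<subseteq> E N2" if "n \<in> G1" for n
              unfolding E_def using that G(2) by (intro UN_upper) (auto simp: G1_def)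
          qed (use fG AL E dG in auto)
          finally have s1: "(\<Sum>n\<in>G1. measure lebesgue (A n) * \<omega> f (r n)) \<le> \<eta> / 3" using N2 by simp
          have "(\<Sum>n\<in>G2. measure lebesgue (A n) * \<omega> f (r n)) \<le> (\<Sum>m\<in>r ` G2. measure lebesgue (B m) * \<omega> f m)"
            by (rule group[OF fG(2)])
          also have "\<dots> \<le> \<eta> / 3" using fG(2) by (intro M0(2)[OF f]) (auto simp: G2_def)
          finally have s2: "(\<Sum>n\<in>G2. measure lebesgue (A n) * \<omega> f (r n)) \<le> \<eta> / 3" .
          show ?thesis using s1 s2 sum.union_disjoint[OF fG GG(2), of "\<lambda>n. measure lebesgue (A n) * \<omega> f (r n)"] GG(1) by simp
        qed
        finally show ?thesis by simp
      qed
      then show ?thesis by blast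
    qed
    have uc: "unconditionally_convergent C" by (rule uniformly_summable_unconditional[OF C tails])
    obtain S where S: "set_sums C S" "\<And>f. (\<lambda>n. support_fun f (C n)) sums support_fun f S"
      by (rule uniformly_summable_set_sums[OF C]) (erule tails, rule that)
    have Sc: "S \<in> cwk" using S(1) by (simp add: set_sums_def)
    have "hausdorff_dist W S \<le> e"
    proof (rule hausdorff_dist_le)
      fix f :: "'a \<Rightarrow>\<^sub>L real" assume f: "norm f \<le> 1"
      have "(\<lambda>n. LINT s:A n|lebesgue. support_fun f (\<Gamma> s)) sums (LINT s:(\<Union>n. A n)|lebesgue. support_fun f (\<Gamma> s))"
        using AL UA by (intro set_integral_sums[OF _ disjA] int) auto
      then have "(\<lambda>n. LINT s:A n|lebesgue. support_fun f (\<Gamma> s)) sums support_fun f W" by (simp add: UA sW)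
      then have s: "(\<lambda>n. (LINT s:A n|lebesgue. support_fun f (\<Gamma> s)) - support_fun f (C n)) sums (support_fun f W - support_fun f S)"
        by (intro sums_diff S(2))
      show "\<bar>support_fun f W - support_fun f S\<bar> \<le> e"
      proof (rule tendsto_upperbound)
        show "(\<lambda>k. \<bar>\<Sum>n<k. (LINT s:A n|lebesgue. support_fun f (\<Gamma> s)) - support_fun f (C n)\<bar>) \<longlonglongrightarrow> \<bar>support_fun f W - support_fun f S\<bar>"
          using s unfolding sums_def by (intro tendsto_rabs)
        have "\<bar>\<Sum>n<k. (LINT s:A n|lebesgue. support_fun f (\<Gamma> s)) - support_fun f (C n)\<bar> \<le> e" for k
        proof -
          have "\<bar>\<Sum>n<k. (LINT s:A n|lebesgue. support_fun f (\<Gamma> s)) - support_fun f (C n)\<bar>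
              \<le> (\<Sum>n<k. measure lebesgue (A n) * \<omega> f (r n))"
            by (rule order_trans[OF sum_abs sum_mono]) (use near[OF f] in \<open>simp add: abs_minus_commute\<close>)
          also have "\<dots> \<le> (\<Sum>m\<in>r ` {..<k}. measure lebesgue (B m) * \<omega> f m)" by (rule group) simp
          also have "\<dots> \<le> e" using total f by simp
          finally show ?thesis .
        qed
        then show "\<forall>\<^sub>F k in sequentially. \<bar>\<Sum>n<k. (LINT s:A n|lebesgue. support_fun f (\<Gamma> s)) - support_fun f (C n)\<bar> \<le> e"
          by simp
      qed simp
    qed (use W(1) Sc in \<open>simp_all add: cwk_bounded cwk_convex cwk_nonempty\<close>)
    then show ?thesis using uc S(1) e(2) unfolding C_def by (intro conjI exI[of _ S]) auto
  qed
  then show "\<exists>B. countable_partition B \<and> (\<forall>A t. countable_partition A \<and> (\<forall>n. \<exists>m. A n \<subseteq> B m) \<and>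
      (\<forall>n. A n \<noteq> {} \<longrightarrow> t n \<in> A n) \<longrightarrow> unconditionally_convergent (birkhoff_term \<Gamma> A t) \<and>
      (\<exists>S. set_sums (birkhoff_term \<Gamma> A t) S \<and> hausdorff_dist W S < \<epsilon>))" using B by blast
qed

section \<open>Birkhoff integrability yields measurable McShane gauges\<close>

text \<open>Rearrangements are covered by the quantifier over \<open>A\<close>: a permuted or
  spread-out version of a finer partition is again one.\<close>

definition birkhoff_partition ::
  "(real \<Rightarrow> 'a::real_normed_vector set) \<Rightarrow> 'a set \<Rightarrow> real \<Rightarrow> (nat \<Rightarrow> real set) \<Rightarrow> bool" where
  "birkhoff_partition \<Gamma> W e B \<longleftrightarrow> countable_partition B \<and>
    (\<forall>A t. countable_partition A \<longrightarrow> (\<forall>n. \<exists>m. A n \<subseteq> B m) \<longrightarrow> (\<forall>n. A n \<noteq> {} \<longrightarrow> t n \<in> A n) \<longrightarrow>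
      (\<exists>S. set_sums (birkhoff_term \<Gamma> A t) S \<and> hausdorff_dist W S < e))"

lemma birkhoff_partition_exists:
  assumes "is_birkhoff_integral \<Gamma> W" "0 < e"
  obtains B where "birkhoff_partition \<Gamma> W e B"
proof -
  obtain B where "countable_partition B" "\<forall>A t. countable_partition A \<and> (\<forall>n. \<exists>m. A n \<subseteq> B m) \<and>
      (\<forall>n. A n \<noteq> {} \<longrightarrow> t n \<in> A n) \<longrightarrow> unconditionally_convergent (birkhoff_term \<Gamma> A t) \<and>
      (\<exists>S. set_sums (birkhoff_term \<Gamma> A t) S \<and> hausdorff_dist W S < e)"
    using assms(1)[unfolded is_birkhoff_integral_def, rule_format, OF assms(2)] by (elim exE conjE)
  then have "birkhoff_partition \<Gamma> W e B" unfolding birkhoff_partition_def by simp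
  then show thesis by (rule that)
qed

context
  fixes \<Gamma> :: "real \<Rightarrow> 'a::real_normed_vector set" and W :: "'a set" and e :: real and B :: "nat \<Rightarrow> real set"
  assumes \<Gamma>: "\<forall>t\<in>{0..1}. \<Gamma> t \<in> cwk" and W: "W \<in> cwk" and B: "birkhoff_partition \<Gamma> W e B"
begin

lemma birkhoff_partition_sums:
  assumes A: "countable_partition A" "\<And>n. \<exists>m. A n \<subseteq> B m" "\<And>n. A n \<noteq> {} \<Longrightarrow> t n \<in> A n"
  obtains S where "S \<in> cwk" "\<And>f. (\<lambda>n. measure lebesgue (A n) * support_fun f (\<Gamma> (t n))) sums support_fun f S"
    "\<And>\<eta>. 0 < \<eta> \<Longrightarrow> \<exists>N. \<forall>n\<ge>N. \<forall>f. norm f \<le> 1 \<longrightarrow>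
      \<bar>(\<Sum>k<n. measure lebesgue (A k) * support_fun f (\<Gamma> (t k))) - support_fun f S\<bar> \<le> \<eta>"
    "\<And>f. norm f \<le> 1 \<Longrightarrow> \<bar>support_fun f W - support_fun f S\<bar> \<le> e"
proof -
  obtain S where S: "set_sums (birkhoff_term \<Gamma> A t) S" "hausdorff_dist W S < e"
    using B A unfolding birkhoff_partition_def by blast
  define C where "C = birkhoff_term \<Gamma> A t"
  have t01: "A n \<noteq> {} \<longrightarrow> t n \<in> {0..1}" for n
  proof -
    have "A n \<subseteq> {0..1}" using A(1) by (simp add: countable_partition_def sets_unit_iff)
    then show ?thesis using A(3)[of n] by blast
  qed
  have C: "C n \<in> cwk" for n unfolding C_def by (rule birkhoff_term_cwk[OF \<Gamma> t01])
  have sC: "support_fun f (C n) = measure lebesgue (A n) * support_fun f (\<Gamma> (t n))" for f n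
    unfolding C_def by (rule support_fun_birkhoff_term[OF \<Gamma> t01])
  have Sc: "S \<in> cwk" and lim: "(\<lambda>n. hausdorff_dist (\<Sum>k<n. C k) S) \<longlonglongrightarrow> 0"
    using S(1) by (auto simp: set_sums_def C_def)
  have part: "(\<Sum>k<n. C k) \<in> cwk" for n by (intro cwk_sum C) simp
  have d: "\<bar>(\<Sum>k<n. measure lebesgue (A k) * support_fun f (\<Gamma> (t k))) - support_fun f S\<bar>
      \<le> norm f * hausdorff_dist (\<Sum>k<n. C k) S" for f n
  proof -
    have "support_fun f (\<Sum>k<n. C k) = (\<Sum>k<n. measure lebesgue (A k) * support_fun f (\<Gamma> (t k)))"
      unfolding sC[symmetric] by (intro support_fun_sum C) simp
    then show ?thesis
      using support_fun_hausdorff_dist[OF cwk_bounded[OF part] cwk_nonempty[OF part] cwk_bounded[OF Sc] cwk_nonempty[OF Sc]]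
      by metis
  qed
  have dist_nonneg: "0 \<le> hausdorff_dist D E" if DE: "D \<in> cwk" "E \<in> cwk" for D E :: "'a set"
  proof -
    obtain x where "x \<in> D" using cwk_nonempty[OF DE(1)] by blast
    then have "infdist x E \<le> hausdorff_dist D E"
      unfolding hausdorff_dist_def using bdd_above_infdist[OF cwk_bounded[OF DE(1)] cwk_nonempty[OF DE(2)]]
      by (intro max.coboundedI1 cSUP_upper)
    then show ?thesis using infdist_nonneg order_trans by blast
  qed
  have unit: "norm f * r \<le> r" if "norm f \<le> 1" "0 \<le> r" for f :: "'a \<Rightarrow>\<^sub>L real" and r
    using mult_right_mono[OF that] by simp
  show thesis
  proof (rule that[OF Sc])
    show "(\<lambda>n. measure lebesgue (A n) * support_fun f (\<Gamma> (t n))) sums support_fun f S" for f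
    proof -
      have "(\<lambda>n. norm f * hausdorff_dist (\<Sum>k<n. C k) S) \<longlonglongrightarrow> 0"
        using tendsto_mult_right_zero[OF lim] .
      then have "(\<lambda>n. (\<Sum>k<n. measure lebesgue (A k) * support_fun f (\<Gamma> (t k))) - support_fun f S) \<longlonglongrightarrow> 0"
        by (rule Lim_null_comparison[rotated]) (use d in simp)
      then show ?thesis unfolding sums_def by (simp add: LIM_zero_iff)
    qed
    show "\<exists>N. \<forall>n\<ge>N. \<forall>f. norm f \<le> 1 \<longrightarrow>
      \<bar>(\<Sum>k<n. measure lebesgue (A k) * support_fun f (\<Gamma> (t k))) - support_fun f S\<bar> \<le> \<eta>" if \<eta>: "0 < \<eta>" for \<eta>
    proof -
      obtain N where N: "\<And>n. n \<ge> N \<Longrightarrow> \<bar>hausdorff_dist (\<Sum>k<n. C k) S\<bar> < \<eta>"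
        using LIMSEQ_D[OF lim \<eta>] by auto
      have "\<bar>(\<Sum>k<n. measure lebesgue (A k) * support_fun f (\<Gamma> (t k))) - support_fun f S\<bar> \<le> \<eta>"
        if "n \<ge> N" "norm f \<le> 1" for n f
        using d[of f n] unit[OF that(2) dist_nonneg[OF part Sc, of n]] N[OF that(1)] by linarith
      then show ?thesis by blast
    qed
    show "\<bar>support_fun f W - support_fun f S\<bar> \<le> e" if "norm f \<le> 1" for f
      using support_fun_hausdorff_dist[OF cwk_bounded[OF W] cwk_nonempty[OF W] cwk_bounded[OF Sc] cwk_nonempty[OF Sc], of f]
        unit[OF that dist_nonneg[OF W Sc]] S(2) by linarith
  qed
qed

text \<open>Two choices of tags agree off \<open>F\<close> and take, on each member in
  \<open>F\<close>, the point of larger and of smaller value. Both series have sums within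
  \<open>e\<close> of the integral, and their difference is the finite sum.\<close>

lemma birkhoff_partition_oscillation:
  assumes A: "countable_partition A" "\<And>n. \<exists>m. A n \<subseteq> B m" and F: "finite F" and f: "norm f \<le> 1"
    and xy: "\<And>n. n \<in> F \<Longrightarrow> x n \<in> A n" "\<And>n. n \<in> F \<Longrightarrow> y n \<in> A n"
  shows "(\<Sum>n\<in>F. measure lebesgue (A n) * \<bar>support_fun f (\<Gamma> (x n)) - support_fun f (\<Gamma> (y n))\<bar>) \<le> 2 * e"
proof -
  define h where "h t = support_fun f (\<Gamma> t)" for t
  have "\<forall>n. \<exists>s. A n \<noteq> {} \<longrightarrow> s \<in> A n" by blast
  then obtain t where t: "\<And>n. A n \<noteq> {} \<Longrightarrow> t n \<in> A n" by metis
  define u where "u n = (if n \<in> F then if h (y n) \<le> h (x n) then x n else y n else t n)" for n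
  define v where "v n = (if n \<in> F then if h (y n) \<le> h (x n) then y n else x n else t n)" for n
  have u: "A n \<noteq> {} \<Longrightarrow> u n \<in> A n" and v: "A n \<noteq> {} \<Longrightarrow> v n \<in> A n" for n
    using xy t by (auto simp: u_def v_def)
  obtain S where S: "(\<lambda>n. measure lebesgue (A n) * h (u n)) sums support_fun f S"
    "\<bar>support_fun f W - support_fun f S\<bar> \<le> e"
    using birkhoff_partition_sums[OF A u] f unfolding h_def by metis
  obtain T where T: "(\<lambda>n. measure lebesgue (A n) * h (v n)) sums support_fun f T"
    "\<bar>support_fun f W - support_fun f T\<bar> \<le> e"
    using birkhoff_partition_sums[OF A v] f unfolding h_def by metis
  have "(\<lambda>n. measure lebesgue (A n) * h (u n) - measure lebesgue (A n) * h (v n)) sums (support_fun f S - support_fun f T)"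
    by (rule sums_diff[OF S(1) T(1)])
  moreover have "(\<lambda>n. measure lebesgue (A n) * h (u n) - measure lebesgue (A n) * h (v n)) sums
      (\<Sum>n\<in>F. measure lebesgue (A n) * h (u n) - measure lebesgue (A n) * h (v n))"
    by (rule sums_finite[OF F]) (simp add: u_def v_def)
  ultimately have "(\<Sum>n\<in>F. measure lebesgue (A n) * h (u n) - measure lebesgue (A n) * h (v n)) = support_fun f S - support_fun f T"
    by (rule sums_unique2[symmetric])
  moreover have "(\<Sum>n\<in>F. measure lebesgue (A n) * \<bar>h (x n) - h (y n)\<bar>) =
      (\<Sum>n\<in>F. measure lebesgue (A n) * h (u n) - measure lebesgue (A n) * h (v n))"
    by (intro sum.cong refl) (auto simp: u_def v_def right_diff_distrib)
  ultimately show ?thesis using S(2) T(2) unfolding h_def by linarith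
qed

text \<open>
  If the tails over finite sets \<open>G k\<close> were large, one could rearrange the partition: the members
  with index in some \<open>G k\<close> keep their order on the even positions, whereas the others are moved to
  odd positions so late that infinitely many blocks of the rearranged series are sums over \<open>G k\<close>.
\<close>

lemma birkhoff_partition_tails:
  assumes A: "countable_partition A" "\<And>n. \<exists>m. A n \<subseteq> B m" and t: "\<And>n. A n \<noteq> {} \<Longrightarrow> t n \<in> A n" and \<eta>: "0 < \<eta>"
  shows "\<exists>N. \<forall>f G. norm f \<le> 1 \<longrightarrow> finite G \<longrightarrow> G \<subseteq> {N..} \<longrightarrow>
    \<bar>\<Sum>n\<in>G. measure lebesgue (A n) * support_fun f (\<Gamma> (t n))\<bar> \<le> \<eta>"
proof (rule ccontr)
  define a where "a f n = measure lebesgue (A n) * support_fun f (\<Gamma> (t n))" for f n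
  assume "\<not> ?thesis"
  then have "\<forall>N. \<exists>f G. norm f \<le> 1 \<and> finite G \<and> G \<subseteq> {N..} \<and> \<eta> < \<bar>\<Sum>n\<in>G. a f n\<bar>"
    unfolding a_def by (simp add: not_le)
  then obtain F G where FG: "\<And>N. norm (F N) \<le> 1" "\<And>N. finite (G N)" "\<And>N. G N \<subseteq> {N..}"
    "\<And>N. \<eta> < \<bar>\<Sum>n\<in>G N. a (F N) n\<bar>" by metis
  \<comment> \<open>The next boundary lies beyond \<open>2 * m\<close> and beyond all of
    \<open>G (2 * m)\<close>, so the chosen finite sets sit in disjoint blocks.\<close>
  define nxt where "nxt m = Suc (Max (insert (2 * m) (G (2 * m))))" for m
  define m where "m k = (nxt ^^ k) 0" for k
  have mS: "m (Suc k) = nxt (m k)" for k by (simp add: m_def)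
  have nxt: "2 * i < nxt i" "G (2 * i) \<subseteq> {2 * i..<nxt i}" for i
    using FG(2,3)[of "2 * i"] by (auto simp: nxt_def less_Suc_eq_le)
  have mono: "m i \<le> m j" if "i \<le> j" for i j
  proof (rule lift_Suc_mono_le[OF _ that])
    show "m k \<le> m (Suc k)" for k using nxt(1)[of "m k"] by (simp add: mS)
  qed
  have large: "k \<le> m k" for k
  proof (induction k)
    case (Suc k)
    then show ?case using nxt(1)[of "m k"] by (simp add: mS)
  qed simp
  define H where "H = (\<Union>k. G (2 * m k))"
  have Gk: "G (2 * m k) \<subseteq> {2 * m k..<m (Suc k)}" for k using nxt(2)[of "m k"] by (simp add: mS)
  have HG: "H \<inter> {2 * m k..<m (Suc k)} = G (2 * m k)" for k
  proof (intro equalityI subsetI)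
    fix n assume n: "n \<in> H \<inter> {2 * m k..<m (Suc k)}"
    then obtain j where j: "n \<in> G (2 * m j)" by (auto simp: H_def)
    have "j = k"
    proof (rule ccontr)
      assume "j \<noteq> k"
      then consider "Suc j \<le> k" | "Suc k \<le> j" by linarith
      then show False using Gk[of j] j n mono[of "Suc j" k] mono[of "Suc k" j] by cases auto
    qed
    then show "n \<in> G (2 * m k)" using j by simp
  qed (use Gk[of k] in \<open>auto simp: H_def\<close>)
  \<comment> \<open>\<open>d n\<close> is the first boundary beyond \<open>n\<close>.\<close>
  define d where "d n = m (LEAST k. n < m k)" for n
  have ex: "\<exists>k. n < m k" for n using large[of "Suc n"] by (intro exI[of _ "Suc n"]) simp
  have d1: "d n \<le> m k" if "n < m k" for n k
    unfolding d_def using that by (intro mono Least_le)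
  have d2: "m (Suc k) \<le> d n" if "m k \<le> n" for n k
  proof -
    have "n < m (LEAST k. n < m k)" by (rule LeastI_ex[OF ex])
    then have "\<not> (LEAST k. n < m k) \<le> k" using mono[of "LEAST k. n < m k" k] that by linarith
    then show ?thesis unfolding d_def by (intro mono) simp
  qed
  \<comment> \<open>Parity separates the two kinds of indices; the delay \<open>d n\<close> moves
    the unwanted ones out of all windows corresponding to blocks.\<close>
  define \<pi> where "\<pi> n = (if n \<in> H then 2 * n else 2 * (n + d n) + 1)" for n
  have dmono: "d i \<le> d j" if "i \<le> j" for i j
  proof -
    have "i < m (LEAST k. j < m k)" using LeastI_ex[OF ex[of j]] that by linarith
    then have "d i \<le> m (LEAST k. j < m k)" by (rule d1)
    then show ?thesis by (simp only: d_def[of j])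
  qed
  have inj: "inj \<pi>"
  proof (rule injI)
    fix i j assume eq: "\<pi> i = \<pi> j"
    have par: "even (\<pi> n) \<longleftrightarrow> n \<in> H" for n by (simp add: \<pi>_def)
    show "i = j"
    proof (cases "i \<in> H")
      case True
      then have "j \<in> H" using par eq by metis
      then show ?thesis using True eq by (simp add: \<pi>_def)
    next
      case False
      then have "j \<notin> H" using par eq by metis
      then have "i + d i = j + d j" using False eq by (simp add: \<pi>_def)
      then show ?thesis using dmono[of i j] dmono[of j i] by linarith
    qed
  qed
  define A' where "A' j = (if j \<in> range \<pi> then A (inv \<pi> j) else {})" for j
  define t' where "t' j = t (inv \<pi> j)" for j
  have A'\<pi>: "A' (\<pi> n) = A n" "t' (\<pi> n) = t n" for n by (simp_all add: A'_def t'_def inj)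
  have A'emp: "A' j = {}" if "j \<notin> range \<pi>" for j using that by (simp add: A'_def)
  have cp: "countable_partition A'"
    unfolding countable_partition_def
  proof (intro conjI allI)
    show "A' n \<in> sets (lebesgue_on {0..1})" for n
      using A(1) by (auto simp: A'_def countable_partition_def)
    show "disjoint_family A'"
      unfolding disjoint_family_on_def
    proof (intro ballI impI)
      fix i j :: nat assume ij: "i \<noteq> j"
      show "A' i \<inter> A' j = {}"
      proof (cases "i \<in> range \<pi> \<and> j \<in> range \<pi>")
        case True
        then obtain k l where "i = \<pi> k" "j = \<pi> l" "k \<noteq> l" using ij by blast
        then show ?thesis using A(1) by (simp add: A'\<pi> countable_partition_def disjoint_family_on_def)
      qed (use A'emp in blast)
    qed
    have "(\<Union>n. A' n) = (\<Union>n. A n)"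
    proof (intro equalityI subsetI)
      fix s assume "s \<in> (\<Union>n. A' n)"
      then obtain j where j: "s \<in> A' j" by blast
      then have "j \<in> range \<pi>" using A'emp by blast
      then show "s \<in> (\<Union>n. A n)" using j by (auto simp: A'\<pi>)
    next
      fix s assume "s \<in> (\<Union>n. A n)"
      then obtain n where "s \<in> A' (\<pi> n)" by (auto simp: A'\<pi>)
      then show "s \<in> (\<Union>n. A' n)" by blast
    qed
    then show "(\<Union>n. A' n) = {0..1}" using A(1) by (simp add: countable_partition_def)
  qed
  have finer: "\<exists>k. A' j \<subseteq> B k" for j using A(2) by (auto simp: A'_def)
  have t': "t' j \<in> A' j" if "A' j \<noteq> {}" for j
  proof -
    obtain n where "j = \<pi> n" using \<open>A' j \<noteq> {}\<close> A'emp by blast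
    then show ?thesis using that t by (simp add: A'\<pi>)
  qed
  define a' where "a' f j = measure lebesgue (A' j) * support_fun f (\<Gamma> (t' j))" for f j
  obtain S where "\<And>\<eta>. 0 < \<eta> \<Longrightarrow> \<exists>N. \<forall>n\<ge>N. \<forall>f. norm f \<le> 1 \<longrightarrow> \<bar>(\<Sum>k<n. a' f k) - support_fun f S\<bar> \<le> \<eta>"
    using birkhoff_partition_sums[OF cp finer t'] unfolding a'_def by metis
  from this[of "\<eta> / 2"] \<eta> obtain N where
    N: "\<And>n f. n \<ge> N \<Longrightarrow> norm f \<le> 1 \<Longrightarrow> \<bar>(\<Sum>k<n. a' f k) - support_fun f S\<bar> \<le> \<eta> / 2" by auto
  define k where "k = N"
  define f where "f = F (2 * m k)"
  \<comment> \<open>No odd position in the window is used: \<open>n < m k\<close> gives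
    \<open>n + d n < 2 * m k\<close>, whereas \<open>m k \<le> n\<close> gives
    \<open>m (Suc k) \<le> d n\<close>. Thus the difference of two late partial sums is the sum over
    \<open>G (2 * m k)\<close>, which exceeds \<open>\<eta>\<close>.\<close>
  have "(\<Sum>j\<in>{4 * m k..<2 * m (Suc k)}. a' f j) = (\<Sum>j\<in>(\<lambda>n. 2 * n) ` G (2 * m k). a' f j)"
  proof (rule sum.mono_neutral_right)
    show "(\<lambda>n. 2 * n) ` G (2 * m k) \<subseteq> {4 * m k..<2 * m (Suc k)}" using Gk[of k] by auto
    show "\<forall>j\<in>{4 * m k..<2 * m (Suc k)} - (\<lambda>n. 2 * n) ` G (2 * m k). a' f j = 0"
    proof
      fix j assume j: "j \<in> {4 * m k..<2 * m (Suc k)} - (\<lambda>n. 2 * n) ` G (2 * m k)"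
      have "j \<notin> range \<pi>"
      proof
        assume "j \<in> range \<pi>"
        then obtain n where n: "j = \<pi> n" by blast
        show False
        proof (cases "n \<in> H")
          case True
          then have "n \<in> H \<inter> {2 * m k..<m (Suc k)}" using n j by (auto simp: \<pi>_def)
          then show False unfolding HG using True n j by (auto simp: \<pi>_def)
        next
          case False
          then have "j = 2 * (n + d n) + 1" using n by (simp add: \<pi>_def)
          then have "2 * m k \<le> n + d n" "n + d n < m (Suc k)" using j by auto
          then show False using d1[of n k] d2[of k n] by (cases "n < m k") auto
        qed
      qed
      then show "a' f j = 0" by (simp add: a'_def A'emp)
    qed
  qed simp
  also have "\<dots> = (\<Sum>n\<in>G (2 * m k). a' f (2 * n))"
    by (subst sum.reindex) (auto simp: inj_on_def)
  also have "\<dots> = (\<Sum>n\<in>G (2 * m k). a f n)"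
  proof (rule sum.cong[OF refl])
    fix n assume "n \<in> G (2 * m k)"
    then have "\<pi> n = 2 * n" by (auto simp: \<pi>_def H_def)
    then show "a' f (2 * n) = a f n" using A'\<pi>[of n] by (simp add: a'_def a_def)
  qed
  finally have "\<eta> < \<bar>\<Sum>j\<in>{4 * m k..<2 * m (Suc k)}. a' f j\<bar>" using FG(4)[of "2 * m k"] by (simp add: f_def)
  moreover have "4 * m k \<le> 2 * m (Suc k)" using nxt(1)[of "m k"] by (simp add: mS)
  then have "(\<Sum>j\<in>{4 * m k..<2 * m (Suc k)}. a' f j) = (\<Sum>j<2 * m (Suc k). a' f j) - (\<Sum>j<4 * m k. a' f j)"
    using sum_diff_nat_ivl[of 0 "4 * m k" "2 * m (Suc k)" "a' f"] by (simp add: atLeast0LessThan)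
  moreover have "N \<le> 4 * m k" using large[of k] by (simp add: k_def)
  then have "\<bar>(\<Sum>j<2 * m (Suc k). a' f j) - support_fun f S\<bar> \<le> \<eta> / 2"
    "\<bar>(\<Sum>j<4 * m k. a' f j) - support_fun f S\<bar> \<le> \<eta> / 2"
    using \<open>4 * m k \<le> 2 * m (Suc k)\<close> FG(1) by (intro N; simp add: f_def)+
  ultimately show False by linarith
qed

end

lemma support_fun_uniformly_bounded:
  assumes "C \<in> cwk"
  obtains M where "0 \<le> M" "\<And>f. norm f \<le> 1 \<Longrightarrow> \<bar>support_fun f C\<bar> \<le> M"
proof -
  obtain M where M: "0 < M" "\<And>x. x \<in> C \<Longrightarrow> norm x \<le> M"
    using cwk_bounded[OF assms] by (meson bounded_pos)
  have "\<bar>support_fun f C\<bar> \<le> M" if "norm f \<le> 1" for f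
    using support_fun_le_norm[OF cwk_nonempty[OF assms] M(2), of f]
      mult_right_mono[OF that less_imp_le[OF M(1)]] by linarith
  then show thesis using that[of M] M(1) by simp
qed

text \<open>
  A multifunction with small sums of oscillations is bounded on the members of positive measure;
  the null members are cut according to the size of the values.
\<close>

lemma birkhoff_bounded_partition:
  fixes \<Gamma> :: "real \<Rightarrow> 'a::real_normed_vector set"
  assumes \<Gamma>: "\<forall>t\<in>{0..1}. \<Gamma> t \<in> cwk" and W: "W \<in> cwk" "is_birkhoff_integral \<Gamma> W" and e: "0 < e"
  obtains B where "birkhoff_partition \<Gamma> W e B"
    "\<And>n. \<exists>M\<ge>0. \<forall>t\<in>B n. \<forall>f. norm f \<le> 1 \<longrightarrow> \<bar>support_fun f (\<Gamma> t)\<bar> \<le> M"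
proof -
  obtain B0 where B0: "birkhoff_partition \<Gamma> W e B0" using birkhoff_partition_exists[OF W(2) e] by blast
  then have cp: "countable_partition B0" by (simp add: birkhoff_partition_def)
  then have B0L: "B0 n \<in> sets lebesgue" "B0 n \<subseteq> {0..1}" for n
    by (auto simp: countable_partition_def sets_unit_iff)
  define lev where "lev t = (LEAST k :: nat. \<forall>x\<in>\<Gamma> t. norm x \<le> real k)" for t
  have lev: "norm x \<le> real (lev t)" if t: "t \<in> {0..1}" and x: "x \<in> \<Gamma> t" for t x
  proof -
    obtain M where M: "\<And>x. x \<in> \<Gamma> t \<Longrightarrow> norm x \<le> M"
      using cwk_bounded[of "\<Gamma> t"] \<Gamma> t by (auto simp: bounded_iff)
    have "\<forall>x\<in>\<Gamma> t. norm x \<le> real (nat \<lceil>M\<rceil>)" using M real_nat_ceiling_ge[of M] order_trans by blast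
    then have "\<forall>x\<in>\<Gamma> t. norm x \<le> real (lev t)" unfolding lev_def by (rule LeastI)
    then show ?thesis using x by blast
  qed
  \<comment> \<open>Null members are split by \<open>lev\<close>; the pieces are measurable because
    all subsets of a null set are Lebesgue measurable.\<close>
  define B' where "B' = (\<lambda>(n, m). if measure lebesgue (B0 n) = 0 then {t \<in> B0 n. lev t = m}
    else if m = 0 then B0 n else {})"
  define B where "B k = B' (prod_decode k)" for k
  define idx where "idx n t = (n, if measure lebesgue (B0 n) = 0 then lev t else 0)" for n t
  have mem: "t \<in> B' p \<longleftrightarrow> t \<in> B0 (fst p) \<and> p = idx (fst p) t" for t p
    by (cases p) (auto simp: B'_def idx_def)
  have dj: "m = n" if "t \<in> B0 m" "t \<in> B0 n" for t m n
    using that cp by (auto simp: countable_partition_def disjoint_family_on_def)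
  have cpB: "countable_partition B"
    unfolding countable_partition_def sets_unit_iff
  proof (intro conjI allI)
    fix k
    obtain n m where nm: "prod_decode k = (n, m)" by (metis surj_pair)
    show "B k \<subseteq> {0..1}" using B0L(2)[of n] mem[of _ "(n, m)"] by (auto simp: B_def nm)
    show "B k \<in> sets lebesgue"
    proof (cases "measure lebesgue (B0 n) = 0")
      case True
      then have "negligible (B0 n)" using unit_lmeasurable[OF B0L] by (simp add: negligible_iff_measure)
      then have "negligible (B k)" by (rule negligible_subset) (auto simp: B_def nm B'_def True)
      then show ?thesis by (rule negligible_imp_sets)
    qed (use B0L in \<open>auto simp: B_def nm B'_def\<close>)
  next
    show "disjoint_family B"
      unfolding disjoint_family_on_def
    proof (intro ballI impI)
      fix j k :: nat assume jk: "j \<noteq> k"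
      have "prod_decode j = prod_decode k" if "t \<in> B j" "t \<in> B k" for t
        using that dj unfolding B_def mem by metis
      then show "B j \<inter> B k = {}" using jk by (auto simp: prod_decode_eq)
    qed
    show "(\<Union>k. B k) = {0..1}"
    proof (intro equalityI subsetI)
      fix t :: real assume "t \<in> {0..1}"
      moreover have "(\<Union>n. B0 n) = {0..1}" using cp by (simp add: countable_partition_def)
      ultimately obtain n where "t \<in> B0 n" by blast
      then have "t \<in> B (prod_encode (idx n t))" by (simp add: B_def mem idx_def)
      then show "t \<in> (\<Union>k. B k)" by blast
    next
      fix t assume "t \<in> (\<Union>k. B k)"
      then obtain k where "t \<in> B0 (fst (prod_decode k))" by (auto simp: B_def mem)
      then show "t \<in> {0..1}" using B0L(2) by blast
    qed
  qed
  have sub: "B k \<subseteq> B0 (fst (prod_decode k))" for k unfolding B_def using mem by blast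
  have "birkhoff_partition \<Gamma> W e B"
    unfolding birkhoff_partition_def
  proof (intro conjI allI impI cpB)
    fix A t assume A: "countable_partition A" "\<forall>n. \<exists>m. A n \<subseteq> B m" "\<forall>n. A n \<noteq> {} \<longrightarrow> t n \<in> A n"
    have "\<forall>n. \<exists>m. A n \<subseteq> B0 m" using A(2) sub by (meson order_trans)
    then show "\<exists>S. set_sums (birkhoff_term \<Gamma> A t) S \<and> hausdorff_dist W S < e"
      using B0 A(1,3) unfolding birkhoff_partition_def by blast
  qed
  moreover have "\<exists>M\<ge>0. \<forall>t\<in>B k. \<forall>f. norm f \<le> 1 \<longrightarrow> \<bar>support_fun f (\<Gamma> t)\<bar> \<le> M" for k
  proof -
    obtain n m where nm: "prod_decode k = (n, m)" by (metis surj_pair)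
    show ?thesis
    proof (cases "measure lebesgue (B0 n) = 0")
      case True
      have "\<bar>support_fun f (\<Gamma> t)\<bar> \<le> real m" if t: "t \<in> B k" and f: "norm f \<le> 1" for t f
      proof -
        have t': "t \<in> {0..1}" "lev t = m" using t B0L(2)[of n] by (auto simp: B_def nm B'_def True)
        have "\<bar>support_fun f (\<Gamma> t)\<bar> \<le> norm f * real m"
          using lev[OF t'(1)] t' \<Gamma> by (intro support_fun_le_norm cwk_nonempty) auto
        also have "\<dots> \<le> real m" using mult_right_mono[OF f, of "real m"] by simp
        finally show ?thesis .
      qed
      then show ?thesis by (intro exI[of _ "real m"]) auto
    next
      case False
      then have pos: "0 < measure lebesgue (B0 n)" using measure_nonneg[of lebesgue "B0 n"] by linarith
      then have "B0 n \<noteq> {}" by auto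
      then obtain y where y: "y \<in> B0 n" by blast
      then have "\<Gamma> y \<in> cwk" using \<Gamma> B0L(2) by blast
      then obtain M where M: "0 \<le> M" "\<And>f. norm f \<le> 1 \<Longrightarrow> \<bar>support_fun f (\<Gamma> y)\<bar> \<le> M"
        using support_fun_uniformly_bounded by blast
      \<comment> \<open>The oscillation estimate for a single member compares every value with the
        one at the fixed point \<open>y\<close>.\<close>
      have "\<bar>support_fun f (\<Gamma> t)\<bar> \<le> M + 2 * e / measure lebesgue (B0 n)" if t: "t \<in> B k" and f: "norm f \<le> 1" for t f
      proof -
        have tB: "t \<in> B0 n" using t sub[of k] nm by auto
        have "(\<Sum>i\<in>{n}. measure lebesgue (B0 i) * \<bar>support_fun f (\<Gamma> t) - support_fun f (\<Gamma> y)\<bar>) \<le> 2 * e"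
          by (rule birkhoff_partition_oscillation[OF \<Gamma> W(1) B0 cp _ _ f]) (use tB y in auto)
        then have "\<bar>support_fun f (\<Gamma> t) - support_fun f (\<Gamma> y)\<bar> \<le> 2 * e / measure lebesgue (B0 n)"
          using pos by (simp add: field_simps)
        then show ?thesis using M(2)[OF f] by linarith
      qed
      then show ?thesis using M(1) e pos by (intro exI[of _ "M + 2 * e / measure lebesgue (B0 n)"]) auto
    qed
  qed
  ultimately show thesis by (rule that)
qed

text \<open>Nonoverlapping intervals meet in sets with empty interior, which are negligible in the
  line, so measures add although the sets are not disjoint.\<close>

lemma free_partition_measure:
  assumes p: "free_tagged_partition p" and q: "q \<subseteq> p" and E: "\<And>w. w \<in> q \<Longrightarrow> E w \<in> sets lebesgue" "\<And>w. w \<in> q \<Longrightarrow> E w \<subseteq> snd w"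
  shows "(\<Sum>w\<in>q. measure lebesgue (E w)) = measure lebesgue (\<Union>w\<in>q. E w)"
proof (rule measure_negligible_finite_Union_image[symmetric])
  have iv: "\<exists>a b. snd w = {a..b}" "snd w \<subseteq> {0..1}" if "w \<in> p" for w
    using p that by (auto simp: free_tagged_partition_def)
  show "finite q" using p q by (auto simp: free_tagged_partition_def intro: finite_subset)
  show "E w \<in> lmeasurable" if "w \<in> q" for w
    using E[OF that] iv(2)[of w] that q by (intro unit_lmeasurable) auto
  show "pairwise (\<lambda>x y. negligible (E x \<inter> E y)) q"
  proof (rule pairwiseI)
    fix x y assume xy: "x \<in> q" "y \<in> q" "x \<noteq> y"
    obtain a b c d where ab: "snd x = {a..b}" "snd y = {c..d}" using iv(1) xy q by (metis subsetD)
    have "interior (snd x) \<inter> interior (snd y) = {}"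
      using p xy q unfolding free_tagged_partition_def by blast
    then have "interior ({a..b} \<inter> {c..d}) = {}" by (simp add: ab)
    then have "negligible ({a..b} \<inter> {c..d})"
      by (intro negligible_convex_interior[THEN iffD2]) (auto simp: convex_Int)
    then show "negligible (E x \<inter> E y)"
      by (rule negligible_subset) (use E(2)[OF xy(1)] E(2)[OF xy(2)] ab in blast)
  qed
qed

text \<open>The gauge at \<open>t\<close> is the distance to the complement of an open neighbourhood
  of the member containing \<open>t\<close>. It is measurable as a countable gluing of continuous
  functions along the measurable sets \<open>B n\<close>.\<close>

lemma partition_gauge_exists:
  assumes B: "countable_partition B" and \<eta>': "\<forall>n. 0 < \<eta> n"
  obtains G \<delta> where "\<And>n. G n \<in> sets lebesgue" "\<And>n. B n \<subseteq> G n" "\<And>n. G n - B n \<in> lmeasurable"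
    "\<And>n. measure lebesgue (G n - B n) \<le> \<eta> n" "\<And>n t. t \<in> B n \<Longrightarrow> 0 < \<delta> t"
    "\<And>n t. t \<in> B n \<Longrightarrow> ball t (\<delta> t) \<subseteq> G n" "\<delta> \<in> borel_measurable (lebesgue_on {0..1})"
proof -
  have \<eta>: "0 < \<eta> n" for n using \<eta>' by simp
  have BL: "B n \<in> sets lebesgue" "B n \<subseteq> {0..1}" for n using B by (auto simp: countable_partition_def sets_unit_iff)
  have "\<exists>T. open T \<and> B n \<subseteq> T \<and> T - B n \<in> lmeasurable \<and> measure lebesgue (T - B n) \<le> \<eta> n" for n
  proof -
    obtain T where T: "open T" "B n \<subseteq> T" "T - B n \<in> lmeasurable" "emeasure lebesgue (T - B n) < ennreal (\<eta> n)"
      using sets_lebesgue_outer_open[OF BL(1) \<eta>] by blast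
    have "ennreal (measure lebesgue (T - B n)) < ennreal (\<eta> n)"
      using T(4) emeasure_eq_measure2[OF T(3)] by simp
    then have "measure lebesgue (T - B n) < \<eta> n" using \<eta>[of n] by (simp add: ennreal_less_iff)
    then show ?thesis using T by (intro exI[of _ T]) auto
  qed
  then obtain T where T: "\<And>n. open (T n)" "\<And>n. B n \<subseteq> T n" "\<And>n. T n - B n \<in> lmeasurable"
    "\<And>n. measure lebesgue (T n - B n) \<le> \<eta> n" by metis
  \<comment> \<open>The bounded interval keeps the complement nonempty; \<open>infdist\<close> to
    the empty set would be 0 and give no gauge.\<close>
  define G where "G n = T n \<inter> {-1<..<2}" for n
  have G: "open (G n)" "B n \<subseteq> G n" for n using T(1,2) BL(2)[of n] by (auto simp: G_def)
  have GL: "G n \<in> sets lebesgue" for n using G(1) by auto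
  have GB: "G n - B n \<in> lmeasurable" for n
    by (rule fmeasurableI2[OF T(3)[of n]]) (use GL BL(1) in \<open>auto simp: G_def\<close>)
  have "measure lebesgue (G n - B n) \<le> measure lebesgue (T n - B n)" for n
    by (rule measure_mono_fmeasurable) (use GL BL(1) T(3) in \<open>auto simp: G_def\<close>)
  then have m: "measure lebesgue (G n - B n) \<le> \<eta> n" for n using T(4)[of n] order_trans by blast
  have ne: "- G n \<noteq> {}" for n by (auto simp: G_def intro!: exI[of _ 5])
  define idx where "idx t = (THE n. t \<in> B n)" for t
  have idx: "idx t = n" if "t \<in> B n" for t n
    unfolding idx_def using that B by (intro the_equality) (auto simp: countable_partition_def disjoint_family_on_def)
  define \<delta> where "\<delta> t = infdist t (- G (idx t))" for t
  show thesis
  proof (rule that[OF GL G(2) GB m])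
    show "0 < \<delta> t" if "t \<in> B n" for n t
    proof -
      have "t \<notin> - G n" "closed (- G n)" using G that by auto
      then have "infdist t (- G n) \<noteq> 0" using ne in_closed_iff_infdist_zero by blast
      then show ?thesis using infdist_nonneg[of t "- G n"] by (simp add: \<delta>_def idx[OF that])
    qed
    show "ball t (\<delta> t) \<subseteq> G n" if "t \<in> B n" for n t
    proof
      fix y assume "y \<in> ball t (\<delta> t)"
      then have "dist t y < infdist t (- G n)" by (simp add: \<delta>_def idx[OF that])
      then show "y \<in> G n" using infdist_le[of y "- G n" t] by fastforce
    qed
    show "\<delta> \<in> borel_measurable (lebesgue_on {0..1})"
      unfolding \<delta>_def
    proof (rule measurable_compose_countable[where f = "\<lambda>n t. infdist t (- G n)" and g = idx])
      show "(\<lambda>t. infdist t (- G n)) \<in> borel_measurable (lebesgue_on {0..1})" for n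
        by (intro borel_measurable_continuous_onI continuous_intros measurable_restrict_space1 measurable_completion
            | simp add: borel_measurable_continuous_onI continuous_intros)+
      show "idx \<in> measurable (lebesgue_on {0..1}) (count_space UNIV)"
      proof (subst measurable_count_space_eq2_countable, safe)
        fix n
        have "idx -` {n} \<inter> space (lebesgue_on {0..1}) = B n"
        proof (intro equalityI subsetI)
          fix t assume t: "t \<in> idx -` {n} \<inter> space (lebesgue_on {0..1})"
          moreover have "(\<Union>n. B n) = {0..1}" using B by (simp add: countable_partition_def)
          ultimately have "t \<in> (\<Union>n. B n)" by auto
          then obtain k where "t \<in> B k" by blast
          then show "t \<in> B n" using idx t by auto
        next
          fix t assume t: "t \<in> B n"
          then have "t \<in> {0..1}" using BL(2) by blast
          then show "t \<in> idx -` {n} \<inter> space (lebesgue_on {0..1})" using idx[OF t] by simp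
        qed
        then show "idx -` {n} \<inter> space (lebesgue_on {0..1}) \<in> sets (lebesgue_on {0..1})"
          using B by (simp add: countable_partition_def)
      qed auto
    qed
  qed
qed

text \<open>The constant 7 collects four errors: \<open>e\<close> for the parts of intervals outside
  the member of their tag, \<open>2 * e\<close> for moving all tags in a member to one point,
  \<open>3 * e\<close> for completing the covered parts of members to whole members, and
  \<open>e\<close> for the Birkhoff sum itself.\<close>

lemma birkhoff_imp_free_gauge:
  fixes \<Gamma> :: "real \<Rightarrow> 'a::real_normed_vector set"
  assumes \<Gamma>: "\<forall>t\<in>{0..1}. \<Gamma> t \<in> cwk" and W: "W \<in> cwk" "is_birkhoff_integral \<Gamma> W" and e: "0 < e"
  shows "\<exists>\<delta>. free_gauge \<Gamma> W (7 * e) \<delta> \<and> \<delta> \<in> borel_measurable (lebesgue_on {0..1})"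
proof -
  obtain B where B: "birkhoff_partition \<Gamma> W e B"
    and bd: "\<And>n. \<exists>M\<ge>0. \<forall>t\<in>B n. \<forall>f. norm f \<le> 1 \<longrightarrow> \<bar>support_fun f (\<Gamma> t)\<bar> \<le> M"
    using birkhoff_bounded_partition[OF \<Gamma> W e] by blast
  have "\<exists>M. 0 \<le> M \<and> (\<forall>t\<in>B n. \<forall>f. norm f \<le> 1 \<longrightarrow> \<bar>support_fun f (\<Gamma> t)\<bar> \<le> M)" for n using bd by blast
  then obtain M where M: "\<And>n. 0 \<le> M n" "\<And>n t f. t \<in> B n \<Longrightarrow> norm f \<le> 1 \<Longrightarrow> \<bar>support_fun f (\<Gamma> t)\<bar> \<le> M n" by metis
  have cp: "countable_partition B" using B by (simp add: birkhoff_partition_def)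
  have BL: "B n \<in> sets lebesgue" "B n \<subseteq> {0..1}" for n using cp by (auto simp: countable_partition_def sets_unit_iff)
  have UB: "(\<Union>n. B n) = {0..1}" and dB: "disjoint_family B" using cp by (auto simp: countable_partition_def)
  have Bm: "B n \<in> lmeasurable" for n by (rule unit_lmeasurable[OF BL])
  have fn: "\<exists>m. B n \<subseteq> B m" for n by blast
  have "\<forall>n. \<exists>x. B n \<noteq> {} \<longrightarrow> x \<in> B n" by blast
  then obtain s where s: "\<And>n. B n \<noteq> {} \<Longrightarrow> s n \<in> B n" by metis
  obtain S where S: "\<And>f. (\<lambda>n. measure lebesgue (B n) * support_fun f (\<Gamma> (s n))) sums support_fun f S"
    "\<And>f. norm f \<le> 1 \<Longrightarrow> \<bar>support_fun f W - support_fun f S\<bar> \<le> e"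
    using birkhoff_partition_sums[OF \<Gamma> W(1) B cp fn s] by metis
  obtain N where N: "\<And>f G. norm f \<le> 1 \<Longrightarrow> finite G \<Longrightarrow> G \<subseteq> {N..} \<Longrightarrow>
      \<bar>\<Sum>n\<in>G. measure lebesgue (B n) * support_fun f (\<Gamma> (s n))\<bar> \<le> e"
    using birkhoff_partition_tails[OF \<Gamma> W(1) B cp fn s e] by metis
  \<comment> \<open>A common bound for the values on the first \<open>N\<close> members, beyond
    which the tail estimate takes over.\<close>
  define Ms where "Ms = (\<Sum>n<N. M n)"
  have Ms: "0 \<le> Ms" "M n \<le> Ms" if "n < N" for n
    unfolding Ms_def using M(1) that by (auto intro: sum_nonneg member_le_sum)
  have Ms0: "0 \<le> Ms" unfolding Ms_def using M(1) by (simp add: sum_nonneg)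
  \<comment> \<open>The denominator pays for the values on the member itself, \<open>M n\<close>,
    and for the uncovered mass of the first \<open>N\<close> members, \<open>Ms\<close>; the
    geometric weights sum to at most \<open>e\<close>.\<close>
  define \<eta> where "\<eta> n = e * (1 / 2) ^ Suc n / (1 + M n + Ms)" for n
  have den: "0 < 1 + M n + Ms" for n using M(1)[of n] Ms0 by linarith
  have \<eta>: "0 < \<eta> n" for n unfolding \<eta>_def using e den by (intro divide_pos_pos mult_pos_pos) auto
  have \<eta>M: "\<eta> n * M n \<le> e * (1 / 2) ^ Suc n" "Ms * \<eta> n \<le> e * (1 / 2) ^ Suc n" for n
  proof -
    have E: "0 \<le> e * (1 / 2) ^ Suc n" using e by simp
    have "\<eta> n * M n = (e * (1 / 2) ^ Suc n) * (M n / (1 + M n + Ms))" by (simp add: \<eta>_def)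
    also have "\<dots> \<le> (e * (1 / 2) ^ Suc n) * 1" using den[of n] M(1)[of n] Ms0 by (intro mult_left_mono E) (simp add: field_simps)
    finally show "\<eta> n * M n \<le> e * (1 / 2) ^ Suc n" by simp
    have "Ms * \<eta> n = (e * (1 / 2) ^ Suc n) * (Ms / (1 + M n + Ms))" by (simp add: \<eta>_def)
    also have "\<dots> \<le> (e * (1 / 2) ^ Suc n) * 1" using den[of n] M(1)[of n] Ms0 by (intro mult_left_mono E) (simp add: field_simps)
    finally show "Ms * \<eta> n \<le> e * (1 / 2) ^ Suc n" by simp
  qed
  obtain G \<delta> where G: "\<And>n. G n \<in> sets lebesgue" "\<And>n. B n \<subseteq> G n" "\<And>n. G n - B n \<in> lmeasurable"
    "\<And>n. measure lebesgue (G n - B n) \<le> \<eta> n" and \<delta>: "\<And>n t. t \<in> B n \<Longrightarrow> 0 < \<delta> t"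
    "\<And>n t. t \<in> B n \<Longrightarrow> ball t (\<delta> t) \<subseteq> G n" "\<delta> \<in> borel_measurable (lebesgue_on {0..1})"
    by (rule partition_gauge_exists[OF cp allI[OF \<eta>]]) (rule that)
  have "free_gauge \<Gamma> W (7 * e) \<delta>"
    unfolding adapted_gauge_def
  proof (intro conjI ballI allI impI)
    fix t :: real assume "t \<in> {0..1}"
    then obtain n where "t \<in> B n" using UB by blast
    then show "0 < \<delta> t" by (rule \<delta>(1))
  next
    fix p and f :: "'a \<Rightarrow>\<^sub>L real"
    assume p: "free_tagged_partition p" and fine: "(\<lambda>t. ball t (\<delta> t)) fine p" and f: "norm f \<le> 1"
    define h where "h t = support_fun f (\<Gamma> t)" for t
    have fin: "finite p" using p by (simp add: free_tagged_partition_def)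
    have pw: "fst w \<in> {0..1}" "\<exists>a b. snd w = {a..b}" "snd w \<subseteq> {0..1}" if "w \<in> p" for w
      using p that by (auto simp: free_tagged_partition_def)
    have sL: "snd w \<in> sets lebesgue" if "w \<in> p" for w using pw(2)[OF that] by auto
    have "\<forall>w. \<exists>n. w \<in> p \<longrightarrow> fst w \<in> B n" using pw(1) UB by blast
    then obtain r where r: "\<And>w. w \<in> p \<Longrightarrow> fst w \<in> B (r w)" by metis
    define c where "c w = measure lebesgue (snd w \<inter> B (r w))" for w
    define d where "d w = measure lebesgue (snd w - B (r w))" for w
    have c0: "0 \<le> c w" and d0: "0 \<le> d w" for w by (simp_all add: c_def d_def)
    have cd: "measure lborel (snd w) = c w + d w" if "w \<in> p" for w
    proof -
      have L: "snd w \<in> lmeasurable" using unit_lmeasurable[OF sL[OF that] pw(3)[OF that]] .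
      have L1: "snd w \<inter> B (r w) \<in> lmeasurable" using L Bm by (rule fmeasurable.Int)
      have L2: "snd w - B (r w) \<in> lmeasurable" using L BL(1) by (rule fmeasurable_Diff)
      have "measure lebesgue ((snd w \<inter> B (r w)) \<union> (snd w - B (r w))) = c w + d w"
        unfolding c_def d_def
      proof (rule measure_Union)
        show "emeasure lebesgue (snd w \<inter> B (r w)) \<noteq> \<infinity>" unfolding infinity_ennreal_def by (rule fmeasurableD2[OF L1])
        show "emeasure lebesgue (snd w - B (r w)) \<noteq> \<infinity>" unfolding infinity_ennreal_def by (rule fmeasurableD2[OF L2])
      qed (use L1 L2 in \<open>auto dest: fmeasurableD\<close>)
      moreover have "(snd w \<inter> B (r w)) \<union> (snd w - B (r w)) = snd w" by blast
      moreover have "measure lborel (snd w) = measure lebesgue (snd w)" using pw(2)[OF that] by auto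
      ultimately show ?thesis by simp
    qed
    define F where "F = r ` p"
    have finF: "finite F" using fin by (simp add: F_def)
    define P where "P n = {w \<in> p. r w = n}" for n
    have Pp: "P n \<subseteq> p" for n by (auto simp: P_def)
    define a where "a n = (\<Sum>w\<in>P n. c w)" for n
    \<comment> \<open>Fineness keeps each interval inside the open neighbourhood of the member of
      its tag, so the parts \<open>d\<close> lie in \<open>G n - B n\<close>.\<close>
    have dn: "(\<Sum>w\<in>P n. d w) \<le> \<eta> n" for n
    proof -
      have "(\<Sum>w\<in>P n. d w) = measure lebesgue (\<Union>w\<in>P n. snd w - B (r w))"
        unfolding d_def using sL BL by (intro free_partition_measure[OF p Pp]) (auto simp: P_def)
      also have "\<dots> \<le> measure lebesgue (G n - B n)"
      proof (rule measure_mono_fmeasurable[OF _ _ G(3)])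
        show "(\<Union>w\<in>P n. snd w - B (r w)) \<subseteq> G n - B n"
        proof
          fix x assume "x \<in> (\<Union>w\<in>P n. snd w - B (r w))"
          then obtain w where w: "w \<in> p" "r w = n" "x \<in> snd w" "x \<notin> B n" by (auto simp: P_def)
          have "snd w \<subseteq> ball (fst w) (\<delta> (fst w))" using fineD[OF fine, of "fst w" "snd w"] w(1) by simp
          then show "x \<in> G n - B n" using \<delta>(2)[OF r[OF w(1)]] w by auto
        qed
        show "(\<Union>w\<in>P n. snd w - B (r w)) \<in> sets lebesgue"
          using fin sL BL Pp by (intro sets.finite_UN) (auto simp: P_def)
      qed
      also have "\<dots> \<le> \<eta> n" by (rule G(4))
      finally show ?thesis .
    qed
    have an: "a n \<le> measure lebesgue (B n)" for n
    proof -
      have "a n = measure lebesgue (\<Union>w\<in>P n. snd w \<inter> B (r w))"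
        unfolding a_def c_def using sL BL by (intro free_partition_measure[OF p Pp]) (auto simp: P_def)
      also have "\<dots> \<le> measure lebesgue (B n)"
      proof (rule measure_mono_fmeasurable[OF _ _ Bm])
        show "(\<Union>w\<in>P n. snd w \<inter> B (r w)) \<in> sets lebesgue"
          using fin sL BL Pp by (intro sets.finite_UN) (auto simp: P_def)
      qed (auto simp: P_def)
      finally show ?thesis .
    qed
    have a0: "0 \<le> a n" for n unfolding a_def using c0 by (intro sum_nonneg) auto
    have aF: "a n = 0" if "n \<notin> F" for n using that by (auto simp: a_def P_def F_def intro!: sum.neutral)
    have grp: "(\<Sum>w\<in>p. g w) = (\<Sum>n\<in>F. \<Sum>w\<in>P n. g w)" for g :: "_ \<Rightarrow> real"
      unfolding F_def P_def by (rule sum.image_gen[OF fin])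
    have geo: "(\<Sum>n\<in>F. e * (1 / 2) ^ Suc n) \<le> e"
      using sum_geometric_tail_le[OF finF, of 0 e] e by simp
    have dtot: "Ms * (\<Sum>w\<in>p. d w) \<le> e"
    proof -
      have "Ms * (\<Sum>w\<in>p. d w) = (\<Sum>n\<in>F. Ms * (\<Sum>w\<in>P n. d w))" unfolding grp by (simp add: sum_distrib_left)
      also have "\<dots> \<le> (\<Sum>n\<in>F. e * (1 / 2) ^ Suc n)"
      proof (rule sum_mono)
        fix n
        show "Ms * (\<Sum>w\<in>P n. d w) \<le> e * (1 / 2) ^ Suc n"
          using mult_left_mono[OF dn[of n] Ms0] \<eta>M(2)[of n] by linarith
      qed
      finally show ?thesis using geo by linarith
    qed
    have i: "\<bar>\<Sum>w\<in>p. d w * h (fst w)\<bar> \<le> e"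
    proof -
      have "\<bar>\<Sum>w\<in>p. d w * h (fst w)\<bar> \<le> (\<Sum>w\<in>p. d w * M (r w))"
      proof (rule order_trans[OF sum_abs sum_mono])
        fix w assume "w \<in> p"
        then show "\<bar>d w * h (fst w)\<bar> \<le> d w * M (r w)"
          using M(2)[OF r f] d0[of w] by (simp add: abs_mult h_def mult_left_mono)
      qed
      also have "\<dots> = (\<Sum>n\<in>F. (\<Sum>w\<in>P n. d w) * M n)"
        unfolding grp sum_distrib_right by (intro sum.cong refl) (auto simp: P_def)
      also have "\<dots> \<le> (\<Sum>n\<in>F. e * (1 / 2) ^ Suc n)"
      proof (rule sum_mono)
        fix n
        show "(\<Sum>w\<in>P n. d w) * M n \<le> e * (1 / 2) ^ Suc n"
          using mult_right_mono[OF dn[of n] M(1)[of n]] \<eta>M(1)[of n] by linarith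
      qed
      finally show ?thesis using geo by linarith
    qed
    have ii: "\<bar>\<Sum>w\<in>p. c w * (h (fst w) - h (s (r w)))\<bar> \<le> 2 * e"
    proof -
      \<comment> \<open>Several intervals may have tags in one member; the tag of largest deviation
        stands for all of them, as the oscillation estimate admits one pair per member.\<close>
      have ex: "\<exists>x. x \<in> B n \<and> (\<forall>w\<in>P n. \<bar>h (fst w) - h (s n)\<bar> \<le> \<bar>h x - h (s n)\<bar>)" if "n \<in> F" for n
      proof -
        have "finite (P n)" "P n \<noteq> {}" using fin Pp finite_subset that by (auto simp: P_def F_def)
        then obtain w where w: "w \<in> P n" "\<And>v. v \<in> P n \<Longrightarrow> \<bar>h (fst v) - h (s n)\<bar> \<le> \<bar>h (fst w) - h (s n)\<bar>"
          using obtains_MAX[of "P n" "\<lambda>v. \<bar>h (fst v) - h (s n)\<bar>"] Max_ge[of "(\<lambda>v. \<bar>h (fst v) - h (s n)\<bar>) ` P n"]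
          by (metis finite_imageI imageI)
        have "fst w \<in> B n" using r[of w] w(1) by (auto simp: P_def)
        then show ?thesis using w(2) by blast
      qed
      then obtain x where x: "\<And>n. n \<in> F \<Longrightarrow> x n \<in> B n"
        "\<And>n w. n \<in> F \<Longrightarrow> w \<in> P n \<Longrightarrow> \<bar>h (fst w) - h (s n)\<bar> \<le> \<bar>h (x n) - h (s n)\<bar>" by metis
      have "\<bar>\<Sum>w\<in>p. c w * (h (fst w) - h (s (r w)))\<bar> \<le> (\<Sum>w\<in>p. c w * \<bar>h (fst w) - h (s (r w))\<bar>)"
        by (rule order_trans[OF sum_abs]) (simp add: abs_mult c0)
      also have "\<dots> = (\<Sum>n\<in>F. \<Sum>w\<in>P n. c w * \<bar>h (fst w) - h (s n)\<bar>)"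
        unfolding grp by (intro sum.cong refl) (auto simp: P_def)
      also have "\<dots> \<le> (\<Sum>n\<in>F. \<Sum>w\<in>P n. c w * \<bar>h (x n) - h (s n)\<bar>)"
        using x(2) c0 by (intro sum_mono mult_left_mono) auto
      also have "\<dots> \<le> (\<Sum>n\<in>F. measure lebesgue (B n) * \<bar>h (x n) - h (s n)\<bar>)"
        unfolding sum_distrib_right[symmetric] a_def[symmetric] by (intro sum_mono mult_right_mono an) simp
      also have "\<dots> \<le> 2 * e"
        unfolding h_def using x(1) s
        by (intro birkhoff_partition_oscillation[OF \<Gamma> W(1) B cp fn finF f]) auto
      finally show ?thesis .
    qed
    have iii: "\<bar>(\<Sum>w\<in>p. c w * h (s (r w))) - support_fun f S\<bar> \<le> 3 * e"
    proof -
      have eqa: "(\<Sum>w\<in>p. c w * h (s (r w))) = (\<Sum>n\<in>F. a n * h (s n))"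
        unfolding grp a_def sum_distrib_right by (intro sum.cong refl) (auto simp: P_def)
      \<comment> \<open>The mass of member \<open>n\<close> not covered by intervals tagged in it.
        Since all members together have mass at most 1, the total deficit is at most the mass of the
        parts \<open>d\<close>.\<close>
      define b where "b n = measure lebesgue (B n) - a n" for n
      have b0: "0 \<le> b n" "b n \<le> measure lebesgue (B n)" for n using an[of n] a0[of n] by (simp_all add: b_def)
      have dGr: "disjoint_family_on B G'" for G' using dB by (auto simp: disjoint_family_on_def)
      have tot1: "(\<Sum>n<k. measure lebesgue (B n)) \<le> 1" for k
        using sum_measure_disjoint_le[of "{..<k}" B "{0..1}"] dGr BL by simp
      have tota: "1 - (\<Sum>n\<in>F. a n) = (\<Sum>w\<in>p. d w)"
      proof -
        have "(\<Sum>w\<in>p. measure lebesgue (snd w)) = measure lebesgue (\<Union>w\<in>p. snd w)"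
          by (rule free_partition_measure[OF p order_refl]) (use sL in auto)
        also have "(\<Union>w\<in>p. snd w) = {0..1}" using p by (simp add: free_tagged_partition_def)
        finally have "(\<Sum>w\<in>p. measure lebesgue (snd w)) = 1" by simp
        moreover have "measure lebesgue (snd w) = c w + d w" if "w \<in> p" for w
          using cd[OF that] pw(2)[OF that] by auto
        ultimately have "(\<Sum>w\<in>p. c w) + (\<Sum>w\<in>p. d w) = 1" by (simp add: sum.distrib)
        moreover have "(\<Sum>n\<in>F. a n) = (\<Sum>w\<in>p. c w)" unfolding a_def grp ..
        ultimately show ?thesis by simp
      qed
      have part: "\<bar>\<Sum>n<k. b n * h (s n)\<bar> \<le> 3 * e" if k: "N \<le> k" "F \<subseteq> {..<k}" for k
      proof -
        have hM: "b n * \<bar>h (s n)\<bar> \<le> b n * M n" for n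
        proof (cases "B n = {}")
          case True
          then have "b n = 0" using b0[of n] by simp
          then show ?thesis by simp
        next
          case False
          then show ?thesis unfolding h_def by (intro mult_left_mono M(2) s f b0)
        qed
        have sumb: "(\<Sum>n<k. b n) \<le> (\<Sum>w\<in>p. d w)"
        proof -
          have "(\<Sum>n<k. a n) = (\<Sum>n\<in>F. a n)" using k(2) aF by (intro sum.mono_neutral_right) auto
          then show ?thesis using tot1[of k] tota by (simp add: b_def sum_subtractf)
        qed
        have "\<bar>\<Sum>n<N. b n * h (s n)\<bar> \<le> e"
        proof -
          have "\<bar>\<Sum>n<N. b n * h (s n)\<bar> \<le> (\<Sum>n<N. b n * \<bar>h (s n)\<bar>)"
            by (rule order_trans[OF sum_abs]) (simp add: abs_mult b0)
          also have "\<dots> \<le> (\<Sum>n<N. b n * Ms)"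
          proof (rule sum_mono)
            fix n assume "n \<in> {..<N}"
            then show "b n * \<bar>h (s n)\<bar> \<le> b n * Ms" using hM[of n] mult_left_mono[OF Ms(2) b0(1)[of n], of n] by simp
          qed
          also have "\<dots> = Ms * (\<Sum>n<N. b n)" by (simp add: sum_distrib_left mult.commute)
          also have "\<dots> \<le> Ms * (\<Sum>n<k. b n)" using k(1) b0 by (intro mult_left_mono Ms0 sum_mono2) auto
          also have "\<dots> \<le> Ms * (\<Sum>w\<in>p. d w)" by (intro mult_left_mono Ms0 sumb)
          finally show ?thesis using dtot by linarith
        qed
        \<comment> \<open>The tail estimate bounds sums rather than absolute values, so indices are
          split by the sign of the value, which doubles \<open>e\<close>.\<close>
        moreover have "\<bar>\<Sum>n=N..<k. b n * h (s n)\<bar> \<le> 2 * e"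
        proof -
          define Gp where "Gp = {n \<in> {N..<k}. 0 \<le> h (s n)}"
          define Gn where "Gn = {n \<in> {N..<k}. h (s n) < 0}"
          have "\<bar>\<Sum>n=N..<k. b n * h (s n)\<bar> \<le> (\<Sum>n=N..<k. measure lebesgue (B n) * \<bar>h (s n)\<bar>)"
            by (rule order_trans[OF sum_abs sum_mono]) (simp add: abs_mult b0 mult_right_mono)
          also have U: "{N..<k} = Gp \<union> Gn" by (auto simp: Gp_def Gn_def)
          also have "(\<Sum>n\<in>Gp \<union> Gn. measure lebesgue (B n) * \<bar>h (s n)\<bar>)
              = (\<Sum>n\<in>Gp. measure lebesgue (B n) * \<bar>h (s n)\<bar>) + (\<Sum>n\<in>Gn. measure lebesgue (B n) * \<bar>h (s n)\<bar>)"
            by (rule sum.union_disjoint) (auto simp: Gp_def Gn_def)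
          also have "(\<Sum>n\<in>Gp. measure lebesgue (B n) * \<bar>h (s n)\<bar>) = (\<Sum>n\<in>Gp. measure lebesgue (B n) * h (s n))"
            by (intro sum.cong) (auto simp: Gp_def)
          also have "(\<Sum>n\<in>Gn. measure lebesgue (B n) * \<bar>h (s n)\<bar>) = - (\<Sum>n\<in>Gn. measure lebesgue (B n) * h (s n))"
            unfolding sum_negf[symmetric] by (intro sum.cong) (auto simp: Gn_def)
          also have "(\<Sum>n\<in>Gp. measure lebesgue (B n) * h (s n)) + - (\<Sum>n\<in>Gn. measure lebesgue (B n) * h (s n)) \<le> e + e"
            using N[OF f, of Gp] N[OF f, of Gn] unfolding h_def[symmetric]
            by (intro add_mono) (auto simp: Gp_def Gn_def abs_le_iff)
          finally show ?thesis unfolding U by simp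
        qed
        moreover have "(\<Sum>n<k. b n * h (s n)) = (\<Sum>n<N. b n * h (s n)) + (\<Sum>n=N..<k. b n * h (s n))"
          using sum.atLeastLessThan_concat[of 0 N k "\<lambda>n. b n * h (s n)"] k(1) by (simp add: atLeast0LessThan)
        ultimately show ?thesis by linarith
      qed
      have "(\<lambda>k. \<Sum>n<k. measure lebesgue (B n) * h (s n)) \<longlonglongrightarrow> support_fun f S"
        using S(1)[of f] by (simp add: sums_def h_def)
      then have lim: "(\<lambda>k. \<bar>(\<Sum>n\<in>F. a n * h (s n)) - (\<Sum>n<k. measure lebesgue (B n) * h (s n))\<bar>) \<longlonglongrightarrow>
          \<bar>(\<Sum>n\<in>F. a n * h (s n)) - support_fun f S\<bar>"
        by (intro tendsto_intros)
      obtain k0 where k0: "F \<subseteq> {..<k0}" using finF finite_nat_iff_bounded by blast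
      have "\<bar>(\<Sum>n\<in>F. a n * h (s n)) - (\<Sum>n<k. measure lebesgue (B n) * h (s n))\<bar> \<le> 3 * e" if "k \<ge> max N k0" for k
      proof -
        have Fk: "F \<subseteq> {..<k}" "N \<le> k" using k0 that by auto
        have "(\<Sum>n\<in>F. a n * h (s n)) = (\<Sum>n<k. a n * h (s n))"
          using Fk(1) aF by (intro sum.mono_neutral_left) auto
        then have "(\<Sum>n\<in>F. a n * h (s n)) - (\<Sum>n<k. measure lebesgue (B n) * h (s n)) = - (\<Sum>n<k. b n * h (s n))"
          by (simp add: b_def left_diff_distrib sum_subtractf)
        then show ?thesis using part[OF Fk(2,1)] by simp
      qed
      then show ?thesis unfolding eqa
        by (intro tendsto_upperbound[OF lim]) (auto intro!: eventually_sequentiallyI[of "max N k0"])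
    qed
    have "(\<Sum>(t, I)\<in>p. measure lborel I * support_fun f (\<Gamma> t)) = (\<Sum>w\<in>p. measure lborel (snd w) * h (fst w))"
      by (simp add: h_def case_prod_unfold)
    also have "\<dots> = (\<Sum>w\<in>p. d w * h (fst w) + (c w * (h (fst w) - h (s (r w))) + c w * h (s (r w))))"
      using cd by (intro sum.cong refl) (simp add: algebra_simps)
    also have "\<dots> = (\<Sum>w\<in>p. d w * h (fst w)) + ((\<Sum>w\<in>p. c w * (h (fst w) - h (s (r w)))) + (\<Sum>w\<in>p. c w * h (s (r w))))"
      by (simp only: sum.distrib)
    finally show "\<bar>support_fun f W - (\<Sum>(t, I)\<in>p. measure lborel I * support_fun f (\<Gamma> t))\<bar> \<le> 7 * e"
      using i ii iii S(2)[OF f] by linarith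
  qed
  then show ?thesis using \<delta>(3) by blast
qed

text \<open>One gauge serves both claims: it is measurable and controls free partitions, among which
  are the Perron partitions.\<close>

theorem birkhoff_imp_H_mcshane:
  fixes \<Gamma> :: "real \<Rightarrow> 'a::real_normed_vector set"
  assumes \<Gamma>: "\<forall>t\<in>{0..1}. \<Gamma> t \<in> cwk" and W: "W \<in> cwk" "is_birkhoff_integral \<Gamma> W"
  shows "is_H_integral \<Gamma> W" "is_mcshane_integral \<Gamma> W"
proof -
  have key: "\<exists>\<delta> :: real \<Rightarrow> real. (\<forall>t\<in>{0..1}. 0 < \<delta> t) \<and> \<delta> \<in> borel_measurable (lebesgue_on {0..1}) \<and>
    (\<forall>p. free_tagged_partition p \<and> (\<lambda>t. ball t (\<delta> t)) fine p \<longrightarrow> hausdorff_dist W (riemann_sum \<Gamma> p) < \<epsilon>)"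
    if \<epsilon>: "0 < \<epsilon>" for \<epsilon>
  proof -
    \<comment> \<open>The factor \<open>7 / 8\<close> restores the strict inequality.\<close>
    obtain \<delta> where \<delta>: "free_gauge \<Gamma> W (7 * (\<epsilon> / 8)) \<delta>" "\<delta> \<in> borel_measurable (lebesgue_on {0..1})"
      using birkhoff_imp_free_gauge[OF \<Gamma> W, of "\<epsilon> / 8"] \<epsilon> by auto
    have "hausdorff_dist W (riemann_sum \<Gamma> p) < \<epsilon>"
      if p: "free_tagged_partition p" "(\<lambda>t. ball t (\<delta> t)) fine p" for p
    proof -
      have p': "finite p" "\<And>t I. (t, I) \<in> p \<Longrightarrow> t \<in> {0..1}" using p(1) by (auto simp: free_tagged_partition_def)
      have R: "riemann_sum \<Gamma> p \<in> cwk" by (rule riemann_sum_cwk[OF \<Gamma> p'])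
      have "hausdorff_dist W (riemann_sum \<Gamma> p) \<le> 7 * (\<epsilon> / 8)"
      proof (rule hausdorff_dist_le)
        fix f :: "'a \<Rightarrow>\<^sub>L real" assume "norm f \<le> 1"
        from adapted_gaugeD(2)[OF \<delta>(1) p this]
        show "\<bar>support_fun f W - support_fun f (riemann_sum \<Gamma> p)\<bar> \<le> 7 * (\<epsilon> / 8)"
          by (simp add: support_fun_riemann_sum[OF \<Gamma> p'])
      qed (use W(1) R in \<open>simp_all add: cwk_bounded cwk_convex cwk_nonempty\<close>)
      then show ?thesis using \<epsilon> by simp
    qed
    then show ?thesis using adapted_gaugeD(1)[OF \<delta>(1)] \<delta>(2) by (intro exI[of _ \<delta>]) auto
  qed
  show "is_H_integral \<Gamma> W"
    unfolding is_H_integral_def tagged_division_iff_free_tagged_partition using key by meson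
  show "is_mcshane_integral \<Gamma> W"
    unfolding is_mcshane_integral_def using key by meson
qed

section \<open>McShane integrability implies Pettis integrability\<close>

text \<open>
  Replacing, in a fine Perron partition, tags \<open>x\<close> by the tag of the interval of a fixed fine partition
  \<open>p\<close> that contains \<open>x\<close> yields a free partition. On the sets where the function is bounded by \<open>m\<close>
  this bounds the integral of its distance to the step function given by \<open>p\<close>, uniformly in \<open>m\<close>.
\<close>

lemma free_gauge_step_approximation:
  fixes \<Gamma> :: "real \<Rightarrow> 'a::real_normed_vector set"
  assumes \<delta>: "free_gauge \<Gamma> W e \<delta>" and p: "p tagged_division_of {0..1}" "(\<lambda>t. ball t (\<delta> t)) fine p"
    and f: "norm f \<le> 1" and meas: "(\<lambda>t. indicator {0..1} t *\<^sub>R support_fun f (\<Gamma> t)) \<in> borel_measurable lebesgue"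
    and e: "0 < e"
  shows "set_integrable lebesgue {0..1} (\<lambda>t. support_fun f (\<Gamma> t))"
    "\<And>E. E \<in> sets lebesgue \<Longrightarrow> E \<subseteq> {0..1} \<Longrightarrow> (LINT t:E|lebesgue. support_fun f (\<Gamma> t)) \<le>
      (\<Sum>w\<in>p. measure lebesgue (snd w \<inter> E) * support_fun f (\<Gamma> (fst w))) + 4 * e"
proof -
  define g where "g t = support_fun f (\<Gamma> t)" for t
  have fp: "free_tagged_partition p" using p(1) tagged_division_iff_free_tagged_partition by blast
  have fin: "finite p" using p(1) by (rule tagged_division_of_finite)
  have pw: "\<exists>a b. snd w = {a..b}" "snd w \<subseteq> {0..1}" "fst w \<in> snd w" if "w \<in> p" for w
    using tagged_division_ofD(2,3,4)[OF p(1), of "fst w" "snd w"] that by auto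
  have un: "(\<Union>w\<in>p. snd w) = {0..1}" using fp by (simp add: free_tagged_partition_def)
  define Z where "Z = (\<Union>w\<in>p. snd w - interior (snd w))"
  have "negligible (snd w - interior (snd w))" if "w \<in> p" for w
  proof -
    obtain a b where "snd w = {a..b}" using pw(1) \<open>w \<in> p\<close> by blast
    then have "snd w - interior (snd w) \<subseteq> {a, b}" by auto
    then show ?thesis by (meson finite.emptyI finite_insert negligible_finite negligible_subset)
  qed
  then have Z: "negligible Z" unfolding Z_def using fin by (intro negligible_Union) auto
  define T where "T s = (\<Sum>w\<in>p. indicator (interior (snd w)) s * g (fst w))" for s :: real
  define D where "D = {0..1} - Z"
  have DL: "D \<in> sets lebesgue" "D \<subseteq> {0..1}" using negligible_imp_sets[OF Z] by (auto simp: D_def)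
  have uniq: "v = w" if "v \<in> p" "w \<in> p" "s \<in> interior (snd v)" "s \<in> interior (snd w)" for v w s
    using fp that unfolding free_tagged_partition_def by blast
  have T: "T s = g (fst w)" if "w \<in> p" "s \<in> interior (snd w)" for w s
  proof -
    have "T s = (\<Sum>v\<in>{w}. indicator (interior (snd v)) s * g (fst v))"
      unfolding T_def
    proof (rule sum.mono_neutral_right[OF fin], use that in simp, rule ballI)
      fix v assume v: "v \<in> p - {w}"
      then have "s \<notin> interior (snd v)" using uniq[of v w s] that by blast
      then show "indicator (interior (snd v)) s * g (fst v) = 0" by simp
    qed
    then show ?thesis using that(2) by simp
  qed
  have inD: "\<exists>w. w \<in> p \<and> s \<in> interior (snd w)" if "s \<in> D" for s
  proof -
    have "s \<in> (\<Union>w\<in>p. snd w)" unfolding un using that by (simp add: D_def)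
    then obtain w where w: "w \<in> p" "s \<in> snd w" by blast
    have "s \<notin> snd w - interior (snd w)" using that w(1) unfolding D_def Z_def by blast
    then show ?thesis using w by blast
  qed
  then have "\<forall>s. \<exists>w. s \<in> D \<longrightarrow> w \<in> p \<and> s \<in> interior (snd w)" by blast
  then obtain W where W: "\<And>s. s \<in> D \<Longrightarrow> W s \<in> p" "\<And>s. s \<in> D \<Longrightarrow> s \<in> interior (snd (W s))" by metis
  have TL: "T \<in> borel_measurable lebesgue"
    unfolding T_def by (intro borel_measurable_sum borel_measurable_times borel_measurable_indicator) auto
  define c where "c = (\<Sum>w\<in>p. \<bar>g (fst w)\<bar>)"
  have Tc: "\<bar>T s\<bar> \<le> c" for s
    unfolding T_def c_def by (rule order_trans[OF sum_abs sum_mono]) (simp add: indicator_def)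
  have gL: "(\<lambda>t. indicator {0..1} t *\<^sub>R g t) \<in> borel_measurable lebesgue" using meas by (simp add: g_def)
  \<comment> \<open>Truncation to points with values at most \<open>m\<close> makes the distance to
    the step function integrable before integrability of \<open>g\<close> is known.\<close>
  define k where "k m s = indicator D s * (indicator {s. \<bar>indicator {0..1} s *\<^sub>R g s\<bar> \<le> real m} s *
      \<bar>indicator {0..1} s *\<^sub>R g s - T s\<bar>)" for m s
  define u where "u s = indicator D s * \<bar>indicator {0..1} s *\<^sub>R g s - T s\<bar>" for s
  have kD: "k m s = \<bar>g s - T s\<bar>" if "s \<in> D" "\<bar>g s\<bar> \<le> real m" for m s using that DL(2) by (auto simp: k_def indicator_def)
  have k0: "k m s = 0" if "\<not> (s \<in> D \<and> \<bar>g s\<bar> \<le> real m)" for m s using that DL(2) by (auto simp: k_def indicator_def)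
  have kL: "k m \<in> borel_measurable lebesgue" for m
  proof -
    have "{s \<in> space lebesgue. \<bar>indicator {0..1} s *\<^sub>R g s\<bar> \<le> real m} \<in> sets lebesgue"
      using gL by (intro borel_measurable_le borel_measurable_abs) auto
    then show ?thesis
      unfolding k_def using gL TL DL(1)
      by (intro borel_measurable_times borel_measurable_indicator borel_measurable_abs borel_measurable_diff) auto
  qed
  have uL: "u \<in> borel_measurable lebesgue"
    unfolding u_def using gL TL DL(1)
    by (intro borel_measurable_times borel_measurable_indicator borel_measurable_abs borel_measurable_diff) auto
  have kint: "integrable lebesgue (k m)" for m
  proof (rule integrableI_bounded_set[where A = D and B = "real m + c"])
    show "emeasure lebesgue D < \<infinity>"
      using fmeasurableD2[OF unit_lmeasurable[OF DL]] by (simp add: top.not_eq_extremum)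
    show "AE s\<in>D in lebesgue. norm (k m s) \<le> real m + c"
    proof (rule AE_I2, rule impI)
      fix s assume "s \<in> D"
      show "norm (k m s) \<le> real m + c"
        using kD[OF \<open>s \<in> D\<close>, of m] k0[of s m] Tc[of s] by (cases "\<bar>g s\<bar> \<le> real m") auto
    qed
    show "AE s in lebesgue. s \<notin> D \<longrightarrow> k m s = 0" using k0 by (intro AE_I2) auto
  qed (use kL DL in auto)
  have kset: "(LINT s:{0..1}|lebesgue. k m s) = integral\<^sup>L lebesgue (k m)" "set_integrable lebesgue {0..1} (k m)" for m
  proof -
    have "indicator {0..1} s *\<^sub>R k m s = k m s" for s
      using DL(2) by (auto simp: k_def indicator_def)
    then have eq: "(\<lambda>s. indicator {0..1} s *\<^sub>R k m s) = k m" by (rule ext)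
    show "(LINT s:{0..1}|lebesgue. k m s) = integral\<^sup>L lebesgue (k m)" "set_integrable lebesgue {0..1} (k m)"
      unfolding set_lebesgue_integral_def set_integrable_def eq by (auto intro: kint)
  qed
  have kle: "integral\<^sup>L lebesgue (k m) \<le> 4 * e" for m
  proof (rule field_le_epsilon)
    fix \<kappa> :: real assume \<kappa>: "0 < \<kappa>"
    have "(k m has_integral integral\<^sup>L lebesgue (k m)) (cbox 0 1)"
      using has_integral_set_lebesgue[OF kset(2)[of m]] kset(1)[of m] by simp
    then obtain \<gamma> where \<gamma>: "gauge \<gamma>" "\<And>q. q tagged_division_of cbox 0 1 \<Longrightarrow> \<gamma> fine q \<Longrightarrow>
        norm ((\<Sum>(x, K)\<in>q. measure lborel K *\<^sub>R k m x) - integral\<^sup>L lebesgue (k m)) < \<kappa>"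
      unfolding has_integral using \<kappa> by meson
    \<comment> \<open>Three demands: \<open>\<gamma>\<close> approximates the integral of
      \<open>k m\<close>, the ball gives fineness for the original tag, and the interior of the
      interval of \<open>p\<close> around \<open>x\<close> makes the cell fine for the tag of that
      interval as well.\<close>
    define \<Delta> where "\<Delta> x = \<gamma> x \<inter> (if x \<in> {0..1} then ball x (\<delta> x) else ball x 1) \<inter> (if x \<in> D then interior (snd (W x)) else UNIV)" for x
    have "gauge \<Delta>"
      unfolding gauge_def \<Delta>_def using \<gamma>(1) adapted_gaugeD(1)[OF \<delta>] W(2)
      by (auto simp: gauge_def intro!: open_Int)
    then obtain q where q: "q tagged_division_of cbox 0 1" "\<Delta> fine q" using fine_division_exists by blast
    have q1: "q tagged_division_of {0..1}" using q(1) by simp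
    have finq: "finite q" using q1 by (rule tagged_division_of_finite)
    have q01: "x \<in> {0..1}" if "(x, K) \<in> q" for x K using tagged_division_ofD(2,3)[OF q1 that] by blast
    have "\<gamma> fine q" using q(2) by (auto simp: fine_def \<Delta>_def)
    then have near: "integral\<^sup>L lebesgue (k m) \<le> (\<Sum>(x, K)\<in>q. measure lborel K * k m x) + \<kappa>"
      using \<gamma>(2)[OF q(1)] by (fastforce simp: abs_less_iff)
    have qb: "K \<subseteq> ball x (\<delta> x)" if "(x, K) \<in> q" for x K
      using fineD[OF q(2) that] q01[OF that] by (auto simp: \<Delta>_def)
    have qW: "K \<subseteq> ball (fst (W x)) (\<delta> (fst (W x)))" if "(x, K) \<in> q" "x \<in> D" for x K
    proof -
      have "K \<subseteq> snd (W x)" using fineD[OF q(2) that(1)] that(2) interior_subset by (fastforce simp: \<Delta>_def)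
      also have "\<dots> \<subseteq> ball (fst (W x)) (\<delta> (fst (W x)))"
        using fineD[OF p(2), of "fst (W x)" "snd (W x)"] W(1)[OF that(2)] by simp
      finally show ?thesis .
    qed
    \<comment> \<open>On points where the difference to the step function has one sign, absolute
      values are a change of Riemann sums under retagging, at most \<open>2 * e\<close>; the two
      signs give \<open>4 * e\<close>.\<close>
    have swap: "(\<Sum>w\<in>q. if fst w \<in> D \<and> R (fst w) then measure lborel (snd w) * \<bar>g (fst w) - T (fst w)\<bar> else 0) \<le> 2 * e"
      if sgn: "(\<forall>x. R x \<longrightarrow> T x \<le> g x) \<or> (\<forall>x. R x \<longrightarrow> g x \<le> T x)" for R
    proof -
      define r where "r w = (if fst w \<in> D \<and> R (fst w) then fst (W (fst w)) else fst w)" for w :: "real \<times> real set"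
      have gr: "g (r w) = (if fst w \<in> D \<and> R (fst w) then T (fst w) else g (fst w))" for w
        using T[OF W, of "fst w"] by (auto simp: r_def)
      have r01: "r (x, K) \<in> {0..1}" if "(x, K) \<in> q" for x K
        using q01[OF that] subsetD[OF pw(2)[OF W(1)] pw(3)[OF W(1)], of x] by (simp add: r_def)
      have rb: "K \<subseteq> (\<lambda>t. ball t (\<delta> t)) (r (x, K))" if "(x, K) \<in> q" for x K
        using qb[OF that] qW[OF that] by (simp add: r_def)
      define q' where "q' = (\<lambda>w. (r w, snd w)) ` q"
      have q': "free_tagged_partition q'" "(\<lambda>t. ball t (\<delta> t)) fine q'"
        "(\<Sum>(t, K)\<in>q'. measure lborel K * g t) = (\<Sum>w\<in>q. measure lborel (snd w) * g (r w))"
        unfolding q'_def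
        by (rule retag_partition[OF q1, where u = r and \<gamma> = "\<lambda>t. ball t (\<delta> t)"]; use rb r01 in blast)+
      \<comment> \<open>The integral of the assumption is shadowed by the choice function
        \<open>W\<close>, so the estimates are stated for any \<open>W'\<close> and used through the
        assumption on \<open>\<delta>\<close>.\<close>
      have 1: "\<bar>support_fun f W' - (\<Sum>(t, K)\<in>q'. measure lborel K * g t)\<bar> \<le> e"
        and 2: "\<bar>support_fun f W' - (\<Sum>(t, K)\<in>q. measure lborel K * g t)\<bar> \<le> e" if "free_gauge \<Gamma> W' e \<delta>" for W'
      proof -
        have fq: "free_tagged_partition q" using q1 tagged_division_iff_free_tagged_partition by blast
        have "(\<lambda>t. ball t (\<delta> t)) fine q" using qb by (auto simp: fine_def)
        then show "\<bar>support_fun f W' - (\<Sum>(t, K)\<in>q. measure lborel K * g t)\<bar> \<le> e"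
          unfolding g_def by (rule adapted_gaugeD(2)[OF that fq _ f])
        show "\<bar>support_fun f W' - (\<Sum>(t, K)\<in>q'. measure lborel K * g t)\<bar> \<le> e"
          unfolding g_def by (rule adapted_gaugeD(2)[OF that q'(1,2) f])
      qed
      have "(\<Sum>(t, K)\<in>q. measure lborel K * g t) - (\<Sum>(t, K)\<in>q'. measure lborel K * g t)
          = (\<Sum>w\<in>q. measure lborel (snd w) * (g (fst w) - g (r w)))"
        unfolding q'(3) by (simp add: case_prod_unfold sum_subtractf right_diff_distrib)
      then have abs: "\<bar>\<Sum>w\<in>q. measure lborel (snd w) * (g (fst w) - g (r w))\<bar> \<le> 2 * e"
        using 1[OF \<delta>] 2[OF \<delta>] by linarith
      from sgn show ?thesis
      proof
        assume pos: "\<forall>x. R x \<longrightarrow> T x \<le> g x"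
        have "(\<Sum>w\<in>q. if fst w \<in> D \<and> R (fst w) then measure lborel (snd w) * \<bar>g (fst w) - T (fst w)\<bar> else 0)
            = (\<Sum>w\<in>q. measure lborel (snd w) * (g (fst w) - g (r w)))"
          using pos by (intro sum.cong refl) (simp add: gr)
        then show ?thesis using abs by linarith
      next
        assume neg: "\<forall>x. R x \<longrightarrow> g x \<le> T x"
        have "(\<Sum>w\<in>q. if fst w \<in> D \<and> R (fst w) then measure lborel (snd w) * \<bar>g (fst w) - T (fst w)\<bar> else 0)
            = - (\<Sum>w\<in>q. measure lborel (snd w) * (g (fst w) - g (r w)))"
          unfolding sum_negf[symmetric] using neg by (intro sum.cong refl) (simp add: gr right_diff_distrib)
        then show ?thesis using abs by linarith
      qed
    qed
    have "(\<Sum>(x, K)\<in>q. measure lborel K * k m x) \<le>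
        (\<Sum>w\<in>q. (if fst w \<in> D \<and> T (fst w) \<le> g (fst w) then measure lborel (snd w) * \<bar>g (fst w) - T (fst w)\<bar> else 0) +
          (if fst w \<in> D \<and> g (fst w) \<le> T (fst w) then measure lborel (snd w) * \<bar>g (fst w) - T (fst w)\<bar> else 0))"
    proof (subst case_prod_unfold, rule sum_mono)
      fix w :: "real \<times> real set"
      have "k m (fst w) \<le> (if fst w \<in> D then \<bar>g (fst w) - T (fst w)\<bar> else 0)"
        using kD[of "fst w" m] k0[of "fst w" m] by (cases "fst w \<in> D \<and> \<bar>g (fst w)\<bar> \<le> real m") auto
      then have "measure lborel (snd w) * k m (fst w) \<le> measure lborel (snd w) * (if fst w \<in> D then \<bar>g (fst w) - T (fst w)\<bar> else 0)"
        by (rule mult_left_mono) simp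
      then show "measure lborel (snd w) * k m (fst w) \<le>
          (if fst w \<in> D \<and> T (fst w) \<le> g (fst w) then measure lborel (snd w) * \<bar>g (fst w) - T (fst w)\<bar> else 0) +
          (if fst w \<in> D \<and> g (fst w) \<le> T (fst w) then measure lborel (snd w) * \<bar>g (fst w) - T (fst w)\<bar> else 0)"
        by (auto split: if_splits)
    qed
    also have "\<dots> \<le> 2 * e + 2 * e"
      unfolding sum.distrib using swap[of "\<lambda>x. T x \<le> g x"] swap[of "\<lambda>x. g x \<le> T x"] by (intro add_mono) auto
    finally show "integral\<^sup>L lebesgue (k m) \<le> 4 * e + \<kappa>" using near by linarith
  qed
  have kmono: "mono (\<lambda>m. k m s)" for s
    by (intro monoI) (auto simp: k_def indicator_def)
  have klim: "(\<lambda>m. k m s) \<longlonglongrightarrow> u s" for s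
  proof (rule tendsto_eventually, rule eventually_sequentiallyI[of "nat \<lceil>\<bar>indicator {0..1} s *\<^sub>R g s\<bar>\<rceil>"])
    fix m assume "nat \<lceil>\<bar>indicator {0..1} s *\<^sub>R g s\<bar>\<rceil> \<le> m"
    then have "\<bar>indicator {0..1} s *\<^sub>R g s\<bar> \<le> real m" by linarith
    then show "k m s = u s" by (simp add: k_def u_def)
  qed
  \<comment> \<open>The bound \<open>4 * e\<close> does not depend on \<open>m\<close>; monotone
    convergence yields integrability of the untruncated distance \<open>u\<close>.\<close>
  have "incseq (\<lambda>m. integral\<^sup>L lebesgue (k m))"
    using kmono by (intro incseq_SucI integral_mono kint) (auto simp: mono_def)
  then obtain L where L: "(\<lambda>m. integral\<^sup>L lebesgue (k m)) \<longlonglongrightarrow> L" using kle incseq_convergent by blast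
  have L4: "L \<le> 4 * e" by (rule LIMSEQ_le_const2[OF L]) (use kle in blast)
  have uint: "integrable lebesgue u" and uI: "integral\<^sup>L lebesgue u = L"
    using integrable_monotone_convergence[OF kint _ _ L uL] integral_monotone_convergence[OF kint _ _ L uL] kmono klim by auto
  define v where "v s = indicator D s * (indicator {0..1} s *\<^sub>R g s - T s)" for s
  have vL: "v \<in> borel_measurable lebesgue"
    unfolding v_def using gL TL DL(1)
    by (intro borel_measurable_times borel_measurable_indicator borel_measurable_diff) auto
  have vint: "integrable lebesgue v"
    by (rule Bochner_Integration.integrable_bound[OF uint vL]) (simp add: u_def v_def abs_mult)
  have Tint: "set_integrable lebesgue E T" "(LINT t:E|lebesgue. T t) = (\<Sum>w\<in>p. measure lebesgue (interior (snd w) \<inter> E) * g (fst w))"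
    if E: "E \<in> sets lebesgue" "E \<subseteq> {0..1}" for E
  proof -
    have mi: "integrable lebesgue (indicat_real (interior K \<inter> E))" for K
    proof -
      have "interior K \<inter> E \<in> lmeasurable" using E by (intro unit_lmeasurable) auto
      then show ?thesis by (auto simp: fmeasurable_def intro!: integrable_real_indicator)
    qed
    have eq: "(\<lambda>t. indicator E t *\<^sub>R T t) = (\<lambda>t. \<Sum>w\<in>p. indicator (interior (snd w) \<inter> E) t * g (fst w))"
      by (auto simp: T_def fun_eq_iff indicator_def sum_distrib_left intro!: sum.cong)
    show "set_integrable lebesgue E T"
      unfolding set_integrable_def eq
      by (intro Bochner_Integration.integrable_sum integrable_mult_left mi)
    show "(LINT t:E|lebesgue. T t) = (\<Sum>w\<in>p. measure lebesgue (interior (snd w) \<inter> E) * g (fst w))"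
      unfolding set_lebesgue_integral_def eq
      by (subst Bochner_Integration.integral_sum) (intro integrable_mult_left mi, simp)
  qed
  have AEg: "AE t in lebesgue. indicator E t *\<^sub>R (T t + v t) = indicator E t *\<^sub>R g t" if "E \<subseteq> {0..1}" for E
  proof (rule AE_I'[of Z])
    show "Z \<in> null_sets lebesgue" using Z by (simp add: negligible_iff_null_sets)
    show "{t \<in> space lebesgue. indicator E t *\<^sub>R (T t + v t) \<noteq> indicator E t *\<^sub>R g t} \<subseteq> Z"
      using that by (auto simp: v_def D_def indicator_def split: if_splits)
  qed
  have vE: "set_integrable lebesgue E v" if "E \<in> sets lebesgue" for E
    unfolding set_integrable_def using vint that by (rule integrable_mult_indicator[rotated])
  have Tv: "set_integrable lebesgue E (\<lambda>t. T t + v t)" if E: "E \<in> sets lebesgue" "E \<subseteq> {0..1}" for E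
    by (rule set_integral_add(1)[OF Tint(1)[OF E] vE[OF E(1)]])
  have gmeas: "(\<lambda>t. indicator E t *\<^sub>R g t) \<in> borel_measurable lebesgue" if "E \<in> sets lebesgue" "E \<subseteq> {0..1}" for E
  proof -
    have "(\<lambda>t. indicator E t *\<^sub>R (indicator {0..1} t *\<^sub>R g t)) \<in> borel_measurable lebesgue"
      by (rule borel_measurable_scaleR[OF borel_measurable_indicator[OF that(1)] gL])
    moreover have "(\<lambda>t. indicator E t *\<^sub>R (indicator {0..1} t *\<^sub>R g t)) = (\<lambda>t. indicator E t *\<^sub>R g t)"
      using that(2) by (auto simp: fun_eq_iff indicator_def)
    ultimately show ?thesis by simp
  qed
  have Tvm: "(\<lambda>t. indicator E t *\<^sub>R (T t + v t)) \<in> borel_measurable lebesgue" if "E \<in> sets lebesgue" "E \<subseteq> {0..1}" for E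
    using Tv[OF that] unfolding set_integrable_def by (rule borel_measurable_integrable)
  have "integrable lebesgue (\<lambda>t. indicator {0..1} t *\<^sub>R g t)"
    using Tv[of "{0..1}"] integrable_cong_AE[OF Tvm gmeas AEg] unfolding set_integrable_def by auto
  then show "set_integrable lebesgue {0..1} (\<lambda>t. support_fun f (\<Gamma> t))" by (simp add: set_integrable_def g_def)
  fix E :: "real set" assume E: "E \<in> sets lebesgue" "E \<subseteq> {0..1}"
  have "(LINT t:E|lebesgue. g t) = (LINT t:E|lebesgue. T t + v t)"
    unfolding set_lebesgue_integral_def
    by (rule integral_cong_AE[OF gmeas[OF E] Tvm[OF E]]) (use AEg[OF E(2)] in \<open>auto elim: eventually_mono\<close>)
  also have "\<dots> = (LINT t:E|lebesgue. T t) + (LINT t:E|lebesgue. v t)"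
    by (rule set_integral_add(2)[OF Tint(1)[OF E] vE[OF E(1)]])
  also have "(LINT t:E|lebesgue. v t) \<le> integral\<^sup>L lebesgue u"
    using vE[OF E(1)] uint unfolding set_lebesgue_integral_def set_integrable_def
    by (intro integral_mono) (auto simp: u_def v_def indicator_def)
  also have "\<dots> \<le> 4 * e" using uI L4 by simp
  also have "(LINT t:E|lebesgue. T t) = (\<Sum>w\<in>p. measure lebesgue (snd w \<inter> E) * g (fst w))"
    unfolding Tint(2)[OF E]
  proof (rule sum.cong[OF refl])
    fix w assume w: "w \<in> p"
    have "measure lebesgue (interior (snd w) \<inter> E) = measure lebesgue (snd w \<inter> E)"
    proof (rule measure_negligible_symdiff[symmetric])
      show "interior (snd w) \<inter> E \<in> lmeasurable" using E by (intro unit_lmeasurable) auto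
    next
      have "interior (snd w) \<inter> E - snd w \<inter> E \<union> (snd w \<inter> E - interior (snd w) \<inter> E) \<subseteq> Z"
        using w interior_subset by (auto simp: Z_def)
      then show "negligible (interior (snd w) \<inter> E - snd w \<inter> E \<union> (snd w \<inter> E - interior (snd w) \<inter> E))"
        using Z negligible_subset by blast
    qed
    then show "measure lebesgue (interior (snd w) \<inter> E) * g (fst w) = measure lebesgue (snd w \<inter> E) * g (fst w)" by simp
  qed
  finally show "(LINT t:E|lebesgue. support_fun f (\<Gamma> t)) \<le>
      (\<Sum>w\<in>p. measure lebesgue (snd w \<inter> E) * support_fun f (\<Gamma> (fst w))) + 4 * e" by (simp add: g_def)
qed

section \<open>Set-valued Pettis integrals from domination\<close>

lemma scalarly_integrableI:
  assumes "\<And>f. set_integrable lebesgue {0..1} (\<lambda>t. support_fun f (\<Gamma> t))"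
  shows "scalarly_integrable \<Gamma>"
  unfolding scalarly_integrable_def
  using assms[unfolded set_integrable_def] by (subst integrable_restrict_space) auto

text \<open>For fixed \<open>E\<close> the integrals form a sublinear function of \<open>f\<close>.
  Domination on the unit ball extends to all functionals by homogeneity with error
  \<open>e * norm f\<close>, as \<open>cwk_representation\<close> demands.\<close>

lemma pettis_integrable_if_dominated:
  fixes \<Gamma> :: "real \<Rightarrow> 'a::banach set"
  assumes \<Gamma>: "\<forall>t\<in>{0..1}. \<Gamma> t \<in> cwk" and si: "scalarly_integrable \<Gamma>"
    and dom: "\<And>E e. E \<in> sets lebesgue \<Longrightarrow> E \<subseteq> {0..1} \<Longrightarrow> 0 < e \<Longrightarrow>
      \<exists>C\<in>cwk. \<forall>f. norm f \<le> 1 \<longrightarrow> (LINT t:E|lebesgue. support_fun f (\<Gamma> t)) \<le> support_fun f C + e"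
  shows "pettis_integrable \<Gamma>"
  unfolding pettis_integrable_def
proof (intro conjI ballI si)
  fix E assume "E \<in> sets (lebesgue_on {0..1::real})"
  then have E: "E \<in> sets lebesgue" "E \<subseteq> {0..1}" by (auto simp: sets_unit_iff)
  define \<psi> where "\<psi> f = (LINT t:E|lebesgue. support_fun f (\<Gamma> t))" for f
  note int = scalarly_integrable_set_integrable[OF si E]
  have sub: "sublinear (\<lambda>f. support_fun f (\<Gamma> t))" if "t \<in> E" for t
    using \<Gamma> E(2) that by (intro sublinear_support_fun cwk_bounded cwk_nonempty) auto
  have "\<psi> (c *\<^sub>R f) = c * \<psi> f" if c: "0 \<le> c" for c f
  proof -
    have "\<psi> (c *\<^sub>R f) = (LINT t:E|lebesgue. c * support_fun f (\<Gamma> t))"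
      unfolding \<psi>_def by (rule set_lebesgue_integral_cong[OF E(1)]) (use sublinear_scale[OF sub c] in simp)
    then show ?thesis by (simp add: \<psi>_def)
  qed
  moreover have "\<psi> (f + g) \<le> \<psi> f + \<psi> g" for f g
  proof -
    have "\<psi> (f + g) \<le> (LINT t:E|lebesgue. support_fun f (\<Gamma> t) + support_fun g (\<Gamma> t))"
      unfolding \<psi>_def using sublinear_add[OF sub] by (intro set_integral_mono int set_integral_add(1)) auto
    then show ?thesis by (simp add: \<psi>_def set_integral_add(2)[OF int int])
  qed
  ultimately have \<psi>: "sublinear \<psi>" by (simp add: sublinear_def)
  have "\<exists>C\<in>cwk. \<forall>f. \<psi> f \<le> support_fun f C + e * norm f" if e: "0 < e" for e
  proof -
    obtain C where C: "C \<in> cwk" "\<And>f. norm f \<le> 1 \<Longrightarrow> \<psi> f \<le> support_fun f C + e"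
      using dom[OF E e] unfolding \<psi>_def by blast
    have sC: "sublinear (\<lambda>f. support_fun f C)" by (rule sublinear_support_fun[OF cwk_bounded[OF C(1)] cwk_nonempty[OF C(1)]])
    have "\<psi> f \<le> support_fun f C + e * norm f" for f
    proof (cases "f = 0")
      case True
      then show ?thesis using sublinear_zero[OF \<psi>] sublinear_zero[OF sC] by simp
    next
      case False
      define g where "g = (1 / norm f) *\<^sub>R f"
      have g: "f = norm f *\<^sub>R g" "norm g \<le> 1" using False by (simp_all add: g_def)
      have "\<psi> f = norm f * \<psi> g" "support_fun f C = norm f * support_fun g C"
        using sublinear_scale[OF \<psi>, of "norm f" g] sublinear_scale[OF sC, of "norm f" g] g(1) by simp_all
      then show ?thesis using mult_left_mono[OF C(2)[OF g(2)] norm_ge_zero[of f]] by (simp add: algebra_simps)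
    qed
    then show ?thesis using C(1) by blast
  qed
  then obtain W where "W \<in> cwk" "\<And>f. support_fun f W = \<psi> f" using cwk_representation[OF \<psi>] by blast
  then show "\<exists>W\<in>cwk. is_pettis_integral \<Gamma> E W" by (auto simp: is_pettis_integral_def \<psi>_def)
qed

text \<open>The dominating set for \<open>E\<close> is the Riemann sum of a fine partition with its
  intervals cut down to \<open>E\<close>; measurability of the scalar functions comes from their
  gauge integrability.\<close>

theorem mcshane_imp_pettis:
  fixes \<Gamma> :: "real \<Rightarrow> 'a::banach set"
  assumes \<Gamma>: "\<forall>t\<in>{0..1}. \<Gamma> t \<in> cwk" and W: "W \<in> cwk" "is_mcshane_integral \<Gamma> W"
  shows "pettis_integrable \<Gamma>"
proof -
  have "((\<lambda>t. support_fun f (\<Gamma> t)) has_integral support_fun f W) {0..1}" for f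
    using mcshane_integral_gauge[OF \<Gamma> W] free_gauge_imp_perron_gauge
    by (intro perron_gauges_has_integral[OF \<Gamma> W(1)]) blast
  then have meas: "(\<lambda>t. indicator {0..1} t *\<^sub>R support_fun f (\<Gamma> t)) \<in> borel_measurable lebesgue" for f
    by (rule has_integral_implies_lebesgue_measurable)
  have fine: "\<exists>\<delta> p. free_gauge \<Gamma> W e \<delta> \<and> p tagged_division_of {0..1} \<and> (\<lambda>t. ball t (\<delta> t)) fine p" if e: "0 < e" for e
  proof -
    obtain \<delta> where \<delta>: "free_gauge \<Gamma> W e \<delta>" using mcshane_integral_gauge[OF \<Gamma> W e] by blast
    obtain p where "p tagged_division_of cbox 0 1" "(\<lambda>t. if t \<in> {0..1} then ball t (\<delta> t) else ball t 1) fine p"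
      by (rule fine_division_exists[OF gauge_on_unit_interval[of \<delta>], of 0 1]) (use adapted_gaugeD(1)[OF \<delta>] in blast)
    then have "p tagged_division_of {0..1}" "(\<lambda>t. ball t (\<delta> t)) fine p"
      using fine_unit_interval_cong[of "\<lambda>t. if t \<in> {0..1} then ball t (\<delta> t) else ball t 1" "\<lambda>t. ball t (\<delta> t)" p] by simp_all
    then show ?thesis using \<delta> by blast
  qed
  have unit: "set_integrable lebesgue {0..1} (\<lambda>t. support_fun f (\<Gamma> t))" if f: "norm f \<le> 1" for f
    using fine[of 1] free_gauge_step_approximation(1)[OF _ _ _ f meas] by (metis zero_less_one)
  have "scalarly_integrable \<Gamma>"
  proof (rule scalarly_integrableI)
    fix f :: "'a \<Rightarrow>\<^sub>L real"
    define c where "c = norm f + 1"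
    have c: "0 < c" by (simp add: c_def add_nonneg_pos)
    have "norm ((1 / c) *\<^sub>R f) \<le> 1" using c by (simp add: c_def divide_simps)
    then have "set_integrable lebesgue {0..1} (\<lambda>t. c * support_fun ((1 / c) *\<^sub>R f) (\<Gamma> t))"
      by (intro set_integrable_mult_right unit)
    moreover have "c * support_fun ((1 / c) *\<^sub>R f) (\<Gamma> t) = support_fun f (\<Gamma> t)" if "t \<in> {0..1}" for t
      using support_fun_scale_functional[of "\<Gamma> t" "1 / c" f] \<Gamma> that c by simp
    ultimately show "set_integrable lebesgue {0..1} (\<lambda>t. support_fun f (\<Gamma> t))"
      by (subst (asm) set_integrable_cong[OF refl refl]) auto
  qed
  then show ?thesis
  proof (rule pettis_integrable_if_dominated[OF \<Gamma>])
    fix E :: "real set" and e :: real assume E: "E \<in> sets lebesgue" "E \<subseteq> {0..1}" and e: "0 < e"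
    \<comment> \<open>\<open>e / 4\<close> compensates the factor 4 of the step
      approximation.\<close>
    obtain \<delta> p where p: "free_gauge \<Gamma> W (e / 4) \<delta>" "p tagged_division_of {0..1}" "(\<lambda>t. ball t (\<delta> t)) fine p"
      using fine[of "e / 4"] e by auto
    have \<Gamma>p: "\<Gamma> (fst w) \<in> cwk" if "w \<in> p" for w
      using tagged_division_ofD(2,3)[OF p(2), of "fst w" "snd w"] that \<Gamma> by auto
    have fin: "finite p" using p(2) by (rule tagged_division_of_finite)
    define C where "C = (\<Sum>w\<in>p. (*\<^sub>R) (measure lebesgue (snd w \<inter> E)) ` \<Gamma> (fst w))"
    have C: "C \<in> cwk" unfolding C_def by (intro cwk_sum fin cwk_scale \<Gamma>p)
    have "(LINT t:E|lebesgue. support_fun f (\<Gamma> t)) \<le> support_fun f C + e" if f: "norm f \<le> 1" for f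
    proof -
      have "support_fun f C = (\<Sum>w\<in>p. support_fun f ((*\<^sub>R) (measure lebesgue (snd w \<inter> E)) ` \<Gamma> (fst w)))"
        unfolding C_def by (intro support_fun_sum fin cwk_scale \<Gamma>p)
      also have "\<dots> = (\<Sum>w\<in>p. measure lebesgue (snd w \<inter> E) * support_fun f (\<Gamma> (fst w)))"
        using \<Gamma>p by (intro sum.cong refl support_fun_scale cwk_bounded cwk_nonempty) auto
      finally show ?thesis
        using free_gauge_step_approximation(2)[OF p f meas _ E] e by simp
    qed
    then show "\<exists>C\<in>cwk. \<forall>f. norm f \<le> 1 \<longrightarrow> (LINT t:E|lebesgue. support_fun f (\<Gamma> t)) \<le> support_fun f C + e"
      using C by blast
  qed
qed

section \<open>Selections and Pettis integrability\<close>

text \<open>The values of \<open>g\<close> lie between \<open>- support_fun (- f)\<close> and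
  \<open>support_fun f\<close> of \<open>\<Gamma>\<close>, so measurability suffices for scalar
  integrability. The integral over \<open>A\<close> is a linear functional below the support
  function of the set integral, hence a vector.\<close>

lemma pettis_selection:
  fixes \<Gamma> :: "real \<Rightarrow> 'a::banach set"
  assumes \<Gamma>: "\<forall>t\<in>{0..1}. \<Gamma> t \<in> cwk" and P: "pettis_integrable \<Gamma>" and g: "g \<in> selections \<Gamma>"
    and meas: "\<And>f :: 'a \<Rightarrow>\<^sub>L real. (\<lambda>t. indicator {0..1} t *\<^sub>R blinfun_apply f (g t)) \<in> borel_measurable lebesgue"
  shows "pettis_integrable_fun g"
proof -
  have up: "blinfun_apply f (g t) \<le> support_fun f (\<Gamma> t)" if "t \<in> {0..1}" for f :: "'a \<Rightarrow>\<^sub>L real" and t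
    using \<Gamma> g that by (intro support_fun_upper cwk_bounded) (auto simp: selections_def)
  have si: "scalarly_integrable \<Gamma>" using P by (simp add: pettis_integrable_def)
  have int: "set_integrable lebesgue {0..1} (\<lambda>t. blinfun_apply f (g t))" for f :: "'a \<Rightarrow>\<^sub>L real"
  proof (rule set_integrable_bound)
    show "set_integrable lebesgue {0..1} (\<lambda>t. \<bar>support_fun f (\<Gamma> t)\<bar> + \<bar>support_fun (- f) (\<Gamma> t)\<bar>)"
      by (intro set_integral_add(1) set_integrable_abs scalarly_integrable_set_integrable[OF si]) auto
    show "set_borel_measurable lebesgue {0..1} (\<lambda>t. blinfun_apply f (g t))"
      using meas by (simp add: set_borel_measurable_def)
    show "AE t in lebesgue. t \<in> {0..1} \<longrightarrow> norm (blinfun_apply f (g t)) \<le> norm (\<bar>support_fun f (\<Gamma> t)\<bar> + \<bar>support_fun (- f) (\<Gamma> t)\<bar>)"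
    proof (rule AE_I2, rule impI)
      fix t :: real assume "t \<in> {0..1}"
      then show "norm (blinfun_apply f (g t)) \<le> norm (\<bar>support_fun f (\<Gamma> t)\<bar> + \<bar>support_fun (- f) (\<Gamma> t)\<bar>)"
        using up[of t f] up[of t "- f"] by (simp add: blinfun.minus_left)
    qed
  qed
  have "scalarly_integrable (\<lambda>t. {g t})" by (rule scalarly_integrableI) (simp add: int)
  moreover have "\<exists>w. is_pettis_integral (\<lambda>t. {g t}) A {w}" if A1: "A \<in> sets (lebesgue_on {0..1})" for A
  proof -
    have A: "A \<in> sets lebesgue" "A \<subseteq> {0..1}" using A1 by (auto simp: sets_unit_iff)
    obtain W where W: "W \<in> cwk" "\<And>f. support_fun f W = (LINT t:A|lebesgue. support_fun f (\<Gamma> t))"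
      using P A1 unfolding pettis_integrable_def is_pettis_integral_def by meson
    have intA: "set_integrable lebesgue A (\<lambda>t. blinfun_apply f (g t))" for f :: "'a \<Rightarrow>\<^sub>L real"
      by (rule set_integrable_subset[OF int A])
    define l where "l f = (LINT t:A|lebesgue. blinfun_apply f (g t))" for f :: "'a \<Rightarrow>\<^sub>L real"
    have "linear l"
      unfolding l_def by (rule linearI) (simp_all add: blinfun.add_left blinfun.scaleR_left set_integral_add(2)[OF intA intA])
    moreover have "l f \<le> support_fun f W" for f
      unfolding W(2) l_def using up A(2)
      by (intro set_integral_mono intA scalarly_integrable_set_integrable[OF si A]) auto
    ultimately obtain w where "\<And>f :: 'a \<Rightarrow>\<^sub>L real. l f = blinfun_apply f w" using dominated_evaluation[OF W(1)] by metis
    then have "is_pettis_integral (\<lambda>t. {g t}) A {w}" by (simp add: is_pettis_integral_def l_def)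
    then show ?thesis ..
  qed
  ultimately show ?thesis by (simp add: pettis_integrable_fun_def)
qed

text \<open>The set-valued notion permits any integral in \<open>cwk\<close>; treating
  \<open>g\<close> as a selection of its own singletons shows that vectors can be taken.\<close>

lemma pettis_integrable_fun_iff:
  fixes g :: "real \<Rightarrow> 'a::banach"
  shows "pettis_integrable_fun g \<longleftrightarrow> pettis_integrable (\<lambda>t. {g t})"
proof
  assume "pettis_integrable_fun g"
  then show "pettis_integrable (\<lambda>t. {g t})"
    using cwk_singleton unfolding pettis_integrable_fun_def pettis_integrable_def by blast
next
  assume P: "pettis_integrable (\<lambda>t. {g t})"
  then have "set_integrable lebesgue {0..1} (\<lambda>t. support_fun f {g t})" for f
    by (intro scalarly_integrable_set_integrable) (auto simp: pettis_integrable_def)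
  then have "(\<lambda>t. indicator {0..1} t *\<^sub>R blinfun_apply f (g t)) \<in> borel_measurable lebesgue" for f :: "'a \<Rightarrow>\<^sub>L real"
    unfolding set_integrable_def support_fun_singleton by (rule borel_measurable_integrable)
  then show "pettis_integrable_fun g"
    using P by (intro pettis_selection[of "\<lambda>t. {g t}"]) (auto simp: cwk_singleton selections_def)
qed

text \<open>H-integrability contributes only the measurability of the scalar functions; the rest is
  domination by \<open>\<Gamma>\<close>.\<close>

lemma H_selection_of_pettis:
  fixes \<Gamma> :: "real \<Rightarrow> 'a::banach set"
  assumes \<Gamma>: "\<forall>t\<in>{0..1}. \<Gamma> t \<in> cwk" and P: "pettis_integrable \<Gamma>" and g: "g \<in> selections \<Gamma>" "H_integrable_fun g"
  shows "pettis_integrable_fun g"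
proof -
  obtain w where w: "is_H_integral (\<lambda>t. {g t}) {w}" using g(2) by (auto simp: H_integrable_fun_def)
  have "((\<lambda>t. blinfun_apply f (g t)) has_integral blinfun_apply f w) {0..1}" for f :: "'a \<Rightarrow>\<^sub>L real"
    using H_integral_has_integral[OF _ cwk_singleton w, of f] by (simp add: cwk_singleton)
  then show ?thesis
    using has_integral_implies_lebesgue_measurable by (intro pettis_selection[OF \<Gamma> P g(1)]) blast
qed

text \<open>
  Subtracting the selection makes the support functions nonnegative. Hence they are Lebesgue
  integrable, and their integrals over subsets are dominated by a translate of the integral.
\<close>

lemma H_with_pettis_selection:
  fixes \<Gamma> :: "real \<Rightarrow> 'a::banach set"
  assumes \<Gamma>: "\<forall>t\<in>{0..1}. \<Gamma> t \<in> cwk" and W: "W \<in> cwk" "is_H_integral \<Gamma> W"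
    and g: "g \<in> selections \<Gamma>" "pettis_integrable_fun g"
  shows "pettis_integrable \<Gamma>"
proof -
  have up: "blinfun_apply f (g t) \<le> support_fun f (\<Gamma> t)" if "t \<in> {0..1}" for f :: "'a \<Rightarrow>\<^sub>L real" and t
    using \<Gamma> g(1) that by (intro support_fun_upper cwk_bounded) (auto simp: selections_def)
  have ig: "set_integrable lebesgue A (\<lambda>t. blinfun_apply f (g t))" if "A \<in> sets lebesgue" "A \<subseteq> {0..1}" for A and f :: "'a \<Rightarrow>\<^sub>L real"
    using scalarly_integrable_set_integrable[of "\<lambda>t. {g t}" A f] g(2) that by (simp add: pettis_integrable_fun_def)
  have hk: "((\<lambda>t. support_fun f (\<Gamma> t)) has_integral support_fun f W) {0..1}" for f
    by (rule H_integral_has_integral[OF \<Gamma> W])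
  have diff: "set_integrable lebesgue {0..1} (\<lambda>t. support_fun f (\<Gamma> t) - blinfun_apply f (g t))" for f :: "'a \<Rightarrow>\<^sub>L real"
  proof (rule nonnegative_absolutely_integrable_1)
    show "(\<lambda>t. support_fun f (\<Gamma> t) - blinfun_apply f (g t)) integrable_on {0..1}"
      using hk[of f] set_lebesgue_integral_eq_integral(1)[OF ig, of "{0..1}" f]
      by (intro integrable_diff) (auto simp: integrable_on_def)
  qed (use up in simp)
  have "set_integrable lebesgue {0..1} (\<lambda>t. support_fun f (\<Gamma> t))" for f
    using set_integral_add(1)[OF diff[of f] ig[of "{0..1}" f]] by simp
  then have si: "scalarly_integrable \<Gamma>" by (rule scalarly_integrableI)
  have ex: "\<exists>w. \<forall>f :: 'a \<Rightarrow>\<^sub>L real. blinfun_apply f w = (LINT t:E|lebesgue. blinfun_apply f (g t))" if "E \<in> sets lebesgue" "E \<subseteq> {0..1}" for E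
    using g(2) that by (simp add: pettis_integrable_fun_def is_pettis_integral_def sets_unit_iff)
  show ?thesis
  proof (rule pettis_integrable_if_dominated[OF \<Gamma> si])
    fix E :: "real set" and e :: real assume E: "E \<in> sets lebesgue" "E \<subseteq> {0..1}" and e: "0 < e"
    obtain w where w: "\<And>f :: 'a \<Rightarrow>\<^sub>L real. blinfun_apply f w = (LINT t:E|lebesgue. blinfun_apply f (g t))" using ex[OF E] by blast
    obtain v where v: "\<And>f :: 'a \<Rightarrow>\<^sub>L real. blinfun_apply f v = (LINT t:{0..1}|lebesgue. blinfun_apply f (g t))" using ex[of "{0..1}"] by auto
    \<comment> \<open>\<open>w\<close> and \<open>v\<close> are the integrals of \<open>g\<close>
      over \<open>E\<close> and over the unit interval: enlarging \<open>E\<close> for the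
      nonnegative difference adds the integral \<open>W\<close> minus \<open>v\<close>, and undoing
      the subtraction of \<open>g\<close> adds \<open>w\<close>.\<close>
    have C: "{w - v} + W \<in> cwk" by (intro cwk_plus cwk_singleton W(1))
    have "(LINT t:E|lebesgue. support_fun f (\<Gamma> t)) \<le> support_fun f ({w - v} + W) + e" for f :: "'a \<Rightarrow>\<^sub>L real"
    proof -
      note i\<phi> = scalarly_integrable_set_integrable[OF si]
      have s01: "(LINT t:{0..1}|lebesgue. support_fun f (\<Gamma> t)) = support_fun f W"
        using has_integral_unique[OF has_integral_set_lebesgue[OF i\<phi>] hk[of f]] by simp
      have dE: "set_integrable lebesgue E (\<lambda>t. support_fun f (\<Gamma> t) - blinfun_apply f (g t))"
        by (rule set_integrable_subset[OF diff E])
      have "(LINT t:E|lebesgue. support_fun f (\<Gamma> t)) - blinfun_apply f w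
          = (LINT t:E|lebesgue. support_fun f (\<Gamma> t) - blinfun_apply f (g t))"
        unfolding w by (rule set_integral_diff(2)[OF i\<phi>[OF E] ig[OF E], symmetric])
      also have "\<dots> \<le> (LINT t:{0..1}|lebesgue. support_fun f (\<Gamma> t) - blinfun_apply f (g t))"
        using dE diff[of f] up E(2) unfolding set_lebesgue_integral_def set_integrable_def
        by (intro integral_mono) (auto simp: indicator_def)
      also have "\<dots> = support_fun f W - blinfun_apply f v"
        unfolding v s01[symmetric] by (rule set_integral_diff(2)) (auto intro: i\<phi> ig)
      finally have "(LINT t:E|lebesgue. support_fun f (\<Gamma> t)) \<le> blinfun_apply f (w - v) + support_fun f W"
        by (simp add: blinfun.diff_right)
      moreover have "support_fun f ({w - v} + W) = blinfun_apply f (w - v) + support_fun f W"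
        using support_fun_plus[of "{w - v}" W f] W(1) by (simp add: cwk_bounded cwk_nonempty)
      ultimately show ?thesis using e by simp
    qed
    then show "\<exists>C\<in>cwk. \<forall>f. norm f \<le> 1 \<longrightarrow> (LINT t:E|lebesgue. support_fun f (\<Gamma> t)) \<le> support_fun f C + e"
      using C by blast
  qed
qed

section \<open>Functions as multifunctions with singleton values\<close>

lemma birkhoff_imp_mcshane_fun:
  "birkhoff_integrable_fun g \<Longrightarrow> mcshane_integrable_fun g"
  unfolding birkhoff_integrable_fun_def mcshane_integrable_fun_def
  using birkhoff_imp_H_mcshane(2)[OF _ cwk_singleton] by (metis cwk_singleton)

lemma mcshane_imp_pettis_fun:
  "mcshane_integrable_fun g \<Longrightarrow> pettis_integrable_fun g" for g :: "real \<Rightarrow> 'a::banach"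
  unfolding mcshane_integrable_fun_def pettis_integrable_fun_iff
  using mcshane_imp_pettis[OF _ cwk_singleton] by (metis cwk_singleton)

lemma H_pettis_imp_birkhoff_fun:
  "H_integrable_fun g \<Longrightarrow> pettis_integrable_fun g \<Longrightarrow> birkhoff_integrable_fun g" for g :: "real \<Rightarrow> 'a::banach"
  unfolding H_integrable_fun_def pettis_integrable_fun_iff birkhoff_integrable_fun_def
  using H_pettis_imp_birkhoff[OF _ cwk_singleton] by (metis cwk_singleton)

text \<open>Condition (vi) is the hub: it is equivalent to (i) and follows from (v). The three
  inclusions coincide, because for H-integrable functions the Birkhoff, McShane and Pettis
  integrability are the same; together with an H-integrable selection they give (v).\<close>

theorem theorem4p3:
  fixes \<Gamma> :: "real \<Rightarrow> 'a::banach set"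
  assumes "\<forall>t\<in>{0..1}. \<Gamma> t \<in> cwk"
  shows "(birkhoff_integrable \<Gamma> \<longleftrightarrow> (H_integrable \<Gamma> \<and> S_H \<Gamma> \<subseteq> S_Bi \<Gamma>))
       \<and> (birkhoff_integrable \<Gamma> \<longleftrightarrow> (H_integrable \<Gamma> \<and> S_H \<Gamma> \<subseteq> S_MS \<Gamma>))
       \<and> (birkhoff_integrable \<Gamma> \<longleftrightarrow> (H_integrable \<Gamma> \<and> S_H \<Gamma> \<subseteq> S_P \<Gamma>))
       \<and> (birkhoff_integrable \<Gamma> \<longleftrightarrow> (H_integrable \<Gamma> \<and> S_P \<Gamma> \<noteq> {}))
       \<and> (birkhoff_integrable \<Gamma> \<longleftrightarrow> (pettis_integrable \<Gamma> \<and> H_integrable \<Gamma>))"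
proof -
  have BH: "H_integrable \<Gamma>" and BP: "pettis_integrable \<Gamma>" if "birkhoff_integrable \<Gamma>"
    using that birkhoff_imp_H_mcshane[OF assms] mcshane_imp_pettis[OF assms]
    unfolding birkhoff_integrable_def H_integrable_def by blast+
  \<comment> \<open>If \<open>S_H\<close> were empty, the inclusions would hold trivially and
    provide no Pettis integrable selection.\<close>
  have sel: "S_H \<Gamma> \<noteq> {}" if "H_integrable \<Gamma>"
    using that H_integrable_selection[OF assms] by (auto simp: H_integrable_def S_H_def)
  have PB: "birkhoff_integrable \<Gamma>" if "pettis_integrable \<Gamma>" "H_integrable \<Gamma>"
    using that H_pettis_imp_birkhoff[OF assms] by (auto simp: H_integrable_def birkhoff_integrable_def)
  have SP: "pettis_integrable \<Gamma>" if "H_integrable \<Gamma>" "S_P \<Gamma> \<noteq> {}"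
    using that H_with_pettis_selection[OF assms] by (auto simp: H_integrable_def S_P_def)
  have "S_H \<Gamma> \<subseteq> S_P \<Gamma>" if "pettis_integrable \<Gamma>"
    using H_selection_of_pettis[OF assms that] by (auto simp: S_H_def S_P_def)
  moreover have "S_H \<Gamma> \<subseteq> S_Bi \<Gamma>" if "S_H \<Gamma> \<subseteq> S_P \<Gamma>"
    using that H_pettis_imp_birkhoff_fun by (auto simp: S_H_def S_P_def S_Bi_def)
  moreover have "S_Bi \<Gamma> \<subseteq> S_MS \<Gamma>" "S_MS \<Gamma> \<subseteq> S_P \<Gamma>"
    using birkhoff_imp_mcshane_fun mcshane_imp_pettis_fun by (auto simp: S_Bi_def S_MS_def S_P_def)
  ultimately show ?thesis using BH BP sel PB SP by blast
qed

end
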